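(* Let $M$ be a $2n$-dimensional manifold with bundle of linear frames $FM$. For each (local) section $\sigma$ of the quotient bundle $FM/\Delta GL(n;\mathbb{R})\to M$, let $(F_\sigma,P_\sigma)$ be the almost biparacomplex structure associated to $\sigma$. Then the assignment to each section $\sigma$ of the canonical connection of $(F_\sigma,P_\sigma)$ is a functorial connection attached to the $\Delta GL(n;\mathbb{R})$-structures over $M$.
   Context: Manifolds and maps are $C^\infty$. An almost biparacomplex structure is a pair $(F,P)$ of tensor fields of type $(1,1)$ with $F^2=P^2=\mathrm{Id}$ and $F\circ P+P\circ F=0$. Put $T_F^{\pm}=\ker(F\mp\mathrm{Id})$. The canonical connection of $(F,P)$ is the unique linear connection $\nabla$ such that $\nabla F=0=\nabla P$ and whose torsion $T$ satisfies $T(X,Y)=0$ for all $X\in T_F^+$, $Y\in T_F^-$. $\Delta GL(n;\mathbb{R})=\left\{\begin{pmatrix}A&0\\0&A\end{pmatrix}: A\in GL(n;\mathbb{R})\right\}\subset GL(2n;\mathbb{R})$. For a closed subgroup $G\subseteq GL(m;\mathbb{R})$, $m=\dim M$, sections $s$ of $FM/G\to M$ over an open set $U$ correspond bijectively to $G$-structures over $U$ via $\mathcal{B}_s=\{u\in FU: u\cdot G=s(\pi(u))\}$, $\pi\colon FM\to M$ being the projection. For $G=\Delta GL(n;\mathbb{R})$, $(F_\sigma,P_\sigma)$ is the almost biparacomplex structure whose adapted frames are the elements of $\mathcal{B}_\sigma$: a frame $(X_1,\ldots,X_n,Y_1,\ldots,Y_n)$ belongs to $\mathcal{B}_\sigma$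 iff $\{X_1,\ldots,X_n\}$ is a basis of $T_{F_\sigma}^+$ at the base point and $Y_i=P_\sigma X_i$ for all $i$. A diffeomorphism $\varphi\colon U\to U'$ acts on frames by $\tilde\varphi(X_1,\ldots,X_m)=(\varphi_*X_1,\ldots,\varphi_*X_m)$, inducing a map $\bar\varphi\colon FU/G\to FU'/G$, and on sections by $\varphi\cdot s=\bar\varphi\circ s\circ\varphi^{-1}$. Let $C(M)\to M$ be the affine bundle whose sections are the linear connections on $M$. A functorial connection attached to the $G$-structures over $M$ is a presheaf morphism $s\mapsto\nabla(s)$ from the sheaf of sections of $FM/G\to M$ into the presheaf of sections of $C(M)\to M$ such that: (1) if $s$ is a section of $FM/G\to M$ on an open subset $U\subseteq M$, then $\nabla(s)$ is a linear connection on $U$ adapted to the $G$-structure defined by $s$, i.e. reducible to the subbundle $\mathcal{B}_s$; (2) if $\varphi\colon U\to U'$ is a diffeomorphism (between open subsets), then $\nabla(\varphi\cdot s)=\varphi\cdot\nabla(s)$, the direct image of the connection $\nabla(s)$ by $\varphi$; (3) there exists a non-negative integer $r$ such that $\nabla$ factors smoothly through the $r$-jet bundle $J^r(FM/G)$: the value $\nabla(s)(x)$ depends only on $j^r_xs$, and the induced map $\nabla^r\colon J^r(FM/G)\to C(M)$, $\nabla^r(j^r_xs)=\nabla(s)(x)$, is differentiable. *)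

theory Defs
  imports "HOL-Analysis.Analysis" "HOL-Library.Multiset"
begin

section \<open>Smooth maps between normed spaces\<close>

text \<open>Only used on open sets, and with finite-dimensional domain.\<close>

primrec differentiable_upto ::
  "nat \<Rightarrow> 'a::real_normed_vector set \<Rightarrow> ('a \<Rightarrow> 'b::real_normed_vector) \<Rightarrow> bool" where
  "differentiable_upto 0 S f \<longleftrightarrow> continuous_on S f"
| "differentiable_upto (Suc k) S f \<longleftrightarrow>
     (\<forall>x\<in>S. f differentiable (at x)) \<and>
     (\<forall>v. differentiable_upto k S (\<lambda>x. frechet_derivative f (at x) v))"

definition smooth_on :: "'a::real_normed_vector set \<Rightarrow> ('a \<Rightarrow> 'b::real_normed_vector) \<Rightarrow> bool" where
  "smooth_on S f \<longleftrightarrow> (\<forall>k. differentiable_upto k S f)"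

section \<open>Smooth manifolds\<close>

type_synonym ('a, 'm) chart = "'a set \<times> ('a \<Rightarrow> real ^ 'm)"

abbreviation chart_inv :: "('a, 'm) chart \<Rightarrow> real ^ 'm \<Rightarrow> 'a" where
  "chart_inv c \<equiv> inv_into (fst c) (snd c)"

definition is_chart :: "('a::topological_space, 'm::finite) chart \<Rightarrow> bool" where
  "is_chart c \<longleftrightarrow> open (fst c) \<and> open (snd c ` fst c) \<and>
     homeomorphism (fst c) (snd c ` fst c) (snd c) (chart_inv c)"

text \<open>The manifold is the whole type; its Hausdorff and second countability axioms are the sort
  constraints. Its dimension is \<open>CARD('m)\<close>.\<close>

definition smooth_atlas ::
  "('a::{t2_space, second_countable_topology}, 'm::finite) chart set \<Rightarrow> bool" where
  "smooth_atlas \<A> \<longleftrightarrow>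
     (\<forall>c\<in>\<A>. is_chart c) \<and> (\<Union>c\<in>\<A>. fst c) = UNIV \<and>
     (\<forall>c\<in>\<A>. \<forall>d\<in>\<A>. smooth_on (snd c ` (fst c \<inter> fst d)) (snd d \<circ> chart_inv c))"

section \<open>Tangent vectors and vector fields\<close>

text \<open>A tangent vector at \<open>x\<close> is represented by its components in one chart chosen around \<open>x\<close>.
  Thus every tangent space is \<open>real ^ 'm\<close>, but how the tangent spaces fit together is expressed only
  through \<open>to_coords\<close>, which gives the components in an arbitrary chart, and its inverse
  \<open>from_coords\<close>.\<close>

definition chart_at :: "('a, 'm) chart set \<Rightarrow> 'a \<Rightarrow> ('a, 'm) chart" where
  "chart_at \<A> x = (SOME c. c \<in> \<A> \<and> x \<in> fst c)"

definition to_coords ::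
  "('a, 'm::finite) chart set \<Rightarrow> ('a, 'm) chart \<Rightarrow> 'a \<Rightarrow> real ^ 'm \<Rightarrow> real ^ 'm" where
  "to_coords \<A> c x =
     frechet_derivative (snd c \<circ> chart_inv (chart_at \<A> x)) (at (snd (chart_at \<A> x) x))"

definition from_coords ::
  "('a, 'm::finite) chart set \<Rightarrow> ('a, 'm) chart \<Rightarrow> 'a \<Rightarrow> real ^ 'm \<Rightarrow> real ^ 'm" where
  "from_coords \<A> c x =
     frechet_derivative (snd (chart_at \<A> x) \<circ> chart_inv c) (at (snd c x))"

definition field_rep ::
  "('a, 'm::finite) chart set \<Rightarrow> ('a, 'm) chart \<Rightarrow> ('a \<Rightarrow> real ^ 'm) \<Rightarrow> real ^ 'm \<Rightarrow> real ^ 'm" where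
  "field_rep \<A> c X = (\<lambda>y. to_coords \<A> c (chart_inv c y) (X (chart_inv c y)))"

definition vector_field ::
  "('a::topological_space, 'm::finite) chart set \<Rightarrow> 'a set \<Rightarrow> ('a \<Rightarrow> real ^ 'm) \<Rightarrow> bool" where
  "vector_field \<A> V X \<longleftrightarrow> open V \<and>
     (\<forall>c\<in>\<A>. smooth_on (snd c ` (V \<inter> fst c)) (field_rep \<A> c X))"

definition coord_field ::
  "('a, 'm::finite) chart set \<Rightarrow> ('a, 'm) chart \<Rightarrow> 'm \<Rightarrow> 'a \<Rightarrow> real ^ 'm" where
  "coord_field \<A> c i = (\<lambda>x. from_coords \<A> c x (axis i 1))"

text \<open>The derivative of the components of \<open>Y\<close> in the chosen chart around \<open>x\<close>, in direction \<open>v\<close>.\<close>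

definition component_deriv ::
  "('a, 'm::finite) chart set \<Rightarrow> 'a \<Rightarrow> real ^ 'm \<Rightarrow> ('a \<Rightarrow> real ^ 'm) \<Rightarrow> real ^ 'm" where
  "component_deriv \<A> x v Y =
     frechet_derivative (field_rep \<A> (chart_at \<A> x) Y) (at (snd (chart_at \<A> x) x)) v"

definition lie_bracket ::
  "('a, 'm::finite) chart set \<Rightarrow> ('a \<Rightarrow> real ^ 'm) \<Rightarrow> ('a \<Rightarrow> real ^ 'm) \<Rightarrow> 'a \<Rightarrow> real ^ 'm" where
  "lie_bracket \<A> X Y = (\<lambda>x. component_deriv \<A> x (X x) Y - component_deriv \<A> x (Y x) X)"

text \<open>Tensor fields of type (1,1) are families of endomorphisms of the tangent spaces.\<close>

definition endo_field ::
  "('a::topological_space, 'm::finite) chart set \<Rightarrow> 'a set \<Rightarrow> ('a \<Rightarrow> real ^ 'm ^ 'm) \<Rightarrow> bool" where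
  "endo_field \<A> U F \<longleftrightarrow> open U \<and> F \<in> extensional U \<and>
     (\<forall>c\<in>\<A>. smooth_on (snd c ` (U \<inter> fst c))
        (\<lambda>y. let x = chart_inv c y
             in matrix (\<lambda>w. to_coords \<A> c x (F x *v from_coords \<A> c x w))))"

section \<open>Linear connections\<close>

text \<open>A point over \<open>x\<close> of the bundle of linear connections is given by its Christoffel symbols
  \<open>\<gamma> $ k $ i $ j\<close> in the chosen chart around \<open>x\<close>; a linear connection is a smooth section.\<close>

type_synonym 'm christoffel = "real ^ 'm ^ 'm ^ 'm"

definition christoffel_apply ::
  "'m::finite christoffel \<Rightarrow> real ^ 'm \<Rightarrow> real ^ 'm \<Rightarrow> real ^ 'm" where
  "christoffel_apply \<gamma> v w = (\<chi> k. \<Sum>i\<in>UNIV. \<Sum>j\<in>UNIV. \<gamma> $ k $ i $ j * v $ i * w $ j)"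

definition cov_deriv_at ::
  "('a, 'm::finite) chart set \<Rightarrow> 'a \<Rightarrow> 'm christoffel \<Rightarrow> real ^ 'm \<Rightarrow> ('a \<Rightarrow> real ^ 'm) \<Rightarrow> real ^ 'm" where
  "cov_deriv_at \<A> x \<gamma> v Y = component_deriv \<A> x v Y + christoffel_apply \<gamma> v (Y x)"

definition cov_deriv ::
  "('a, 'm::finite) chart set \<Rightarrow> ('a \<Rightarrow> 'm christoffel) \<Rightarrow>
   ('a \<Rightarrow> real ^ 'm) \<Rightarrow> ('a \<Rightarrow> real ^ 'm) \<Rightarrow> 'a \<Rightarrow> real ^ 'm" where
  "cov_deriv \<A> \<Gamma> X Y = (\<lambda>x. cov_deriv_at \<A> x (\<Gamma> x) (X x) Y)"

text \<open>Christoffel symbols in an arbitrary chart: the components of the covariant derivatives of the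
  coordinate fields. With the base point they are the coordinates of the bundle of linear
  connections.\<close>

definition conn_coords ::
  "('a, 'm::finite) chart set \<Rightarrow> ('a, 'm) chart \<Rightarrow> 'a \<Rightarrow> 'm christoffel \<Rightarrow> 'm christoffel" where
  "conn_coords \<A> c x \<gamma> = (\<chi> k i j.
     to_coords \<A> c x (cov_deriv_at \<A> x \<gamma> (coord_field \<A> c i x) (coord_field \<A> c j)) $ k)"

definition linear_connection ::
  "('a::topological_space, 'm::finite) chart set \<Rightarrow> 'a set \<Rightarrow> ('a \<Rightarrow> 'm christoffel) \<Rightarrow> bool" where
  "linear_connection \<A> U \<Gamma> \<longleftrightarrow> open U \<and> \<Gamma> \<in> extensional U \<and>
     (\<forall>c\<in>\<A>. smooth_on (snd c ` (U \<inter> fst c))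
        (\<lambda>y. conn_coords \<A> c (chart_inv c y) (\<Gamma> (chart_inv c y))))"

definition torsion ::
  "('a, 'm::finite) chart set \<Rightarrow> ('a \<Rightarrow> 'm christoffel) \<Rightarrow>
   ('a \<Rightarrow> real ^ 'm) \<Rightarrow> ('a \<Rightarrow> real ^ 'm) \<Rightarrow> 'a \<Rightarrow> real ^ 'm" where
  "torsion \<A> \<Gamma> X Y =
     (\<lambda>x. cov_deriv \<A> \<Gamma> X Y x - cov_deriv \<A> \<Gamma> Y X x - lie_bracket \<A> X Y x)"

definition cov_deriv_endo ::
  "('a, 'm::finite) chart set \<Rightarrow> ('a \<Rightarrow> 'm christoffel) \<Rightarrow> ('a \<Rightarrow> real ^ 'm ^ 'm) \<Rightarrow>
   ('a \<Rightarrow> real ^ 'm) \<Rightarrow> ('a \<Rightarrow> real ^ 'm) \<Rightarrow> 'a \<Rightarrow> real ^ 'm" where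
  "cov_deriv_endo \<A> \<Gamma> F X Y =
     (\<lambda>x. cov_deriv \<A> \<Gamma> X (\<lambda>y. F y *v Y y) x - F x *v cov_deriv \<A> \<Gamma> X Y x)"

definition parallel_endo ::
  "('a::topological_space, 'm::finite) chart set \<Rightarrow> 'a set \<Rightarrow> ('a \<Rightarrow> 'm christoffel) \<Rightarrow>
   ('a \<Rightarrow> real ^ 'm ^ 'm) \<Rightarrow> bool" where
  "parallel_endo \<A> U \<Gamma> F \<longleftrightarrow>
     (\<forall>V X Y. V \<subseteq> U \<longrightarrow> vector_field \<A> V X \<longrightarrow> vector_field \<A> V Y \<longrightarrow>
        (\<forall>x\<in>V. cov_deriv_endo \<A> \<Gamma> F X Y x = 0))"

section \<open>Almost biparacomplex structures and the canonical connection\<close>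

definition almost_biparacomplex ::
  "('a::topological_space, 'm::finite) chart set \<Rightarrow> 'a set \<Rightarrow>
   ('a \<Rightarrow> real ^ 'm ^ 'm) \<Rightarrow> ('a \<Rightarrow> real ^ 'm ^ 'm) \<Rightarrow> bool" where
  "almost_biparacomplex \<A> U F P \<longleftrightarrow> endo_field \<A> U F \<and> endo_field \<A> U P \<and>
     (\<forall>x\<in>U. F x ** F x = mat 1 \<and> P x ** P x = mat 1 \<and> F x ** P x + P x ** F x = 0)"

definition eigen_plus :: "real ^ 'm ^ 'm \<Rightarrow> (real ^ 'm::finite) set" where
  "eigen_plus B = {v. (B - mat 1) *v v = 0}"

definition eigen_minus :: "real ^ 'm ^ 'm \<Rightarrow> (real ^ 'm::finite) set" where
  "eigen_minus B = {v. (B + mat 1) *v v = 0}"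

definition is_canonical_connection ::
  "('a::topological_space, 'm::finite) chart set \<Rightarrow> 'a set \<Rightarrow>
   ('a \<Rightarrow> real ^ 'm ^ 'm) \<Rightarrow> ('a \<Rightarrow> real ^ 'm ^ 'm) \<Rightarrow> ('a \<Rightarrow> 'm christoffel) \<Rightarrow> bool" where
  "is_canonical_connection \<A> U F P \<Gamma> \<longleftrightarrow>
     linear_connection \<A> U \<Gamma> \<and> parallel_endo \<A> U \<Gamma> F \<and> parallel_endo \<A> U \<Gamma> P \<and>
     (\<forall>V X Y. V \<subseteq> U \<longrightarrow> vector_field \<A> V X \<longrightarrow> vector_field \<A> V Y \<longrightarrow>
        (\<forall>x\<in>V. X x \<in> eigen_plus (F x)) \<longrightarrow> (\<forall>x\<in>V. Y x \<in> eigen_minus (F x)) \<longrightarrow>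
        (\<forall>x\<in>V. torsion \<A> \<Gamma> X Y x = 0))"

definition canonical_connection ::
  "('a::topological_space, 'm::finite) chart set \<Rightarrow> 'a set \<Rightarrow>
   ('a \<Rightarrow> real ^ 'm ^ 'm) \<Rightarrow> ('a \<Rightarrow> real ^ 'm ^ 'm) \<Rightarrow> 'a \<Rightarrow> 'm christoffel" where
  "canonical_connection \<A> U F P = (THE \<Gamma>. is_canonical_connection \<A> U F P \<Gamma>)"

section \<open>Frames and sections of the quotient of the frame bundle by G\<close>

text \<open>A linear frame at \<open>x\<close> is an invertible matrix whose columns are the vectors of the frame, so
  that \<open>GL(m)\<close> acts on the right by matrix multiplication. Points of the frame bundle are pairs
  \<open>(x, u)\<close>; \<open>frame_chart\<close> is the chart of the frame bundle induced by a chart of the manifold.\<close>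

definition frame_coords ::
  "('a, 'm::finite) chart set \<Rightarrow> ('a, 'm) chart \<Rightarrow> 'a \<Rightarrow> real ^ 'm ^ 'm \<Rightarrow> real ^ 'm ^ 'm" where
  "frame_coords \<A> c x u = (\<chi> k i. to_coords \<A> c x (column i u) $ k)"

definition frame_chart ::
  "('a, 'm::finite) chart set \<Rightarrow> ('a, 'm) chart \<Rightarrow> 'a \<times> (real ^ 'm ^ 'm) \<Rightarrow> (real ^ 'm) \<times> (real ^ 'm ^ 'm)" where
  "frame_chart \<A> c = (\<lambda>(x, u). (snd c x, frame_coords \<A> c x u))"

definition frame_rep ::
  "('a, 'm::finite) chart set \<Rightarrow> ('a, 'm) chart \<Rightarrow> ('a \<Rightarrow> real ^ 'm ^ 'm) \<Rightarrow> real ^ 'm \<Rightarrow> real ^ 'm ^ 'm" where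
  "frame_rep \<A> c Z = (\<lambda>y. frame_coords \<A> c (chart_inv c y) (Z (chart_inv c y)))"

definition frame_field ::
  "('a::topological_space, 'm::finite) chart set \<Rightarrow> 'a set \<Rightarrow> ('a \<Rightarrow> real ^ 'm ^ 'm) \<Rightarrow> bool" where
  "frame_field \<A> V Z \<longleftrightarrow> open V \<and> (\<forall>x\<in>V. invertible (Z x)) \<and>
     (\<forall>c\<in>\<A>. smooth_on (snd c ` (V \<inter> fst c)) (frame_rep \<A> c Z))"

definition frame_orbit :: "real ^ 'm ^ 'm \<Rightarrow> (real ^ 'm ^ 'm) set \<Rightarrow> (real ^ 'm::finite ^ 'm) set" where
  "frame_orbit u G = (\<lambda>g. u ** g) ` G"

text \<open>Here and below \<open>G\<close> is a closed subgroup of \<open>GL(m)\<close>. The quotient carries the unique smooth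
  structure for which the projection of the frame bundle is a submersion, so the smooth sections are
  those which locally lift to smooth frame fields. Sections over \<open>U\<close> are \<open>undefined\<close> off \<open>U\<close>.\<close>

definition quotient_section ::
  "('a::topological_space, 'm::finite) chart set \<Rightarrow> (real ^ 'm ^ 'm) set \<Rightarrow> 'a set \<Rightarrow>
   ('a \<Rightarrow> (real ^ 'm ^ 'm) set) \<Rightarrow> bool" where
  "quotient_section \<A> G U s \<longleftrightarrow> open U \<and> s \<in> extensional U \<and>
     (\<forall>x\<in>U. \<exists>V Z. x \<in> V \<and> V \<subseteq> U \<and> frame_field \<A> V Z \<and> (\<forall>y\<in>V. s y = frame_orbit (Z y) G))"

definition G_structure ::
  "(real ^ 'm ^ 'm) set \<Rightarrow> 'a set \<Rightarrow> ('a \<Rightarrow> (real ^ 'm::finite ^ 'm) set) \<Rightarrow> ('a \<times> (real ^ 'm ^ 'm)) set" where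
  "G_structure G U s = {(x, u). x \<in> U \<and> invertible u \<and> frame_orbit u G = s x}"

section \<open>Reducibility of a linear connection to a subbundle of the frame bundle\<close>

text \<open>Tangent vectors of the frame bundle at \<open>(x, u)\<close> are written in the chart induced by the chosen
  chart around \<open>x\<close>. The horizontal lift of \<open>v\<close> is the initial velocity of a parallel frame along a
  curve with velocity \<open>v\<close>, whence its formula. A linear connection is reducible to a subbundle iff at
  the points of the subbundle the horizontal subspace is tangent to it.\<close>

definition horizontal_space ::
  "'m::finite christoffel \<Rightarrow> real ^ 'm ^ 'm \<Rightarrow> ((real ^ 'm) \<times> (real ^ 'm ^ 'm)) set" where
  "horizontal_space \<gamma> u =
     range (\<lambda>v. (v, \<chi> k i. - (christoffel_apply \<gamma> v (column i u) $ k)))"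

definition frame_tangent_space ::
  "('a, 'm::finite) chart set \<Rightarrow> ('a \<times> (real ^ 'm ^ 'm)) set \<Rightarrow> 'a \<Rightarrow> real ^ 'm ^ 'm \<Rightarrow>
   ((real ^ 'm) \<times> (real ^ 'm ^ 'm)) set" where
  "frame_tangent_space \<A> B x u =
     {w. \<exists>\<beta> \<epsilon>. (\<epsilon>::real) > 0 \<and> \<beta> 0 = (x, u) \<and>
           (\<forall>t\<in>{-\<epsilon><..<\<epsilon>}. \<beta> t \<in> B \<and> fst (\<beta> t) \<in> fst (chart_at \<A> x)) \<and>
           smooth_on {-\<epsilon><..<\<epsilon>} (frame_chart \<A> (chart_at \<A> x) \<circ> \<beta>) \<and>
           ((frame_chart \<A> (chart_at \<A> x) \<circ> \<beta>) has_vector_derivative w) (at 0)}"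

definition reducible_to ::
  "('a, 'm::finite) chart set \<Rightarrow> ('a \<Rightarrow> 'm christoffel) \<Rightarrow> ('a \<times> (real ^ 'm ^ 'm)) set \<Rightarrow> bool" where
  "reducible_to \<A> \<Gamma> B \<longleftrightarrow>
     (\<forall>(x, u)\<in>B. horizontal_space (\<Gamma> x) u \<subseteq> frame_tangent_space \<A> B x u)"

section \<open>Action of local diffeomorphisms\<close>

definition smooth_map_on ::
  "('a::topological_space, 'm::finite) chart set \<Rightarrow> 'a set \<Rightarrow> ('a \<Rightarrow> 'a) \<Rightarrow> bool" where
  "smooth_map_on \<A> U f \<longleftrightarrow> continuous_on U f \<and>
     (\<forall>c\<in>\<A>. \<forall>d\<in>\<A>. smooth_on (snd c ` (U \<inter> fst c \<inter> f -` fst d)) (snd d \<circ> f \<circ> chart_inv c))"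

definition diffeomorphism ::
  "('a::topological_space, 'm::finite) chart set \<Rightarrow> 'a set \<Rightarrow> 'a set \<Rightarrow> ('a \<Rightarrow> 'a) \<Rightarrow> bool" where
  "diffeomorphism \<A> U U' \<phi> \<longleftrightarrow> open U \<and> open U' \<and> bij_betw \<phi> U U' \<and>
     smooth_map_on \<A> U \<phi> \<and> smooth_map_on \<A> U' (inv_into U \<phi>)"

definition tangent_map ::
  "('a, 'm::finite) chart set \<Rightarrow> ('a \<Rightarrow> 'a) \<Rightarrow> 'a \<Rightarrow> real ^ 'm \<Rightarrow> real ^ 'm" where
  "tangent_map \<A> \<phi> x =
     frechet_derivative (snd (chart_at \<A> (\<phi> x)) \<circ> \<phi> \<circ> chart_inv (chart_at \<A> x))
       (at (snd (chart_at \<A> x) x))"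

definition push_field ::
  "('a, 'm::finite) chart set \<Rightarrow> ('a \<Rightarrow> 'a) \<Rightarrow> 'a set \<Rightarrow> ('a \<Rightarrow> real ^ 'm) \<Rightarrow> 'a \<Rightarrow> real ^ 'm" where
  "push_field \<A> \<phi> U X = (\<lambda>y. let x = inv_into U \<phi> y in tangent_map \<A> \<phi> x (X x))"

definition push_frame ::
  "('a, 'm::finite) chart set \<Rightarrow> ('a \<Rightarrow> 'a) \<Rightarrow> 'a \<Rightarrow> real ^ 'm ^ 'm \<Rightarrow> real ^ 'm ^ 'm" where
  "push_frame \<A> \<phi> x u = (\<chi> k i. tangent_map \<A> \<phi> x (column i u) $ k)"

definition push_section ::
  "('a, 'm::finite) chart set \<Rightarrow> ('a \<Rightarrow> 'a) \<Rightarrow> 'a set \<Rightarrow> 'a set \<Rightarrow>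
   ('a \<Rightarrow> (real ^ 'm ^ 'm) set) \<Rightarrow> 'a \<Rightarrow> (real ^ 'm ^ 'm) set" where
  "push_section \<A> \<phi> U U' s = (\<lambda>y\<in>U'. let x = inv_into U \<phi> y in push_frame \<A> \<phi> x ` s x)"

definition push_connection ::
  "('a::topological_space, 'm::finite) chart set \<Rightarrow> ('a \<Rightarrow> 'a) \<Rightarrow> 'a set \<Rightarrow> 'a set \<Rightarrow>
   ('a \<Rightarrow> 'm christoffel) \<Rightarrow> 'a \<Rightarrow> 'm christoffel" where
  "push_connection \<A> \<phi> U U' \<Gamma> = (THE \<Gamma>'. linear_connection \<A> U' \<Gamma>' \<and>
     (\<forall>V X Y. V \<subseteq> U \<longrightarrow> vector_field \<A> V X \<longrightarrow> vector_field \<A> V Y \<longrightarrow>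
        (\<forall>x\<in>V. cov_deriv \<A> \<Gamma>' (push_field \<A> \<phi> U X) (push_field \<A> \<phi> U Y) (\<phi> x) =
                tangent_map \<A> \<phi> x (cov_deriv \<A> \<Gamma> X Y x))))"

section \<open>Jets\<close>

text \<open>The dimension of the space of \<open>r\<close>-jets depends on \<open>r\<close>, so its coordinates range over the
  functions vanishing off a finite index set \<open>I\<close>, a copy of Euclidean space carrying the product
  topology.\<close>

primrec coord_differentiable_upto ::
  "nat \<Rightarrow> 'i set \<Rightarrow> ('i \<Rightarrow> real) set \<Rightarrow> (('i \<Rightarrow> real) \<Rightarrow> 'b::real_normed_vector) \<Rightarrow> bool" where
  "coord_differentiable_upto 0 I D f \<longleftrightarrow> continuous_on D f"
| "coord_differentiable_upto (Suc k) I D f \<longleftrightarrow> continuous_on D f \<and>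
     (\<forall>i\<in>I. (\<forall>p\<in>D. (\<lambda>t. f (p(i := t))) differentiable (at (p i))) \<and>
            coord_differentiable_upto k I D (\<lambda>p. vector_derivative (\<lambda>t. f (p(i := t))) (at (p i))))"

definition coord_smooth_on ::
  "'i set \<Rightarrow> ('i \<Rightarrow> real) set \<Rightarrow> (('i \<Rightarrow> real) \<Rightarrow> 'b::real_normed_vector) \<Rightarrow> bool" where
  "coord_smooth_on I D f \<longleftrightarrow> (\<forall>k. coord_differentiable_upto k I D f)"

primrec iter_partial ::
  "'m list \<Rightarrow> (real ^ 'm::finite \<Rightarrow> 'b::real_normed_vector) \<Rightarrow> real ^ 'm \<Rightarrow> 'b" where
  "iter_partial [] f = f"
| "iter_partial (i # l) f = (\<lambda>y. frechet_derivative (iter_partial l f) (at y) (axis i 1))"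

text \<open>A multiset is a multi-index; which of its enumerations is used is irrelevant, as partial
  derivatives of smooth functions commute.\<close>

definition multi_partial ::
  "'m multiset \<Rightarrow> (real ^ 'm::finite \<Rightarrow> 'b::real_normed_vector) \<Rightarrow> real ^ 'm \<Rightarrow> 'b" where
  "multi_partial \<mu> f = iter_partial (SOME l. mset l = \<mu>) f"

datatype 'm jet_index = Base 'm | Fibre "'m multiset" 'm 'm

definition jet_indices :: "nat \<Rightarrow> 'm jet_index set" where
  "jet_indices r = range Base \<union> {Fibre \<mu> k i |\<mu> k i. size \<mu> \<le> r}"

text \<open>The coordinates, induced by the chart \<open>c\<close>, of the \<open>r\<close>-jet at \<open>x\<close> of a frame field, and the
  open set in which they take their values.\<close>

definition frame_jet_coords ::
  "('a, 'm::finite) chart set \<Rightarrow> nat \<Rightarrow> ('a, 'm) chart \<Rightarrow> 'a \<Rightarrow> ('a \<Rightarrow> real ^ 'm ^ 'm) \<Rightarrow>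
   'm jet_index \<Rightarrow> real" where
  "frame_jet_coords \<A> r c x Z = (\<lambda>p. case p of
      Base i \<Rightarrow> snd c x $ i
    | Fibre \<mu> k i \<Rightarrow>
        if size \<mu> \<le> r then multi_partial \<mu> (frame_rep \<A> c Z) (snd c x) $ k $ i else 0)"

definition frame_jet_domain ::
  "nat \<Rightarrow> ('a, 'm::finite) chart \<Rightarrow> ('m jet_index \<Rightarrow> real) set" where
  "frame_jet_domain r c = {p. (\<forall>i. i \<notin> jet_indices r \<longrightarrow> p i = 0) \<and>
     (\<chi> i. p (Base i)) \<in> snd c ` fst c \<and> invertible (\<chi> k i. p (Fibre {#} k i))}"

text \<open>Since the projection of the frame bundle onto its quotient is a submersion, two sections of the
  quotient have the same \<open>r\<close>-jet iff they have local lifts with the same \<open>r\<close>-jet.\<close>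

definition same_jet ::
  "('a::topological_space, 'm::finite) chart set \<Rightarrow> (real ^ 'm ^ 'm) set \<Rightarrow> nat \<Rightarrow> 'a \<Rightarrow>
   ('a \<Rightarrow> (real ^ 'm ^ 'm) set) \<Rightarrow> ('a \<Rightarrow> (real ^ 'm ^ 'm) set) \<Rightarrow> bool" where
  "same_jet \<A> G r x s s' \<longleftrightarrow>
     (\<exists>V Z Z'. x \<in> V \<and> frame_field \<A> V Z \<and> frame_field \<A> V Z' \<and>
        (\<forall>y\<in>V. s y = frame_orbit (Z y) G \<and> s' y = frame_orbit (Z' y) G) \<and>
        frame_jet_coords \<A> r (chart_at \<A> x) x Z = frame_jet_coords \<A> r (chart_at \<A> x) x Z')"

type_synonym ('a, 'm) quotient_jet = "'a \<times> ('a set \<times> ('a \<Rightarrow> (real ^ 'm ^ 'm) set)) set"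

definition quotient_jet ::
  "('a::topological_space, 'm::finite) chart set \<Rightarrow> (real ^ 'm ^ 'm) set \<Rightarrow> nat \<Rightarrow> 'a \<Rightarrow>
   ('a \<Rightarrow> (real ^ 'm ^ 'm) set) \<Rightarrow> ('a, 'm) quotient_jet" where
  "quotient_jet \<A> G r x s =
     (x, {(U', s'). quotient_section \<A> G U' s' \<and> x \<in> U' \<and> same_jet \<A> G r x s s'})"

text \<open>The map from \<open>r\<close>-jets of frame fields to \<open>r\<close>-jets of sections of the quotient is a surjective
  submersion as well, so a fibred map from the latter jets to the bundle of linear connections is
  smooth iff its composite with this submersion is smooth in the coordinates
  \<open>frame_jet_coords\<close> and \<open>conn_coords\<close>.\<close>

definition smooth_on_quotient_jets ::
  "('a::topological_space, 'm::finite) chart set \<Rightarrow> (real ^ 'm ^ 'm) set \<Rightarrow> nat \<Rightarrow>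
   (('a, 'm) quotient_jet \<Rightarrow> 'm christoffel) \<Rightarrow> bool" where
  "smooth_on_quotient_jets \<A> G r N \<longleftrightarrow>
     (\<forall>c\<in>\<A>. \<exists>\<Phi>. coord_smooth_on (jet_indices r) (frame_jet_domain r c) \<Phi> \<and>
        (\<forall>V Z x. x \<in> V \<longrightarrow> V \<subseteq> fst c \<longrightarrow> frame_field \<A> V Z \<longrightarrow>
           conn_coords \<A> c x (N (quotient_jet \<A> G r x (\<lambda>y\<in>V. frame_orbit (Z y) G))) =
           \<Phi> (frame_jet_coords \<A> r c x Z)))"

section \<open>Functorial connections\<close>

definition functorial_connection ::
  "('a::topological_space, 'm::finite) chart set \<Rightarrow> (real ^ 'm ^ 'm) set \<Rightarrow>
   ('a set \<Rightarrow> ('a \<Rightarrow> (real ^ 'm ^ 'm) set) \<Rightarrow> 'a \<Rightarrow> 'm christoffel) \<Rightarrow> bool" where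
  "functorial_connection \<A> G nabla \<longleftrightarrow>
     (\<forall>U V s. quotient_section \<A> G U s \<longrightarrow> open V \<longrightarrow> V \<subseteq> U \<longrightarrow>
        nabla V (restrict s V) = restrict (nabla U s) V) \<and>
     (\<forall>U s. quotient_section \<A> G U s \<longrightarrow>
        linear_connection \<A> U (nabla U s) \<and> reducible_to \<A> (nabla U s) (G_structure G U s)) \<and>
     (\<forall>U U' \<phi> s. diffeomorphism \<A> U U' \<phi> \<longrightarrow> quotient_section \<A> G U s \<longrightarrow>
        nabla U' (push_section \<A> \<phi> U U' s) = push_connection \<A> \<phi> U U' (nabla U s)) \<and>
     (\<exists>r nabla_r. smooth_on_quotient_jets \<A> G r nabla_r \<and>
        (\<forall>U s x. quotient_section \<A> G U s \<longrightarrow> x \<in> U \<longrightarrow>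
           nabla_r (quotient_jet \<A> G r x s) = nabla U s x))"

section \<open>The structure group of almost biparacomplex structures\<close>

definition block_diag :: "real ^ 'n ^ 'n \<Rightarrow> real ^ ('n::finite + 'n) ^ ('n + 'n)" where
  "block_diag B = (\<chi> p q. case (p, q) of
      (Inl i, Inl j) \<Rightarrow> B $ i $ j
    | (Inr i, Inr j) \<Rightarrow> B $ i $ j
    | _ \<Rightarrow> 0)"

definition delta_GL :: "(real ^ ('n::finite + 'n) ^ ('n + 'n)) set" where
  "delta_GL = block_diag ` {B. invertible B}"

definition adapted_frame ::
  "real ^ ('n + 'n) ^ ('n + 'n) \<Rightarrow> real ^ ('n + 'n) ^ ('n + 'n) \<Rightarrow>
   real ^ ('n::finite + 'n) ^ ('n + 'n) \<Rightarrow> bool" where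
  "adapted_frame F P u \<longleftrightarrow> invertible u \<and>
     (let X = (\<lambda>i. column (Inl i) u); Y = (\<lambda>i. column (Inr i) u)
      in inj X \<and> independent (range X) \<and> span (range X) = eigen_plus F \<and> (\<forall>i. Y i = P *v X i))"

definition structure_of_section ::
  "('a::topological_space, 'n::finite + 'n) chart set \<Rightarrow> 'a set \<Rightarrow>
   ('a \<Rightarrow> (real ^ ('n + 'n) ^ ('n + 'n)) set) \<Rightarrow>
   ('a \<Rightarrow> real ^ ('n + 'n) ^ ('n + 'n)) \<times> ('a \<Rightarrow> real ^ ('n + 'n) ^ ('n + 'n))" where
  "structure_of_section \<A> U \<sigma> = (THE (F, P). almost_biparacomplex \<A> U F P \<and>
     (\<forall>x\<in>U. \<forall>u. (x, u) \<in> G_structure delta_GL U \<sigma> \<longleftrightarrow> adapted_frame (F x) (P x) u))"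

end

theory Submission
  imports Defs
begin

text \<open>
  Locally a section lifts to a frame field \<open>Z\<close>, and \<open>F = Z F\<^sub>0 Z\<^sup>-\<^sup>1\<close>, \<open>P = Z P\<^sub>0 Z\<^sup>-\<^sup>1\<close> for the
  model endomorphisms \<open>F\<^sub>0\<close>, \<open>P\<^sub>0\<close>, whose commutant is the Lie algebra of \<open>delta_GL\<close>. In terms of
  the value \<open>z\<close> and the differential \<open>D\<close> of \<open>Z\<close> at a point, a connection with Christoffel symbols
  \<open>\<gamma>\<close> preserves \<open>F\<close> and \<open>P\<close> iff \<open>z\<^sup>-\<^sup>1 (\<gamma>\<^sub>v z + D\<^sub>v)\<close> lies in this commutant for all \<open>v\<close>, and
  the torsion condition is linear in \<open>\<gamma>\<close>. Linear algebra shows that these conditions have exactly one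
  solution \<open>\<gamma>\<close>, given by a smooth function of \<open>(z, D)\<close>: this is existence, uniqueness, smoothness and
  dependence on the first jet only. The conditions do not depend on the lift \<open>Z\<close>, and as second
  derivatives are symmetric they are compatible with the law of change of coordinates of Christoffel
  symbols, which gives naturality. Reducibility holds since the horizontal lift at \<open>z g\<close> is the
  velocity of a curve \<open>Z g(t)\<close> with \<open>g(t)\<close> in \<open>delta_GL\<close>.
\<close>


section \<open>Calculus of smooth maps\<close>

text \<open>Uniqueness rests on an interplay of both structures. Let \<open>d\<close> be bilinear
  and commute with the model endomorphisms in its second argument. For \<open>a\<close> in the plus
  and \<open>b\<close> in the minus eigenspace of \<open>model_F\<close>, commutation puts
  \<open>d a b\<close> in the minus and \<open>d b a\<close> in the plus eigenspace, so the one
  torsion equation splits into two and fixes both values; \<open>model_P\<close> then reduces pairs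
  of equal type to mixed pairs. Read as a construction, the same splitting gives the explicit
  formula behind existence and smoothness. The obstacle is the representation: tangent vectors and
  Christoffel symbols are stored in a chart picked by choice at each point, so raw values say
  nothing about smoothness. Statements are therefore moved to a fixed chart, and a change of chart
  is treated as the identity diffeomorphism; one transformation law with its Hessian term then
  serves smoothness as well as naturality. As \<open>canonical_connection\<close> and
  \<open>push_connection\<close> are definite descriptions, identifying them needs uniqueness each
  time.\<close>

lemma differentiable_upto_imp_continuous: "differentiable_upto k S f \<Longrightarrow> continuous_on S f"
  by (cases k) (auto intro!: continuous_at_imp_continuous_on differentiable_imp_continuous_within)

lemma differentiable_upto_SucD: "differentiable_upto (Suc k) S f \<Longrightarrow> differentiable_upto k S f"
proof (induction k arbitrary: f)
  case 0
  then show ?case using differentiable_upto_imp_continuous[OF 0] by simp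
next
  case (Suc k)
  show ?case
    using Suc.prems Suc.IH by (subst differentiable_upto.simps) (metis differentiable_upto.simps(2))
qed

lemma differentiable_upto_subset:
  "differentiable_upto k S f \<Longrightarrow> T \<subseteq> S \<Longrightarrow> differentiable_upto k T f"
  by (induction k arbitrary: f) (auto intro: continuous_on_subset)

lemma differentiable_upto_has_derivative:
  "differentiable_upto (Suc k) S f \<Longrightarrow> x \<in> S \<Longrightarrow> (f has_derivative frechet_derivative f (at x)) (at x)"
  by (simp add: frechet_derivative_works)

lemma differentiable_upto_cong:
  assumes "differentiable_upto k S f" "open S" "\<And>x. x \<in> S \<Longrightarrow> f x = g x"
  shows "differentiable_upto k S g"
  using assms(1,3)
proof (induction k arbitrary: f g)
  case 0
  then show ?case by (simp cong: continuous_on_cong_simp)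
next
  case (Suc k)
  have D: "(g has_derivative frechet_derivative f (at x)) (at x)" if "x \<in> S" for x
    using has_derivative_transform_within_open[OF differentiable_upto_has_derivative[OF Suc.prems(1) that] assms(2) that]
      Suc.prems(2) by blast
  have eq: "frechet_derivative g (at x) = frechet_derivative f (at x)" if "x \<in> S" for x
    using frechet_derivative_at[OF D[OF that]] by simp
  have "differentiable_upto k S (\<lambda>x. frechet_derivative g (at x) v)" for v
    using Suc.IH[of "\<lambda>x. frechet_derivative f (at x) v"] Suc.prems(1) eq by simp
  then show ?case
    using D by (auto simp: differentiable_def)
qed

text \<open>Derivatives are unique, so any explicit derivative \<open>f'\<close> may stand in for
  the choice-defined \<open>frechet_derivative\<close>. The closure properties below exhibit
  \<open>f'\<close> and leave its values in fixed directions to the induction.\<close>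

lemma differentiable_upto_SucI:
  assumes "open S" "\<And>x. x \<in> S \<Longrightarrow> (f has_derivative f' x) (at x)"
    and "\<And>v. differentiable_upto k S (\<lambda>x. f' x v)"
  shows "differentiable_upto (Suc k) S f"
proof -
  have "differentiable_upto k S (\<lambda>x. frechet_derivative f (at x) v)" for v
    by (rule differentiable_upto_cong[OF assms(3)[of v] assms(1)])
       (use assms(2) frechet_derivative_at in metis)
  then show ?thesis using assms(2) by (auto simp: differentiable_def)
qed

lemma differentiable_upto_const: "open S \<Longrightarrow> differentiable_upto k S (\<lambda>x. c)"
proof (induction k arbitrary: c)
  case (Suc k)
  then show ?case by (intro differentiable_upto_SucI[where f' = "\<lambda>x v. 0"]) auto
qed auto

lemma differentiable_upto_ident: "open S \<Longrightarrow> differentiable_upto k S (\<lambda>x. x)"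
proof (cases k)
  case (Suc k)
  assume "open S"
  then show ?thesis unfolding Suc
    by (intro differentiable_upto_SucI[where f' = "\<lambda>x v. v"] differentiable_upto_const) auto
qed auto

lemma differentiable_upto_add:
  "open S \<Longrightarrow> differentiable_upto k S f \<Longrightarrow> differentiable_upto k S g \<Longrightarrow>
   differentiable_upto k S (\<lambda>x. f x + g x)"
proof (induction k arbitrary: f g)
  case 0
  then show ?case by (auto intro: continuous_on_add)
next
  case (Suc k)
  show ?case
    by (rule differentiable_upto_SucI[where f' = "\<lambda>x v. frechet_derivative f (at x) v + frechet_derivative g (at x) v"])
       (use Suc in \<open>auto intro!: has_derivative_add simp flip: frechet_derivative_works\<close>)
qed

lemma differentiable_upto_linear:
  assumes "bounded_linear h"
  shows "open S \<Longrightarrow> differentiable_upto k S f \<Longrightarrow> differentiable_upto k S (\<lambda>x. h (f x))"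
proof (induction k arbitrary: f)
  case 0
  then show ?case using bounded_linear.continuous_on[OF assms] by auto
next
  case (Suc k)
  show ?case
    by (rule differentiable_upto_SucI[where f' = "\<lambda>x v. h (frechet_derivative f (at x) v)"])
       (use Suc in \<open>auto intro!: bounded_linear.has_derivative[OF assms] simp flip: frechet_derivative_works\<close>)
qed

lemma differentiable_upto_bilinear:
  assumes "bounded_bilinear h"
  shows "open S \<Longrightarrow> differentiable_upto k S f \<Longrightarrow> differentiable_upto k S g \<Longrightarrow>
    differentiable_upto k S (\<lambda>x. h (f x) (g x))"
proof (induction k arbitrary: f g)
  case 0
  then show ?case using bounded_bilinear.continuous_on[OF assms] by auto
next
  case (Suc k)
  show ?case
  proof (rule differentiable_upto_SucI[where f' =
      "\<lambda>x v. h (f x) (frechet_derivative g (at x) v) + h (frechet_derivative f (at x) v) (g x)"])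
    show "((\<lambda>x. h (f x) (g x)) has_derivative
      (\<lambda>v. h (f x) (frechet_derivative g (at x) v) + h (frechet_derivative f (at x) v) (g x))) (at x)"
      if "x \<in> S" for x
      using Suc.prems that
      by (intro bounded_bilinear.FDERIV[OF assms] differentiable_upto_has_derivative) auto
    show "differentiable_upto k S
      (\<lambda>x. h (f x) (frechet_derivative g (at x) v) + h (frechet_derivative f (at x) v) (g x))" for v
      using Suc.prems
      by (intro differentiable_upto_add Suc.IH differentiable_upto_SucD[OF Suc.prems(2)]
          differentiable_upto_SucD[OF Suc.prems(3)]) auto
  qed (use Suc in auto)
qed

lemma differentiable_upto_sum:
  "open S \<Longrightarrow> (\<And>i. i \<in> I \<Longrightarrow> differentiable_upto k S (f i)) \<Longrightarrow>
   differentiable_upto k S (\<lambda>x. \<Sum>i\<in>I. f i x)"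
  by (induction I rule: infinite_finite_induct)
     (auto intro: differentiable_upto_add differentiable_upto_const)

lemma linear_eq_sum_Basis:
  fixes L :: "'a::euclidean_space \<Rightarrow> 'b::real_vector"
  assumes "linear L"
  shows "L w = (\<Sum>b\<in>Basis. (w \<bullet> b) *\<^sub>R L b)"
proof -
  have "L w = L (\<Sum>b\<in>Basis. (w \<bullet> b) *\<^sub>R b)" by (simp add: euclidean_representation)
  also have "\<dots> = (\<Sum>b\<in>Basis. (w \<bullet> b) *\<^sub>R L b)"
    using assms by (simp add: linear_sum linear_scale)
  finally show ?thesis .
qed

text \<open>\<open>differentiable_upto\<close> controls derivatives in constant directions only,
  whereas the chain rule evaluates the derivative of \<open>g\<close> in a direction varying with
  \<open>x\<close>. Expanding that direction in the basis of the Euclidean middle space leaves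
  scalar factors times derivatives of \<open>g\<close> in constant directions, to which the
  induction applies.\<close>

lemma differentiable_upto_compose:
  fixes f :: "'a::real_normed_vector \<Rightarrow> 'b::euclidean_space" and g :: "'b \<Rightarrow> 'c::real_normed_vector"
  assumes "open S" "open T" "f ` S \<subseteq> T"
  shows "differentiable_upto k S f \<Longrightarrow> differentiable_upto k T g \<Longrightarrow> differentiable_upto k S (\<lambda>x. g (f x))"
proof (induction k arbitrary: g)
  case 0
  then show ?case using assms continuous_on_compose2 by auto
next
  case (Suc k)
  have f: "(f has_derivative frechet_derivative f (at x)) (at x)" if "x \<in> S" for x
    using Suc.prems(1) that by (rule differentiable_upto_has_derivative)
  have g: "(g has_derivative frechet_derivative g (at y)) (at y)" if "y \<in> T" for y
    using Suc.prems(2) that by (rule differentiable_upto_has_derivative)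
  have eq: "frechet_derivative g (at (f x)) w =
    (\<Sum>b\<in>Basis. (w \<bullet> b) *\<^sub>R frechet_derivative g (at (f x)) b)" if "x \<in> S" for x w
  proof -
    have "f x \<in> T" using that assms(3) by blast
    then show ?thesis by (rule linear_eq_sum_Basis[OF has_derivative_linear[OF g]])
  qed
  let ?d = "\<lambda>x v. \<Sum>b\<in>Basis. (frechet_derivative f (at x) v \<bullet> b) *\<^sub>R frechet_derivative g (at (f x)) b"
  have 1: "((\<lambda>x. g (f x)) has_derivative ?d x) (at x)" if x: "x \<in> S" for x
  proof -
    have "f x \<in> T" using x assms(3) by blast
    from has_derivative_compose[OF f[OF x] g[OF this]]
    have "((\<lambda>x. g (f x)) has_derivative
      (\<lambda>v. frechet_derivative g (at (f x)) (frechet_derivative f (at x) v))) (at x)" .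
    moreover have "(\<lambda>v. frechet_derivative g (at (f x)) (frechet_derivative f (at x) v)) = ?d x"
      by (rule ext) (rule eq[OF x])
    ultimately show ?thesis by (rule back_subst[of "\<lambda>d. (_ has_derivative d) (at x)"])
  qed
  have 2: "differentiable_upto k S (\<lambda>x. ?d x v)" for v
  proof (intro differentiable_upto_sum[OF assms(1)] differentiable_upto_bilinear[OF bounded_bilinear_scaleR assms(1)])
    fix b :: 'b
    show "differentiable_upto k S (\<lambda>x. frechet_derivative f (at x) v \<bullet> b)"
      using Suc.prems(1) by (intro differentiable_upto_linear[OF bounded_linear_inner_left assms(1)]) simp
    show "differentiable_upto k S (\<lambda>x. frechet_derivative g (at (f x)) b)"
      using Suc.prems(2) by (intro Suc.IH[OF differentiable_upto_SucD[OF Suc.prems(1)]]) simp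
  qed
  show ?case
    by (rule differentiable_upto_SucI[OF assms(1) 1 2])
qed

lemma smooth_on_subset: "smooth_on S f \<Longrightarrow> T \<subseteq> S \<Longrightarrow> smooth_on T f"
  using differentiable_upto_subset unfolding smooth_on_def by blast

lemma smooth_on_cong:
  "smooth_on S f \<Longrightarrow> open S \<Longrightarrow> (\<And>x. x \<in> S \<Longrightarrow> f x = g x) \<Longrightarrow> smooth_on S g"
  using differentiable_upto_cong unfolding smooth_on_def by blast

lemma smooth_on_has_derivative:
  "smooth_on S f \<Longrightarrow> x \<in> S \<Longrightarrow> (f has_derivative frechet_derivative f (at x)) (at x)"
  using differentiable_upto_has_derivative unfolding smooth_on_def by blast

lemma smooth_on_imp_continuous: "smooth_on S f \<Longrightarrow> continuous_on S f"
  using differentiable_upto_imp_continuous unfolding smooth_on_def by blast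

lemma smooth_on_const: "open S \<Longrightarrow> smooth_on S (\<lambda>x. c)"
  by (simp add: smooth_on_def differentiable_upto_const)

lemma smooth_on_ident: "open S \<Longrightarrow> smooth_on S (\<lambda>x. x)"
  by (simp add: smooth_on_def differentiable_upto_ident)

lemma smooth_on_add:
  "open S \<Longrightarrow> smooth_on S f \<Longrightarrow> smooth_on S g \<Longrightarrow> smooth_on S (\<lambda>x. f x + g x)"
  by (simp add: smooth_on_def differentiable_upto_add)

lemma smooth_on_linear:
  "bounded_linear h \<Longrightarrow> open S \<Longrightarrow> smooth_on S f \<Longrightarrow> smooth_on S (\<lambda>x. h (f x))"
  by (simp add: smooth_on_def differentiable_upto_linear)

lemma smooth_on_bilinear:
  "bounded_bilinear h \<Longrightarrow> open S \<Longrightarrow> smooth_on S f \<Longrightarrow> smooth_on S g \<Longrightarrow>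
   smooth_on S (\<lambda>x. h (f x) (g x))"
  by (simp add: smooth_on_def differentiable_upto_bilinear)

lemma smooth_on_uminus: "open S \<Longrightarrow> smooth_on S f \<Longrightarrow> smooth_on S (\<lambda>x. - f x)"
  using smooth_on_linear[of uminus] bounded_linear_minus[OF bounded_linear_ident] by blast

lemma smooth_on_diff:
  "open S \<Longrightarrow> smooth_on S f \<Longrightarrow> smooth_on S g \<Longrightarrow> smooth_on S (\<lambda>x. f x - g x)"
  using smooth_on_add[of S f "\<lambda>x. - g x"] smooth_on_uminus[of S g] by simp

lemma smooth_on_scaleR:
  "open S \<Longrightarrow> smooth_on S f \<Longrightarrow> smooth_on S g \<Longrightarrow> smooth_on S (\<lambda>x. f x *\<^sub>R g x)"
  by (rule smooth_on_bilinear[OF bounded_bilinear_scaleR])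

lemma smooth_on_mult:
  fixes f g :: "'a::real_normed_vector \<Rightarrow> real"
  shows "open S \<Longrightarrow> smooth_on S f \<Longrightarrow> smooth_on S g \<Longrightarrow> smooth_on S (\<lambda>x. f x * g x)"
  by (rule smooth_on_bilinear[OF bounded_bilinear_mult])

lemma smooth_on_sum:
  "open S \<Longrightarrow> (\<And>i. i \<in> I \<Longrightarrow> smooth_on S (f i)) \<Longrightarrow> smooth_on S (\<lambda>x. \<Sum>i\<in>I. f i x)"
  by (simp add: smooth_on_def differentiable_upto_sum)

lemma smooth_on_prod:
  fixes f :: "'i \<Rightarrow> 'a::real_normed_vector \<Rightarrow> real"
  shows "open S \<Longrightarrow> (\<And>i. i \<in> I \<Longrightarrow> smooth_on S (f i)) \<Longrightarrow> smooth_on S (\<lambda>x. \<Prod>i\<in>I. f i x)"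
  by (induction I rule: infinite_finite_induct) (auto intro: smooth_on_mult smooth_on_const)

lemma smooth_on_compose:
  fixes f :: "'a::real_normed_vector \<Rightarrow> 'b::euclidean_space"
  shows "open S \<Longrightarrow> open T \<Longrightarrow> f ` S \<subseteq> T \<Longrightarrow> smooth_on S f \<Longrightarrow> smooth_on T g \<Longrightarrow>
    smooth_on S (\<lambda>x. g (f x))"
  by (simp add: smooth_on_def differentiable_upto_compose)

lemma smooth_on_frechet_derivative_const:
  "smooth_on S f \<Longrightarrow> smooth_on S (\<lambda>x. frechet_derivative f (at x) v)"
  unfolding smooth_on_def by (metis differentiable_upto.simps(2))

text \<open>The direction \<open>g x\<close> moves with the point; a basis expansion reduces it to
  constant directions, as in the chain rule.\<close>

lemma smooth_on_frechet_derivative: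
  fixes f :: "'a::euclidean_space \<Rightarrow> 'b::real_normed_vector"
  assumes "open S" "smooth_on S f" "smooth_on S g"
  shows "smooth_on S (\<lambda>x. frechet_derivative f (at x) (g x))"
proof (rule smooth_on_cong)
  show "smooth_on S (\<lambda>x. \<Sum>b\<in>Basis. (g x \<bullet> b) *\<^sub>R frechet_derivative f (at x) b)"
    by (rule smooth_on_sum[OF assms(1) smooth_on_scaleR[OF assms(1) 
        smooth_on_linear[OF bounded_linear_inner_left assms(1,3)]
        smooth_on_frechet_derivative_const[OF assms(2)]]])
  show "(\<Sum>b\<in>Basis. (g x \<bullet> b) *\<^sub>R frechet_derivative f (at x) b) = frechet_derivative f (at x) (g x)"
    if "x \<in> S" for x
    by (rule linear_eq_sum_Basis[OF has_derivative_linear[OF smooth_on_has_derivative[OF assms(2) that]], symmetric])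
qed (fact assms(1))

lemma smooth_on_local:
  assumes "\<And>x. x \<in> S \<Longrightarrow> \<exists>T. open T \<and> x \<in> T \<and> smooth_on T f"
  shows "smooth_on S f"
proof -
  have "differentiable_upto k S f"
    if "\<And>x. x \<in> S \<Longrightarrow> \<exists>T. open T \<and> x \<in> T \<and> differentiable_upto k T f" for k
    using that
  proof (induction k arbitrary: f)
    case 0
    then show ?case
      by (auto intro!: continuous_at_imp_continuous_on) (metis continuous_on_eq_continuous_at)
  next
    case (Suc k)
    show ?case
      unfolding differentiable_upto.simps
    proof (intro conjI ballI allI)
      show "f differentiable at x" if "x \<in> S" for x
        using Suc.prems[OF that] by auto
      show "differentiable_upto k S (\<lambda>x. frechet_derivative f (at x) v)" for v
        using Suc.prems by (intro Suc.IH) (metis differentiable_upto.simps(2))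
    qed
  qed
  then show ?thesis using assms unfolding smooth_on_def by meson
qed

text \<open>The derivative of the reciprocal is a product of reciprocals with the derivative of
  \<open>f\<close>. It is needed only to order \<open>k\<close>, so the induction on the order
  closes.\<close>

lemma smooth_on_inverse:
  fixes f :: "'a::real_normed_vector \<Rightarrow> real"
  assumes "open S" "smooth_on S f" "\<And>x. x \<in> S \<Longrightarrow> f x \<noteq> 0"
  shows "smooth_on S (\<lambda>x. inverse (f x))"
proof -
  have "differentiable_upto k S (\<lambda>x. inverse (f x))" for k
  proof (induction k)
    case 0
    then show ?case using smooth_on_imp_continuous[OF assms(2)] assms(3)
      by (auto intro: continuous_on_inverse)
  next
    case (Suc k)
    show ?case
    proof (rule differentiable_upto_SucI[OF assms(1), where f' =
        "\<lambda>x v. - (inverse (f x) * (frechet_derivative f (at x) v * inverse (f x)))"])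
      show "((\<lambda>x. inverse (f x)) has_derivative
        (\<lambda>v. - (inverse (f x) * (frechet_derivative f (at x) v * inverse (f x))))) (at x)" if "x \<in> S" for x
        using Deriv.has_derivative_inverse[OF assms(3)[OF that] smooth_on_has_derivative[OF assms(2) that]]
        by (simp add: mult.assoc)
      show "differentiable_upto k S (\<lambda>x. - (inverse (f x) * (frechet_derivative f (at x) v * inverse (f x))))" for v
        using smooth_on_frechet_derivative_const[OF assms(2), of v] Suc assms(1)
        by (intro differentiable_upto_linear[of uminus] bounded_linear_minus[OF bounded_linear_ident]
            differentiable_upto_bilinear[OF bounded_bilinear_mult]) (auto simp: smooth_on_def)
    qed
  qed
  then show ?thesis by (simp add: smooth_on_def)
qed

section \<open>Smooth maps with vector and matrix values, and matrix inversion\<close>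

lemma smooth_on_vec_lambda:
  fixes f :: "'i::finite \<Rightarrow> 'a::real_normed_vector \<Rightarrow> 'b::euclidean_space"
  assumes "open S" "\<And>i. smooth_on S (f i)"
  shows "smooth_on S (\<lambda>x. \<chi> i. f i x)"
proof -
  have "linear (\<lambda>y::'b. (\<chi> j. if j = i then y else 0) :: 'b ^ 'i)" for i
    by (rule linearI) (auto simp: vec_eq_iff)
  then have "smooth_on S (\<lambda>x. \<Sum>i\<in>UNIV. (\<chi> j. if j = i then f i x else 0))"
    using assms by (intro smooth_on_sum smooth_on_linear[where h = "\<lambda>y. \<chi> j. if j = _ then y else 0"])
      (auto simp: linear_conv_bounded_linear)
  moreover have "(\<Sum>i\<in>UNIV. (\<chi> j. if j = i then f i x else 0)) = (\<chi> i. f i x)" for x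
    by (simp add: vec_eq_iff)
  ultimately show ?thesis by simp
qed

lemma smooth_on_vec_nth: "open S \<Longrightarrow> smooth_on S f \<Longrightarrow> smooth_on S (\<lambda>x. f x $ i)"
  by (rule smooth_on_linear[OF bounded_linear_vec_nth])

lemma bounded_linear_Pair_left: "bounded_linear (\<lambda>x::'a::real_normed_vector. (x, 0::'b::real_normed_vector))"
  by (intro bounded_linear_Pair bounded_linear_ident bounded_linear_zero)

lemma bounded_linear_Pair_right: "bounded_linear (\<lambda>x::'a::real_normed_vector. (0::'b::real_normed_vector, x))"
  by (intro bounded_linear_Pair bounded_linear_ident bounded_linear_zero)

lemma smooth_on_Pair:
  assumes "open S" "smooth_on S f" "smooth_on S g"
  shows "smooth_on S (\<lambda>x. (f x, g x))"
  using smooth_on_add[OF assms(1) smooth_on_linear[OF bounded_linear_Pair_left assms(1,2)]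
      smooth_on_linear[OF bounded_linear_Pair_right assms(1,3)]] by simp

lemma bounded_bilinear_matrix_mult: "bounded_bilinear ((**) :: real^'n::finite^'m::finite \<Rightarrow> real^'k::finite^'n \<Rightarrow> _)"
  unfolding bilinear_conv_bounded_bilinear[symmetric] bilinear_def
  by (auto intro!: linearI simp: matrix_matrix_mult_def vec_eq_iff sum_distrib_left algebra_simps sum.distrib)

lemma bounded_bilinear_matrix_vector_mult: "bounded_bilinear ((*v) :: real^'n::finite^'m::finite \<Rightarrow> _)"
  unfolding bilinear_conv_bounded_bilinear[symmetric] bilinear_def
  by (auto intro!: linearI simp: matrix_vector_mult_def vec_eq_iff sum_distrib_left algebra_simps sum.distrib)

lemmas smooth_on_matrix_mult = smooth_on_bilinear[OF bounded_bilinear_matrix_mult]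
lemmas smooth_on_matrix_vector_mult = smooth_on_bilinear[OF bounded_bilinear_matrix_vector_mult]

lemma matrix_vector_mult_minus_left: "(- A) *v x = - (A *v x)" for A :: "real^'n::finite^'m::finite"
  by (simp add: matrix_vector_mult_def vec_eq_iff sum_negf)

lemma matrix_vector_mult_columns: "u *v b = (\<Sum>i\<in>UNIV. b $ i *\<^sub>R column i u)" for u :: "real^'n::finite^'m::finite"
  by (simp add: matrix_vector_mult_def column_def vec_eq_iff mult.commute)

lemma has_derivative_matrix_vector_mult:
  fixes f :: "'x::real_normed_vector \<Rightarrow> real^'k::finite^'l::finite"
  assumes "(f has_derivative f') (at x)" "(g has_derivative g') (at x)"
  shows "((\<lambda>y. f y *v g y) has_derivative (\<lambda>v. f x *v g' v + f' v *v g x)) (at x)"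
  by (rule bounded_bilinear.FDERIV[OF bounded_bilinear_matrix_vector_mult assms])

lemma has_derivative_matrix_mult:
  fixes f :: "'x::real_normed_vector \<Rightarrow> real^'k::finite^'l::finite" and g :: "'x \<Rightarrow> real^'j::finite^'k"
  assumes "(f has_derivative f') (at x)" "(g has_derivative g') (at x)"
  shows "((\<lambda>y. f y ** g y) has_derivative (\<lambda>v. f x ** g' v + f' v ** g x)) (at x)"
  by (rule bounded_bilinear.FDERIV[OF bounded_bilinear_matrix_mult assms])

lemma smooth_on_det:
  fixes f :: "'a::real_normed_vector \<Rightarrow> real^'n::finite^'n"
  shows "open S \<Longrightarrow> smooth_on S f \<Longrightarrow> smooth_on S (\<lambda>x. det (f x))"
  unfolding det_def
  by (intro smooth_on_sum smooth_on_mult smooth_on_const smooth_on_prod smooth_on_vec_nth)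

lemma
  fixes A :: "real^'n::finite^'n"
  assumes "invertible A"
  shows matrix_inv_right: "A ** matrix_inv A = mat 1" and matrix_inv_left: "matrix_inv A ** A = mat 1"
  using someI_ex[OF assms[unfolded invertible_def]] unfolding matrix_inv_def by auto

text \<open>Cramer's rule for the linear system whose right-hand side is the \<open>j\<close>-th
  basis vector. It exhibits the entries of the inverse as quotients of determinants, hence as smooth
  functions.\<close>

lemma matrix_inv_nth_cramer:
  fixes A :: "real^'n::finite^'n"
  assumes "invertible A"
  shows "matrix_inv A $ k $ j =
    inverse (det A) * det (\<chi> i l. if l = k then axis j 1 $ i else A $ i $ l)"
proof -
  have "A *v (matrix_inv A *v axis j 1) = axis j 1"
    using assms by (simp add: matrix_vector_mul_assoc matrix_inv_right)
  then have "matrix_inv A *v axis j 1 = (\<chi> k. det (\<chi> i l. if l = k then axis j 1 $ i else A $ i $ l) / det A)"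
    using cramer[of A] assms by (simp add: invertible_det_nz)
  then have "(matrix_inv A *v axis j 1) $ k = det (\<chi> i l. if l = k then axis j 1 $ i else A $ i $ l) / det A"
    by simp
  then show ?thesis by (simp add: matrix_vector_mult_basis column_def field_simps)
qed

lemma smooth_on_matrix_inv:
  fixes f :: "'a::real_normed_vector \<Rightarrow> real^'n::finite^'n"
  assumes "open S" "smooth_on S f" "\<And>x. x \<in> S \<Longrightarrow> invertible (f x)"
  shows "smooth_on S (\<lambda>x. matrix_inv (f x))"
proof (rule smooth_on_cong)
  show "smooth_on S (\<lambda>x. \<chi> k j. inverse (det (f x)) * det (\<chi> i l. if l = k then axis j 1 $ i else f x $ i $ l))"
  proof (intro smooth_on_vec_lambda smooth_on_mult smooth_on_inverse smooth_on_det)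
    show "smooth_on S (\<lambda>x. if l = k then axis j 1 $ i else f x $ i $ l)" for k j i l :: 'n
      using assms by (cases "l = k") (auto intro: smooth_on_const smooth_on_vec_nth)
  qed (use assms in \<open>auto simp: invertible_det_nz\<close>)
  show "(\<chi> k j. inverse (det (f x)) * det (\<chi> i l. if l = k then axis j 1 $ i else f x $ i $ l)) = matrix_inv (f x)"
    if "x \<in> S" for x
    using matrix_inv_nth_cramer[OF assms(3)[OF that]] by (simp add: vec_eq_iff)
qed (fact assms(1))

lemma open_invertible: "open {A :: real^'n::finite^'n. invertible A}"
proof -
  have "continuous_on UNIV (det :: real^'n^'n \<Rightarrow> real)"
    using smooth_on_imp_continuous[OF smooth_on_det[OF open_UNIV smooth_on_ident[OF open_UNIV]]] by simp
  then have "open (det -` (- {0}) :: (real^'n^'n) set)"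
    by (intro open_vimage) auto
  moreover have "det -` (- {0}) = {A :: real^'n^'n. invertible A}"
    by (auto simp: invertible_det_nz)
  ultimately show ?thesis by simp
qed

section \<open>Symmetry of second derivatives\<close>

text \<open>A second difference of \<open>f\<close> is evaluated by the mean value theorem in both orders.\<close>

lemma second_difference_mean_value:
  fixes f :: "'a::real_normed_vector \<Rightarrow> real"
  assumes f: "\<And>y. y \<in> ball x r \<Longrightarrow> (f has_derivative f' y) (at y)"
    and f': "\<And>y. y \<in> ball x r \<Longrightarrow> ((\<lambda>y. f' y v) has_derivative f'' y) (at y)"
    and t: "0 < t" "t * (norm v + norm w) < r"
  obtains z where "norm (z - x) \<le> t * (norm v + norm w)"
    "f (x + t *\<^sub>R v + t *\<^sub>R w) - f (x + t *\<^sub>R v) - f (x + t *\<^sub>R w) + f x = t * t * f'' z w"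
proof -
  have nrm: "norm (a *\<^sub>R v + b *\<^sub>R w) \<le> t * (norm v + norm w)"
    if "0 \<le> a" "a \<le> t" "0 \<le> b" "b \<le> t" for a b
  proof -
    have "norm (a *\<^sub>R v + b *\<^sub>R w) \<le> a * norm v + b * norm w"
      using norm_triangle_ineq[of "a *\<^sub>R v" "b *\<^sub>R w"] that by simp
    also have "\<dots> \<le> t * norm v + t * norm w"
      using that by (intro add_mono mult_right_mono) auto
    finally show ?thesis by (simp add: algebra_simps)
  qed
  have inb: "x + a *\<^sub>R v + b *\<^sub>R w \<in> ball x r" if "0 \<le> a" "a \<le> t" "0 \<le> b" "b \<le> t" for a b
  proof -
    have "dist x (x + a *\<^sub>R v + b *\<^sub>R w) = norm (a *\<^sub>R v + b *\<^sub>R w)"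
      by (metis dist_commute dist_norm add.assoc add_diff_cancel_left')
    then show ?thesis using nrm[OF that] t(2) by simp
  qed
  have d1: "((\<lambda>s. f (x + s *\<^sub>R v + b *\<^sub>R w)) has_real_derivative f' (x + s *\<^sub>R v + b *\<^sub>R w) v) (at s)"
    if "0 \<le> s" "s \<le> t" "0 \<le> b" "b \<le> t" for s b
  proof -
    have "((\<lambda>s. x + s *\<^sub>R v + b *\<^sub>R w) has_derivative (\<lambda>h. h *\<^sub>R v)) (at s)"
      by (auto intro!: derivative_eq_intros)
    from has_derivative_compose[OF this f[OF inb[OF that]]]
    show ?thesis
      by (simp add: has_field_derivative_def linear_scale[OF has_derivative_linear[OF f[OF inb[OF that]]]]
          mult_commute_abs)
  qed
  have d2: "((\<lambda>b. f' (x + s *\<^sub>R v + b *\<^sub>R w) v) has_real_derivative f'' (x + s *\<^sub>R v + b *\<^sub>R w) w) (at b)"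
    if "0 \<le> s" "s \<le> t" "0 \<le> b" "b \<le> t" for s b
  proof -
    have "((\<lambda>b. x + s *\<^sub>R v + b *\<^sub>R w) has_derivative (\<lambda>h. h *\<^sub>R w)) (at b)"
      by (auto intro!: derivative_eq_intros)
    from has_derivative_compose[OF this f'[OF inb[OF that]]]
    show ?thesis
      by (simp add: has_field_derivative_def linear_scale[OF has_derivative_linear[OF f'[OF inb[OF that]]]]
          mult_commute_abs)
  qed
  \<comment> \<open>The mean value theorem in \<open>s\<close> turns this difference in direction
    \<open>w\<close> into a difference of derivatives in direction \<open>v\<close>; applied again
    in \<open>b\<close> it gives the second derivative. The summand with factor 0 is kept so that
    \<open>d1\<close> covers both terms, with \<open>b\<close> equal to \<open>t\<close> and to
    0.\<close>
  let ?g = "\<lambda>s. f (x + s *\<^sub>R v + t *\<^sub>R w) - f (x + s *\<^sub>R v + 0 *\<^sub>R w)"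
  obtain s where s: "0 < s" "s < t"
    "?g t - ?g 0 = (t - 0) * (f' (x + s *\<^sub>R v + t *\<^sub>R w) v - f' (x + s *\<^sub>R v + 0 *\<^sub>R w) v)"
  proof -
    have "(?g has_real_derivative f' (x + s *\<^sub>R v + t *\<^sub>R w) v - f' (x + s *\<^sub>R v + 0 *\<^sub>R w) v) (at s)"
      if "0 \<le> s" "s \<le> t" for s
      using that t(1) by (intro DERIV_diff d1) auto
    from MVT2[OF t(1) this] show ?thesis using that by blast
  qed
  obtain b where b: "0 < b" "b < t"
    "f' (x + s *\<^sub>R v + t *\<^sub>R w) v - f' (x + s *\<^sub>R v + 0 *\<^sub>R w) v =
     (t - 0) * f'' (x + s *\<^sub>R v + b *\<^sub>R w) w"
  proof -
    have "((\<lambda>b. f' (x + s *\<^sub>R v + b *\<^sub>R w) v) has_real_derivative f'' (x + s *\<^sub>R v + b *\<^sub>R w) w) (at b)"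
      if "0 \<le> b" "b \<le> t" for b
      using that s by (intro d2) auto
    from MVT2[OF t(1) this] show ?thesis using that by blast
  qed
  show thesis
  proof (rule that)
    show "norm ((x + s *\<^sub>R v + b *\<^sub>R w) - x) \<le> t * (norm v + norm w)"
      using nrm[of s b] s b by (simp add: add.assoc)
    show "f (x + t *\<^sub>R v + t *\<^sub>R w) - f (x + t *\<^sub>R v) - f (x + t *\<^sub>R w) + f x =
        t * t * f'' (x + s *\<^sub>R v + b *\<^sub>R w) w"
      using s(3) b(3) by simp
  qed
qed

text \<open>One and the same second difference is evaluated in both orders. The two intermediate
  points lie near \<open>x\<close>, so continuity of the second derivatives bounds the asymmetry by
  any \<open>e\<close>.\<close>

lemma second_derivative_symmetric_real:
  fixes f :: "'a::real_normed_vector \<Rightarrow> real"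
  assumes S: "open S" "x \<in> S" and f: "smooth_on S f"
  shows "frechet_derivative (\<lambda>y. frechet_derivative f (at y) v) (at x) w =
         frechet_derivative (\<lambda>y. frechet_derivative f (at y) w) (at x) v"
proof -
  let ?H = "\<lambda>v w y. frechet_derivative (\<lambda>y. frechet_derivative f (at y) v) (at y) w"
  have sm: "smooth_on S (\<lambda>y. frechet_derivative f (at y) v)" for v
    using f by (rule smooth_on_frechet_derivative_const)
  have cont: "isCont (?H v w) x" for v w
    using smooth_on_imp_continuous[OF smooth_on_frechet_derivative_const[OF sm]] S
    by (metis continuous_on_eq_continuous_at)
  have "\<bar>?H v w x - ?H w v x\<bar> \<le> e" if e: "e > 0" for e
  proof -
    obtain d1 where d1: "d1 > 0" "\<And>y. norm (y - x) < d1 \<Longrightarrow> \<bar>?H v w y - ?H v w x\<bar> < e / 2"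
      using cont[of v w] e unfolding continuous_at_eps_delta
      by (metis dist_norm half_gt_zero real_norm_def)
    obtain d2 where d2: "d2 > 0" "\<And>y. norm (y - x) < d2 \<Longrightarrow> \<bar>?H w v y - ?H w v x\<bar> < e / 2"
      using cont[of w v] e unfolding continuous_at_eps_delta
      by (metis dist_norm half_gt_zero real_norm_def)
    obtain d3 where d3: "d3 > 0" "ball x d3 \<subseteq> S"
      using S openE by blast
    define r where "r = min d1 (min d2 d3)"
    \<comment> \<open>The summand 1 keeps the denominator positive when both vectors vanish, and
      makes the inequality between \<open>t * (norm v + norm w)\<close> and \<open>r\<close>
      strict.\<close>
    define t where "t = r / (norm v + norm w + 1)"
    have r: "r > 0" "r \<le> d1" "r \<le> d2" "r \<le> d3" using d1 d2 d3 by (auto simp: r_def)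
    have t: "t > 0" "t * (norm v + norm w) < r" "t * (norm w + norm v) < r"
      using r(1) by (auto simp: t_def field_simps add_pos_nonneg add_nonneg_pos)
    have D: "(f has_derivative frechet_derivative f (at y)) (at y)"
      "((\<lambda>y. frechet_derivative f (at y) v) has_derivative
          frechet_derivative (\<lambda>y. frechet_derivative f (at y) v) (at y)) (at y)" if "y \<in> ball x r" for y v
      using that r d3 smooth_on_has_derivative[OF f] smooth_on_has_derivative[OF sm]
      by (meson subset_ball subsetD)+
    obtain z1 where z1: "norm (z1 - x) \<le> t * (norm v + norm w)"
      "f (x + t *\<^sub>R v + t *\<^sub>R w) - f (x + t *\<^sub>R v) - f (x + t *\<^sub>R w) + f x = t * t * ?H v w z1"
      using second_difference_mean_value[OF D t(1,2)] by blast
    obtain z2 where z2: "norm (z2 - x) \<le> t * (norm w + norm v)"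
      "f (x + t *\<^sub>R w + t *\<^sub>R v) - f (x + t *\<^sub>R w) - f (x + t *\<^sub>R v) + f x = t * t * ?H w v z2"
      using second_difference_mean_value[OF D t(1,3)] by blast
    have "f (x + t *\<^sub>R w + t *\<^sub>R v) = f (x + t *\<^sub>R v + t *\<^sub>R w)"
      by (simp add: add.assoc add.commute[of "t *\<^sub>R w"])
    then have "f (x + t *\<^sub>R v + t *\<^sub>R w) - f (x + t *\<^sub>R v) - f (x + t *\<^sub>R w) + f x =
        f (x + t *\<^sub>R w + t *\<^sub>R v) - f (x + t *\<^sub>R w) - f (x + t *\<^sub>R v) + f x"
      by linarith
    then have "t * t * ?H v w z1 = t * t * ?H w v z2"
      unfolding z1(2) z2(2) .
    then have "?H v w z1 = ?H w v z2" using t(1) by simp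
    moreover have "\<bar>?H v w z1 - ?H v w x\<bar> < e / 2" using z1 t r by (intro d1) auto
    moreover have "\<bar>?H w v z2 - ?H w v x\<bar> < e / 2" using z2 t r by (intro d2) auto
    ultimately show ?thesis by linarith
  qed
  then have "\<bar>?H v w x - ?H w v x\<bar> \<le> 0" using dense_ge by blast
  then show ?thesis by simp
qed

lemma second_derivative_symmetric:
  fixes f :: "'a::real_normed_vector \<Rightarrow> 'b::euclidean_space"
  assumes S: "open S" "x \<in> S" and f: "smooth_on S f"
  shows "frechet_derivative (\<lambda>y. frechet_derivative f (at y) v) (at x) w =
         frechet_derivative (\<lambda>y. frechet_derivative f (at y) w) (at x) v"
proof (rule euclidean_eqI)
  fix b :: 'b
  have sm: "smooth_on S (\<lambda>y. f y \<bullet> b)"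
    using f S by (intro smooth_on_linear[OF bounded_linear_inner_left])
  have D1: "frechet_derivative (\<lambda>y. f y \<bullet> b) (at y) v = frechet_derivative f (at y) v \<bullet> b"
    if "y \<in> S" for y v
    using bounded_linear.has_derivative[OF bounded_linear_inner_left smooth_on_has_derivative[OF f that], of b]
    by (metis frechet_derivative_at)
  have D2: "frechet_derivative (\<lambda>y. frechet_derivative (\<lambda>y. f y \<bullet> b) (at y) v) (at x) w =
    frechet_derivative (\<lambda>y. frechet_derivative f (at y) v) (at x) w \<bullet> b" for v w
  proof -
    have "((\<lambda>y. frechet_derivative f (at y) v \<bullet> b) has_derivative
       (\<lambda>w. frechet_derivative (\<lambda>y. frechet_derivative f (at y) v) (at x) w \<bullet> b)) (at x)"
      using bounded_linear.has_derivative[OF bounded_linear_inner_left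
          smooth_on_has_derivative[OF smooth_on_frechet_derivative_const[OF f] S(2)]] .
    from has_derivative_transform_within_open[OF this S D1[symmetric]]
    show ?thesis by (metis frechet_derivative_at)
  qed
  show "frechet_derivative (\<lambda>y. frechet_derivative f (at y) v) (at x) w \<bullet> b =
        frechet_derivative (\<lambda>y. frechet_derivative f (at y) w) (at x) v \<bullet> b"
    using second_derivative_symmetric_real[OF S sm, of v w] by (simp add: D2)
qed

section \<open>The model structure and its commutant\<close>

lemma sum_UNIV_Plus:
  fixes f :: "'a::finite + 'b::finite \<Rightarrow> 'c::comm_monoid_add"
  shows "(\<Sum>p\<in>UNIV. f p) = (\<Sum>i\<in>UNIV. f (Inl i)) + (\<Sum>i\<in>UNIV. f (Inr i))"
  by (simp add: sum.Plus flip: UNIV_Plus_UNIV)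

text \<open>The matrices of F and P relative to an adapted frame: its first half spans the plus
  eigenspace of F, its second half the minus eigenspace, and P exchanges the two halves.\<close>

definition model_F :: "real^('n::finite + 'n)^('n + 'n)" where
  "model_F = (\<chi> p q. case p of Inl i \<Rightarrow> if q = Inl i then 1 else 0 | Inr i \<Rightarrow> if q = Inr i then -1 else 0)"

definition model_P :: "real^('n::finite + 'n)^('n + 'n)" where
  "model_P = (\<chi> p q. case p of Inl i \<Rightarrow> if q = Inr i then 1 else 0 | Inr i \<Rightarrow> if q = Inl i then 1 else 0)"

lemma model_F_vec_nth [simp]:
  "(model_F *v a) $ Inl i = a $ Inl i" "(model_F *v a) $ Inr i = - a $ Inr i"
  by (simp_all add: model_F_def matrix_vector_mult_def if_distrib [where f = "\<lambda>x. x * _"] cong: if_cong)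

lemma model_P_vec_nth [simp]:
  "(model_P *v a) $ Inl i = a $ Inr i" "(model_P *v a) $ Inr i = a $ Inl i"
  by (simp_all add: model_P_def matrix_vector_mult_def if_distrib [where f = "\<lambda>x. x * _"] cong: if_cong)

lemma vec_eq_iff_Plus: "x = y \<longleftrightarrow> (\<forall>i. x $ Inl i = y $ Inl i) \<and> (\<forall>i. x $ Inr i = y $ Inr i)"
  for x y :: "'a^('n::finite + 'm::finite)"
  by (auto simp: vec_eq_iff split_sum_all)

lemma model_vec [simp]:
  "model_F *v (model_F *v a) = a" "model_P *v (model_P *v a) = a"
  "model_F *v (model_P *v a) = - (model_P *v (model_F *v a))"
  by (simp_all add: vec_eq_iff_Plus)

definition model_endo :: "real^('n::finite + 'n)^('n + 'n) \<Rightarrow> bool" where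
  "model_endo A \<longleftrightarrow> A ** model_F = model_F ** A \<and> A ** model_P = model_P ** A"

lemma model_endo_vec:
  "model_endo A \<longleftrightarrow> (\<forall>a. A *v (model_F *v a) = model_F *v (A *v a)) \<and> (\<forall>a. A *v (model_P *v a) = model_P *v (A *v a))"
  by (simp add: model_endo_def matrix_eq matrix_vector_mul_assoc)

lemma model_endo_mat1: "model_endo (mat 1)"
  by (simp add: model_endo_def)

lemma model_endo_mult: "model_endo A \<Longrightarrow> model_endo B \<Longrightarrow> model_endo (A ** B)"
  unfolding model_endo_def by (metis matrix_mul_assoc)

lemma model_endo_add: "model_endo A \<Longrightarrow> model_endo B \<Longrightarrow> model_endo (A + B)"
  by (simp add: model_endo_vec matrix_vector_mult_add_rdistrib matrix_vector_right_distrib)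

lemma model_endo_diff: "model_endo A \<Longrightarrow> model_endo B \<Longrightarrow> model_endo (A - B)"
  by (simp add: model_endo_vec matrix_vector_mult_diff_rdistrib matrix_vector_mult_diff_distrib)

lemma model_endo_scaleR: "model_endo A \<Longrightarrow> model_endo (r *\<^sub>R A)"
  by (simp add: model_endo_vec vec.scale scaleR_matrix_vector_assoc[symmetric] matrix_vector_mult_scaleR)

lemma matrix_inv_vec:
  assumes "invertible (A :: real^'n::finite^'n)"
  shows "A *v (matrix_inv A *v x) = x" "matrix_inv A *v (A *v x) = x"
  using assms by (simp_all add: matrix_vector_mul_assoc matrix_inv_left matrix_inv_right)

lemma invertible_matrix_inv: "invertible (A :: real^'n::finite^'n) \<Longrightarrow> invertible (matrix_inv A)"
  unfolding invertible_def using matrix_inv_left matrix_inv_right invertible_def by metis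

lemma model_endo_matrix_inv:
  assumes "model_endo A" "invertible A"
  shows "model_endo (matrix_inv A)"
  using assms unfolding model_endo_vec by (metis matrix_inv_vec)

lemma block_diag_vec_nth:
  "(block_diag B *v a) $ Inl i = (B *v (\<chi> j. a $ Inl j)) $ i"
  "(block_diag B *v a) $ Inr i = (B *v (\<chi> j. a $ Inr j)) $ i"
  by (simp_all add: block_diag_def matrix_vector_mult_def sum_UNIV_Plus)

lemma model_endo_block_diag: "model_endo (block_diag B)"
proof -
  have "(\<chi> j. - f j) = - (\<chi> j. f j)" for f :: "'a \<Rightarrow> real" by (simp add: vec_eq_iff)
  then show ?thesis by (simp add: model_endo_vec vec_eq_iff_Plus block_diag_vec_nth vec.neg)
qed

text \<open>Commuting with \<open>model_F\<close> kills the off-diagonal blocks; commuting with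
  \<open>model_P\<close> makes the two diagonal blocks equal.\<close>

lemma model_endo_imp_block_diag:
  fixes A :: "real^('n::finite + 'n)^('n + 'n)"
  assumes "model_endo A"
  obtains B where "A = block_diag B"
proof
  have F: "A *v (model_F *v a) = model_F *v (A *v a)" and P: "A *v (model_P *v a) = model_P *v (A *v a)" for a
    using assms by (auto simp: model_endo_vec)
  have entry: "A $ p $ q = (A *v axis q 1) $ p" for p q
    by (simp add: matrix_vector_mult_basis column_def)
  have ax: "model_F *v axis (Inl j) 1 = axis (Inl j) 1" "model_F *v axis (Inr j) 1 = - axis (Inr j) 1"
    "model_P *v axis (Inl j) 1 = axis (Inr j) 1" "model_P *v axis (Inr j) 1 = axis (Inl j) 1" for j :: 'n
    by (auto simp: vec_eq_iff_Plus axis_def)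
  have 1: "A $ Inl i $ Inr j = 0" for i j
    using arg_cong[OF F[of "axis (Inr j) 1"], of "\<lambda>x. x $ Inl i"]
    unfolding entry ax model_F_vec_nth by (simp add: vec.neg)
  have 2: "A $ Inr i $ Inl j = 0" for i j
    using arg_cong[OF F[of "axis (Inl j) 1"], of "\<lambda>x. x $ Inr i"]
    unfolding entry ax model_F_vec_nth by simp
  have 3: "A $ Inr i $ Inr j = A $ Inl i $ Inl j" for i j
    using arg_cong[OF P[of "axis (Inl j) 1"], of "\<lambda>x. x $ Inr i"]
    unfolding entry ax model_P_vec_nth by simp
  show "A = block_diag (\<chi> i j. A $ Inl i $ Inl j)"
    by (simp add: block_diag_def vec_eq_iff_Plus 1 2 3)
qed

lemma block_diag_mult: "block_diag A ** block_diag B = block_diag (A ** B)"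
  by (simp add: matrix_eq vec_eq_iff_Plus block_diag_vec_nth flip: matrix_vector_mul_assoc)

lemma block_diag_mat1: "block_diag A = mat 1 \<longleftrightarrow> A = mat 1" for A :: "real^'n::finite^'n"
proof
  assume "block_diag A = mat 1"
  then have "block_diag A $ Inl i $ Inl j = (mat 1 :: real^('n + 'n)^('n + 'n)) $ Inl i $ Inl j" for i j
    by simp
  then show "A = mat 1" by (simp add: block_diag_def vec_eq_iff mat_def)
qed (auto simp: block_diag_def vec_eq_iff mat_def split: sum.splits)

lemma delta_GL_eq: "delta_GL = {g. invertible g \<and> model_endo g}"
proof (intro equalityI subsetI)
  fix g :: "real^('n::finite + 'n)^('n + 'n)"
  assume "g \<in> delta_GL"
  then obtain B where B: "g = block_diag B" "invertible B" by (auto simp: delta_GL_def)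
  then have "g ** block_diag (matrix_inv B) = mat 1" "block_diag (matrix_inv B) ** g = mat 1"
    by (simp_all add: block_diag_mult block_diag_mat1 matrix_inv_left matrix_inv_right)
  then show "g \<in> {g. invertible g \<and> model_endo g}"
    using B model_endo_block_diag by (auto simp: invertible_def)
next
  fix g :: "real^('n::finite + 'n)^('n + 'n)"
  assume g: "g \<in> {g. invertible g \<and> model_endo g}"
  then obtain B where B: "g = block_diag B" using model_endo_imp_block_diag by blast
  \<comment> \<open>The inverse lies in the commutant too, hence is again block diagonal, and its
    block inverts \<open>B\<close>.\<close>
  obtain C where C: "matrix_inv g = block_diag C"
    using g model_endo_matrix_inv model_endo_imp_block_diag by blast
  have "block_diag (B ** C) = mat 1" "block_diag (C ** B) = mat 1"
    using g unfolding block_diag_mult[symmetric] B[symmetric] C[symmetric]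
    by (simp_all add: matrix_inv_left matrix_inv_right)
  then have "invertible B" unfolding block_diag_mat1 invertible_def by blast
  then show "g \<in> delta_GL" using B by (auto simp: delta_GL_def)
qed

lemma invertible_mult_left_cancel:
  "invertible (A :: real^'n::finite^'n) \<Longrightarrow> A ** B = A ** C \<longleftrightarrow> B = C"
  by (metis matrix_inv_left matrix_mul_assoc matrix_mul_lid)

lemma frame_orbit_delta_GL:
  assumes "invertible z"
  shows "u \<in> frame_orbit z delta_GL \<longleftrightarrow> invertible u \<and> model_endo (matrix_inv z ** u)"
proof
  assume "u \<in> frame_orbit z delta_GL"
  then show "invertible u \<and> model_endo (matrix_inv z ** u)"
    using assms by (auto simp: frame_orbit_def delta_GL_eq invertible_mult matrix_mul_assoc matrix_inv_left)
next
  assume *: "invertible u \<and> model_endo (matrix_inv z ** u)"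
  have "u = z ** (matrix_inv z ** u)"
    using assms by (simp add: matrix_mul_assoc matrix_inv_right)
  then show "u \<in> frame_orbit z delta_GL"
    using * assms by (auto simp: frame_orbit_def delta_GL_eq invertible_mult invertible_matrix_inv)
qed

lemma frame_orbit_self: "z \<in> frame_orbit z delta_GL"
  unfolding frame_orbit_def delta_GL_eq
  by (rule image_eqI[where x = "mat 1"]) (auto simp: invertible_def model_endo_mat1 intro: exI[of _ "mat 1"])

lemma frame_orbit_mult:
  assumes "g \<in> delta_GL"
  shows "frame_orbit (z ** g) delta_GL = frame_orbit z delta_GL"
proof (intro equalityI subsetI)
  fix u assume "u \<in> frame_orbit (z ** g) delta_GL"
  then show "u \<in> frame_orbit z delta_GL"
    using assms by (auto simp: frame_orbit_def delta_GL_eq invertible_mult model_endo_mult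
        simp flip: matrix_mul_assoc)
next
  fix u assume "u \<in> frame_orbit z delta_GL"
  then obtain h where h: "h \<in> delta_GL" "u = z ** h" by (auto simp: frame_orbit_def)
  have "u = (z ** g) ** (matrix_inv g ** h)"
    using h assms by (simp add: delta_GL_eq matrix_mul_assoc matrix_inv_right)
       (metis matrix_inv_right matrix_mul_assoc matrix_mul_rid)
  moreover have "matrix_inv g ** h \<in> delta_GL"
    using h assms by (auto simp: delta_GL_eq invertible_mult model_endo_mult invertible_matrix_inv model_endo_matrix_inv)
  ultimately show "u \<in> frame_orbit (z ** g) delta_GL" by (auto simp: frame_orbit_def)
qed

lemma frame_orbit_eq_iff:
  "frame_orbit u delta_GL = frame_orbit z delta_GL \<longleftrightarrow> u \<in> frame_orbit z delta_GL"
  using frame_orbit_self frame_orbit_mult unfolding frame_orbit_def by (metis (no_types, lifting) imageE)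

section \<open>Adapted frames and conjugates of the model\<close>

lemma eigen_plus_iff: "v \<in> eigen_plus B \<longleftrightarrow> B *v v = v"
  by (simp add: eigen_plus_def matrix_vector_mult_diff_rdistrib)

lemma eigen_minus_iff: "v \<in> eigen_minus B \<longleftrightarrow> B *v v = - v"
  by (simp add: eigen_minus_def matrix_vector_mult_add_rdistrib eq_neg_iff_add_eq_0)

lemma matrix_eq_columns: "A = B \<longleftrightarrow> (\<forall>q. A *v axis q 1 = B *v axis q 1)"
  for A B :: "real^'n::finite^'m::finite"
  by (auto simp: matrix_vector_mult_basis column_def vec_eq_iff)

text \<open>Trades the basis and span conditions on half of the frame for matrix equations, which
  can be compared with the description of \<open>delta_GL\<close> as the invertible part of the
  commutant.\<close>

lemma adapted_frame_iff:
  fixes F P u :: "real^('n::finite + 'n)^('n + 'n)"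
  assumes FP: "P ** P = mat 1" "F ** P + P ** F = 0"
  shows "adapted_frame F P u \<longleftrightarrow> invertible u \<and> F ** u = u ** model_F \<and> P ** u = u ** model_P"
proof -
  define X where "X i = column (Inl i) u" for i
  have X: "X i = u *v axis (Inl i) 1" for i by (simp add: X_def matrix_vector_mult_basis)
  have Y: "column (Inr i) u = u *v axis (Inr i) 1" for i by (simp add: matrix_vector_mult_basis)
  have ax: "model_F *v axis (Inl j) 1 = axis (Inl j) 1" "model_F *v axis (Inr j) 1 = - axis (Inr j) 1"
    "model_P *v axis (Inl j) 1 = axis (Inr j) 1" "model_P *v axis (Inr j) 1 = axis (Inl j) 1" for j :: 'n
    by (auto simp: vec_eq_iff_Plus axis_def)
  have adapted: "adapted_frame F P u \<longleftrightarrow> invertible u \<and> inj X \<and> independent (range X) \<and>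
      span (range X) = eigen_plus F \<and> (\<forall>i. u *v axis (Inr i) 1 = P *v X i)"
    by (simp add: adapted_frame_def Let_def X_def[abs_def] flip: Y)
  have PP: "P *v (P *v v) = v" for v using FP by (simp add: matrix_vector_mul_assoc)
  have FPv: "F *v (P *v v) = - (P *v (F *v v))" for v
    using arg_cong[OF FP(2), of "\<lambda>A. A *v v"]
    by (simp add: matrix_vector_mult_add_rdistrib eq_neg_iff_add_eq_0 flip: matrix_vector_mul_assoc)
  show ?thesis unfolding adapted
  proof (intro iffI conjI; (elim conjE)?)
    assume u: "span (range X) = eigen_plus F" "\<forall>i. u *v axis (Inr i) 1 = P *v X i"
    have FX: "F *v X i = X i" for i
      using u(1) span_base[of "X i" "range X"] by (simp add: eigen_plus_iff)
    \<comment> \<open>On the second half of the frame anticommutation is used: F takes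
      \<open>P *v X i\<close> to its negative, as \<open>X i\<close> is fixed by F.\<close>
    show "F ** u = u ** model_F"
      unfolding matrix_eq_columns split_sum_all
      using u(2) FX by (simp add: ax FPv vec.neg flip: matrix_vector_mul_assoc X)
    show "P ** u = u ** model_P"
      unfolding matrix_eq_columns split_sum_all
      using u(2) by (simp add: ax PP flip: matrix_vector_mul_assoc X)
  next
    assume u: "invertible u" "F ** u = u ** model_F" "P ** u = u ** model_P"
    have F: "F *v (u *v a) = u *v (model_F *v a)" and P: "P *v (u *v a) = u *v (model_P *v a)" for a
      using u by (simp_all add: matrix_vector_mul_assoc)
    have inj: "inj ((*v) u)" by (metis injI matrix_inv_vec(2) u(1))
    have "inj (\<lambda>i::'n. axis (Inl i) 1 :: real^('n + 'n))"
      by (auto intro!: injI simp: axis_eq_axis)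
    then show "inj X"
      using inj unfolding X[abs_def] inj_def by blast
    have "independent (range (\<lambda>i::'n. axis (Inl i) 1 :: real^('n + 'n)))"
      by (rule independent_mono[OF independent_Basis]) (auto simp: Basis_vec_def)
    then have "independent ((*v) u ` range (\<lambda>i::'n. axis (Inl i) 1 :: real^('n + 'n)))"
      by (rule linear_independent_injective_image[OF matrix_vector_mul_linear _ inj_on_subset[OF inj subset_UNIV]])
    then show "independent (range X)"
      unfolding image_image X[abs_def] .
    show "\<forall>i. u *v axis (Inr i) 1 = P *v X i" by (simp add: X P ax)
    show "span (range X) = eigen_plus F"
    proof (intro equalityI subsetI)
      have sub: "subspace (eigen_plus F)"
        by (auto simp: subspace_def eigen_plus_iff matrix_vector_right_distrib matrix_vector_mult_scaleR)
      show "v \<in> eigen_plus F" if "v \<in> span (range X)" for v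
      proof -
        have "range X \<subseteq> eigen_plus F" by (auto simp: eigen_plus_iff X F ax)
        from span_minimal[OF this sub] that show ?thesis by blast
      qed
      fix v assume v: "v \<in> eigen_plus F"
      define a where "a = matrix_inv u *v v"
      have va: "v = u *v a" using u(1) by (simp add: a_def matrix_inv_vec)
      have "model_F *v a = a"
        using v inj unfolding eigen_plus_iff va F by (simp add: inj_eq)
      \<comment> \<open>A plus eigenvector has no components along the second half of the frame,
        hence is a combination of the \<open>X i\<close>.\<close>
      then have a0: "a $ Inr i = 0" for i
        by (metis model_F_vec_nth(2) neg_equal_zero)
      have "v = (\<Sum>q\<in>UNIV. (a $ q) *\<^sub>R column q u)"
        by (simp add: va matrix_vector_mult_def vec_eq_iff column_def mult.commute)
      also have "\<dots> = (\<Sum>i\<in>UNIV. (a $ Inl i) *\<^sub>R X i)"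
        by (simp add: sum_UNIV_Plus a0 X_def)
      also have "\<dots> \<in> span (range X)" by (intro span_sum span_scale span_base) auto
      finally show "v \<in> span (range X)" .
    qed
  qed auto
qed

text \<open>A single adapted frame at a point already determines F and P there; this is the
  uniqueness half of the description in \<open>structure_of_section\<close>.\<close>

lemma adapted_frame_unique:
  fixes F P u :: "real^('n::finite + 'n)^('n + 'n)"
  assumes "P ** P = mat 1" "F ** P + P ** F = 0" "adapted_frame F P u"
  shows "F = u ** model_F ** matrix_inv u" "P = u ** model_P ** matrix_inv u"
proof -
  have "invertible u" "F ** u = u ** model_F" "P ** u = u ** model_P"
    using assms adapted_frame_iff by blast+
  then show "F = u ** model_F ** matrix_inv u" "P = u ** model_P ** matrix_inv u"
    by (metis matrix_inv_right matrix_mul_assoc matrix_mul_rid)+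
qed

lemma conjugate_model:
  fixes z :: "real^('n::finite + 'n)^('n + 'n)"
  assumes "invertible z"
  shows "(z ** model_F ** matrix_inv z) ** (z ** model_F ** matrix_inv z) = mat 1"
    "(z ** model_P ** matrix_inv z) ** (z ** model_P ** matrix_inv z) = mat 1"
    "(z ** model_F ** matrix_inv z) ** (z ** model_P ** matrix_inv z) +
     (z ** model_P ** matrix_inv z) ** (z ** model_F ** matrix_inv z) = 0"
  using assms
  by (simp_all add: matrix_eq matrix_inv_vec matrix_vector_mult_add_rdistrib vec.neg flip: matrix_vector_mul_assoc)

lemma adapted_frame_conjugate:
  fixes z :: "real^('n::finite + 'n)^('n + 'n)"
  assumes "invertible z"
  shows "adapted_frame (z ** model_F ** matrix_inv z) (z ** model_P ** matrix_inv z) u \<longleftrightarrow>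
    invertible u \<and> frame_orbit u delta_GL = frame_orbit z delta_GL"
proof -
  have "z ** M ** matrix_inv z ** u = u ** M \<longleftrightarrow> matrix_inv z ** u ** M = M ** (matrix_inv z ** u)" for M
  proof -
    have "matrix_inv z ** (z ** M ** matrix_inv z ** u) = M ** (matrix_inv z ** u)"
      by (simp add: matrix_mul_assoc matrix_inv_left[OF assms])
    then show ?thesis
      using invertible_mult_left_cancel[OF invertible_matrix_inv[OF assms], of "z ** M ** matrix_inv z ** u" "u ** M"]
      by (auto simp: matrix_mul_assoc)
  qed
  then show ?thesis
    unfolding adapted_frame_iff[OF conjugate_model(2,3)[OF assms]] frame_orbit_eq_iff
      frame_orbit_delta_GL[OF assms] model_endo_def by blast
qed

text \<open>Conjugation of the model is well defined on orbits: \<open>u\<close> is adapted to the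
  structure built from \<open>z\<close>, and one adapted frame determines the structure.\<close>

lemma conjugate_model_cong:
  fixes u z :: "real^('n::finite + 'n)^('n + 'n)"
  assumes "invertible u" "invertible z" "frame_orbit u delta_GL = frame_orbit z delta_GL"
  shows "u ** model_F ** matrix_inv u = z ** model_F ** matrix_inv z"
    "u ** model_P ** matrix_inv u = z ** model_P ** matrix_inv z"
  using adapted_frame_unique[OF conjugate_model(2,3)[OF assms(2)], of u] adapted_frame_conjugate[OF assms(2), of u] assms
  by auto

section \<open>The canonical connection at a point\<close>

definition christoffel_matrix :: "'m::finite christoffel \<Rightarrow> real^'m \<Rightarrow> real^'m^'m" where
  "christoffel_matrix \<gamma> v = (\<chi> k j. \<Sum>i\<in>UNIV. \<gamma> $ k $ i $ j * v $ i)"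

lemma christoffel_matrix_vec: "christoffel_matrix \<gamma> v *v w = christoffel_apply \<gamma> v w"
  by (auto simp: christoffel_matrix_def christoffel_apply_def matrix_vector_mult_def vec_eq_iff
      sum_distrib_right intro!: sum.swap)

lemma bilinear_christoffel_apply: "bilinear (christoffel_apply \<gamma>)"
  unfolding bilinear_def
  by (auto intro!: linearI simp: christoffel_apply_def vec_eq_iff algebra_simps sum.distrib sum_distrib_left)

definition christoffel_of :: "(real^'m \<Rightarrow> real^'m \<Rightarrow> real^'m) \<Rightarrow> 'm::finite christoffel" where
  "christoffel_of h = (\<chi> k i j. h (axis i 1) (axis j 1) $ k)"

lemma christoffel_apply_axis: "christoffel_apply \<gamma> (axis i 1) (axis j 1) $ k = \<gamma> $ k $ i $ j"
  by (simp add: christoffel_apply_def axis_def mult_delta_right)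

lemma christoffel_eqI:
  assumes "\<And>v w. christoffel_apply \<gamma> v w = christoffel_apply \<gamma>' v w"
  shows "\<gamma> = \<gamma>'"
  unfolding vec_eq_iff using assms christoffel_apply_axis by metis

lemma bilinear_eq_axis:
  fixes f g :: "real^'m::finite \<Rightarrow> real^'m \<Rightarrow> 'b::real_vector"
  assumes "bilinear f" "bilinear g" "\<And>i j. f (axis i 1) (axis j 1) = g (axis i 1) (axis j 1)"
  shows "f v w = g v w"
  using bilinear_eq_stdbasis[OF assms(1,2)] assms(3) by (auto simp: Basis_vec_def)

lemma christoffel_apply_of:
  assumes "bilinear h"
  shows "christoffel_apply (christoffel_of h) v w = h v w"
  by (rule bilinear_eq_axis[OF bilinear_christoffel_apply assms])
     (simp add: vec_eq_iff christoffel_apply_axis, simp add: christoffel_of_def)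

text \<open>The Christoffel symbols \<open>\<gamma>\<close> of the canonical connection at a point, in terms of the value \<open>z\<close>
  and the differential \<open>D\<close> of an adapted frame. The first condition says that parallel transport
  infinitesimally preserves the structure, the second is the vanishing of the torsion.\<close>

definition canonical_at ::
  "real^('n + 'n)^('n + 'n) \<Rightarrow> (real^('n + 'n) \<Rightarrow> real^('n + 'n)^('n + 'n)) \<Rightarrow>
   ('n::finite + 'n) christoffel \<Rightarrow> bool" where
  "canonical_at z D \<gamma> \<longleftrightarrow>
     (\<forall>v. \<exists>A. model_endo A \<and> (\<forall>b. christoffel_apply \<gamma> v (z *v b) + D v *v b = z *v (A *v b))) \<and>
     (\<forall>a b. model_F *v a = a \<longrightarrow> model_F *v b = - b \<longrightarrow>
        christoffel_apply \<gamma> (z *v a) (z *v b) = christoffel_apply \<gamma> (z *v b) (z *v a))"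

lemma canonical_at_torsion:
  assumes "canonical_at z D \<gamma>" "model_F *v a = a" "model_F *v b = - b"
  shows "christoffel_apply \<gamma> (z *v a) (z *v b) = christoffel_apply \<gamma> (z *v b) (z *v a)"
  using assms unfolding canonical_at_def by blast

definition plus_part :: "real^('n + 'n) \<Rightarrow> real^('n::finite + 'n)" where
  "plus_part a = (1/2) *\<^sub>R (a + model_F *v a)"

definition minus_part :: "real^('n + 'n) \<Rightarrow> real^('n::finite + 'n)" where
  "minus_part a = (1/2) *\<^sub>R (a - model_F *v a)"

lemma part_vec_nth [simp]:
  "plus_part a $ Inl i = a $ Inl i" "plus_part a $ Inr i = 0"
  "minus_part a $ Inl i = 0" "minus_part a $ Inr i = a $ Inr i"
  by (simp_all add: plus_part_def minus_part_def)

lemma plus_minus_part: "plus_part a + minus_part a = a"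
  by (simp add: vec_eq_iff_Plus)

lemma part_model [simp]:
  "model_F *v plus_part a = plus_part a" "model_F *v minus_part a = - minus_part a"
  "plus_part (model_F *v a) = plus_part a" "minus_part (model_F *v a) = - minus_part a"
  "plus_part (model_P *v a) = model_P *v minus_part a" "minus_part (model_P *v a) = model_P *v plus_part a"
  "model_F *v (model_P *v plus_part a) = - (model_P *v plus_part a)"
  "model_F *v (model_P *v minus_part a) = model_P *v minus_part a"
  by (simp_all add: vec_eq_iff_Plus)

lemma linear_part: "linear plus_part" "linear minus_part"
  by (rule linearI; simp add: vec_eq_iff_Plus)+

lemma part_eigen:
  "model_F *v a = a \<Longrightarrow> plus_part a = a" "model_F *v a = a \<Longrightarrow> minus_part a = 0"
  "model_F *v a = - a \<Longrightarrow> plus_part a = 0" "model_F *v a = - a \<Longrightarrow> minus_part a = a"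
  by (simp_all add: plus_part_def minus_part_def flip: scaleR_add_left)

text \<open>In the difference \<open>d\<close> of two solutions, written in frame components, the
  term with \<open>D\<close> cancels. What remains is bilinear, commutes with the model in its
  second argument and is symmetric on mixed pairs of eigenvectors.\<close>

lemma canonical_at_unique:
  assumes z: "invertible z" and c: "canonical_at z D \<gamma>" "canonical_at z D \<gamma>'"
  shows "\<gamma> = \<gamma>'"
proof -
  define d where "d a b = matrix_inv z *v (christoffel_apply \<gamma> (z *v a) (z *v b) - christoffel_apply \<gamma>' (z *v a) (z *v b))" for a b
  have comm: "d a (model_F *v b) = model_F *v d a b" "d a (model_P *v b) = model_P *v d a b"
    and lin: "linear (d a)" for a b
  proof -
    obtain A where A: "model_endo A" "\<And>b. christoffel_apply \<gamma> (z *v a) (z *v b) + D (z *v a) *v b = z *v (A *v b)"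
      using c(1) unfolding canonical_at_def by blast
    obtain A' where A': "model_endo A'" "\<And>b. christoffel_apply \<gamma>' (z *v a) (z *v b) + D (z *v a) *v b = z *v (A' *v b)"
      using c(2) unfolding canonical_at_def by blast
    have "christoffel_apply \<gamma> (z *v a) (z *v b) - christoffel_apply \<gamma>' (z *v a) (z *v b) =
      z *v ((A - A') *v b)" for b
      using A(2)[of b] A'(2)[of b]
      by (simp add: matrix_vector_mult_diff_rdistrib matrix_vector_mult_diff_distrib)
         (metis add_diff_cancel_right)
    then have "d a b = (A - A') *v b" for b
      by (simp add: d_def matrix_inv_vec[OF z])
    then have "d a = (*v) (A - A')" by blast
    moreover have "model_endo (A - A')" using A(1) A'(1) by (rule model_endo_diff)
    ultimately show "d a (model_F *v b) = model_F *v d a b" "d a (model_P *v b) = model_P *v d a b" "linear (d a)"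
      by (auto simp: model_endo_vec)
  qed
  have lin': "linear (\<lambda>a. d a b)" for b
    unfolding d_def using bilinear_christoffel_apply[of \<gamma>] bilinear_christoffel_apply[of \<gamma>']
    by (auto intro!: linearI simp: bilinear_ladd bilinear_lmul matrix_vector_right_distrib
        matrix_vector_mult_scaleR matrix_vector_mult_diff_distrib scaleR_diff_right)
  have sym: "d a b = d b a" if "model_F *v a = a" "model_F *v b = - b" for a b
    using canonical_at_torsion[OF c(1) that] canonical_at_torsion[OF c(2) that] by (simp add: d_def)
  have pm: "d a b = 0 \<and> d b a = 0" if ab: "model_F *v a = a" "model_F *v b = - b" for a b
  proof -
    have "model_F *v d a b = - d a b" "model_F *v d b a = d b a"
      using comm(1)[of a b] comm(1)[of b a] ab by (simp_all add: linear_neg[OF lin])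
    \<comment> \<open>\<open>d a b\<close> and \<open>d b a\<close> belong to opposite eigenspaces
      of \<open>model_F\<close>, and \<open>sym\<close> identifies them.\<close>
    then have "d a b = - d a b" using sym[OF ab] by simp
    then have "d a b = 0" unfolding vec_eq_iff by simp
    then show ?thesis using sym[OF ab] by simp
  qed
  \<comment> \<open>Applying \<open>model_P\<close> to the second argument changes its eigenspace,
    so this reduces pairs of equal type to the mixed pairs already settled.\<close>
  have P: "d a b = model_P *v d a (model_P *v b)" for a b
    using comm(2)[of a b] by simp
  have "d (plus_part a) b = 0" for a b
  proof -
    have "d (plus_part a) (plus_part b) = 0"
      using pm[of "plus_part a" "model_P *v plus_part b"] P[of "plus_part a" "plus_part b"] by simp
    moreover have "d (plus_part a) (minus_part b) = 0" using pm by simp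
    ultimately show ?thesis
      using linear_add[OF lin, of "plus_part a" "plus_part b" "minus_part b"] by (simp add: plus_minus_part)
  qed
  moreover have "d (minus_part a) b = 0" for a b
  proof -
    have "d (minus_part a) (minus_part b) = 0"
      using pm[of "model_P *v minus_part b" "minus_part a"] P[of "minus_part a" "minus_part b"] by (simp add: vec.neg)
    moreover have "d (minus_part a) (plus_part b) = 0" using pm by simp
    ultimately show ?thesis
      using linear_add[OF lin, of "minus_part a" "plus_part b" "minus_part b"] by (simp add: plus_minus_part)
  qed
  ultimately have d0: "d a b = 0" for a b
    using linear_add[OF lin', of "plus_part a" "minus_part a" b] by (simp add: plus_minus_part)
  show ?thesis
  proof (rule christoffel_eqI)
    fix v w
    have "z *v d (matrix_inv z *v v) (matrix_inv z *v w) = 0" by (simp add: d0)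
    then show "christoffel_apply \<gamma> v w = christoffel_apply \<gamma>' v w"
      by (simp add: d_def matrix_inv_vec[OF z])
  qed
qed

section \<open>Existence and smoothness of the canonical Christoffel symbols\<close>

text \<open>The flat connection for which the frame is parallel satisfies the first condition. In frame
  components it is \<open>- frame_deriv z D\<close>, and its torsion is \<open>- frame_bracket z D\<close>; the correction
  \<open>torsion_correction z D\<close> commutes with the structure and cancels the torsion.\<close>

definition frame_deriv ::
  "real^('n + 'n)^('n + 'n) \<Rightarrow> (real^('n + 'n) \<Rightarrow> real^('n + 'n)^('n + 'n)) \<Rightarrow>
   real^('n + 'n) \<Rightarrow> real^('n + 'n) \<Rightarrow> real^('n::finite + 'n)" where
  "frame_deriv z D a b = matrix_inv z *v (D (z *v a) *v b)"

definition frame_bracket ::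
  "real^('n + 'n)^('n + 'n) \<Rightarrow> (real^('n + 'n) \<Rightarrow> real^('n + 'n)^('n + 'n)) \<Rightarrow>
   real^('n + 'n) \<Rightarrow> real^('n + 'n) \<Rightarrow> real^('n::finite + 'n)" where
  "frame_bracket z D a b = frame_deriv z D a b - frame_deriv z D b a"

text \<open>The formula is forced. For \<open>a\<close> in the plus and \<open>b\<close> in the
  minus eigenspace, a correction S that commutes with \<open>model_F\<close> has S(a,b) in the minus
  and S(b,a) in the plus eigenspace, and cancelling the torsion means that S(a,b) - S(b,a) is the
  bracket of \<open>a\<close> and \<open>b\<close>. So S(a,b) is the minus part of this bracket and
  S(b,a) the plus part of the bracket in reverse order: the first and third summands. The other two
  extend S to pairs of equal type by commutation with \<open>model_P\<close>.\<close>

definition torsion_correction ::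
  "real^('n + 'n)^('n + 'n) \<Rightarrow> (real^('n + 'n) \<Rightarrow> real^('n + 'n)^('n + 'n)) \<Rightarrow>
   real^('n + 'n) \<Rightarrow> real^('n + 'n) \<Rightarrow> real^('n::finite + 'n)" where
  "torsion_correction z D a b =
     minus_part (frame_bracket z D (plus_part a) (minus_part b)) +
     model_P *v minus_part (frame_bracket z D (plus_part a) (model_P *v plus_part b)) +
     plus_part (frame_bracket z D (minus_part a) (plus_part b)) +
     model_P *v plus_part (frame_bracket z D (minus_part a) (model_P *v minus_part b))"

definition canonical_christoffel ::
  "real^('n + 'n)^('n + 'n) \<Rightarrow> (real^('n + 'n) \<Rightarrow> real^('n + 'n)^('n + 'n)) \<Rightarrow> ('n::finite + 'n) christoffel" where
  "canonical_christoffel z D = christoffel_of (\<lambda>v w. z *v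
     (torsion_correction z D (matrix_inv z *v v) (matrix_inv z *v w) -
      frame_deriv z D (matrix_inv z *v v) (matrix_inv z *v w)))"

lemma bilinear_frame_deriv:
  assumes "linear D"
  shows "bilinear (frame_deriv z D)"
  unfolding bilinear_def frame_deriv_def
  by (auto intro!: linearI simp: matrix_vector_right_distrib matrix_vector_mult_add_rdistrib
      matrix_vector_mult_scaleR scaleR_matrix_vector_assoc[symmetric] linear_add[OF assms] linear_scale[OF assms])

lemma bilinear_frame_bracket:
  assumes "linear D"
  shows "bilinear (frame_bracket z D)"
  using bilinear_frame_deriv[OF assms, of z] unfolding bilinear_def frame_bracket_def
  by (auto intro!: linear_compose_sub)

lemma bilinear_torsion_correction:
  assumes "linear D"
  shows "bilinear (torsion_correction z D)"
proof -
  note B = bilinear_frame_bracket[OF assms, of z]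
  show ?thesis
    unfolding bilinear_def torsion_correction_def
    by (auto intro!: linearI simp: bilinear_ladd[OF B] bilinear_lmul[OF B] bilinear_radd[OF B] bilinear_rmul[OF B]
        linear_add[OF linear_part(1)] linear_add[OF linear_part(2)] linear_scale[OF linear_part(1)]
        linear_scale[OF linear_part(2)] matrix_vector_right_distrib matrix_vector_mult_scaleR scaleR_add_right)
qed

text \<open>Each summand lies in the eigenspace of \<open>model_F\<close> to which the part of
  \<open>b\<close> occurring in it belongs, which gives the first equation. Replacing
  \<open>b\<close> by its image under \<open>model_P\<close> exchanges the first summand with the
  second and the third with the fourth, up to \<open>model_P\<close>.\<close>

lemma torsion_correction_comm:
  assumes "linear D"
  shows "torsion_correction z D a (model_F *v b) = model_F *v torsion_correction z D a b"
    "torsion_correction z D a (model_P *v b) = model_P *v torsion_correction z D a b"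
proof -
  note B = bilinear_frame_bracket[OF assms, of z]
  show "torsion_correction z D a (model_F *v b) = model_F *v torsion_correction z D a b"
    by (simp add: torsion_correction_def bilinear_rneg[OF B] matrix_vector_right_distrib vec.neg
        linear_neg[OF linear_part(1)] linear_neg[OF linear_part(2)])
  show "torsion_correction z D a (model_P *v b) = model_P *v torsion_correction z D a b"
    by (simp add: torsion_correction_def matrix_vector_right_distrib)
qed

lemma canonical_at_canonical_christoffel:
  assumes z: "invertible z" and D: "linear D"
  shows "canonical_at z D (canonical_christoffel z D)"
proof -
  let ?h = "\<lambda>v w. z *v (torsion_correction z D (matrix_inv z *v v) (matrix_inv z *v w) -
      frame_deriv z D (matrix_inv z *v v) (matrix_inv z *v w))"
  note S = bilinear_torsion_correction[OF D, of z] and E = bilinear_frame_deriv[OF D, of z]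
  have "bilinear ?h"
    unfolding bilinear_def
    by (auto intro!: linearI simp: bilinear_ladd[OF S] bilinear_lmul[OF S] bilinear_radd[OF S] bilinear_rmul[OF S]
        bilinear_ladd[OF E] bilinear_lmul[OF E] bilinear_radd[OF E] bilinear_rmul[OF E]
        matrix_vector_right_distrib matrix_vector_mult_scaleR matrix_vector_mult_diff_distrib
        scaleR_diff_right)
  then have app: "christoffel_apply (canonical_christoffel z D) v w = ?h v w" for v w
    unfolding canonical_christoffel_def by (rule christoffel_apply_of)
  show ?thesis
    unfolding canonical_at_def app
  proof (intro conjI allI impI)
    fix v
    define A where "A = matrix (torsion_correction z D (matrix_inv z *v v))"
    have A: "A *v b = torsion_correction z D (matrix_inv z *v v) b" for b
      unfolding A_def using S by (intro matrix_works) (auto simp: bilinear_def linear_matrix_vector_mul_eq)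
    have "model_endo A"
      by (simp add: model_endo_vec A torsion_correction_comm[OF D])
    moreover have "z *v (torsion_correction z D (matrix_inv z *v v) (matrix_inv z *v (z *v b)) -
        frame_deriv z D (matrix_inv z *v v) (matrix_inv z *v (z *v b))) + D v *v b = z *v (A *v b)" for b
      by (simp add: A matrix_inv_vec[OF z] frame_deriv_def matrix_vector_mult_diff_distrib)
    ultimately show "\<exists>A. model_endo A \<and> (\<forall>b. z *v (torsion_correction z D (matrix_inv z *v v) (matrix_inv z *v (z *v b)) -
        frame_deriv z D (matrix_inv z *v v) (matrix_inv z *v (z *v b))) + D v *v b = z *v (A *v b))"
      by blast
  next
    fix a b :: "real^('a + 'a)"
    assume ab: "model_F *v a = a" "model_F *v b = - b"
    note B = bilinear_frame_bracket[OF D, of z]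
    have "frame_bracket z D b a = - frame_bracket z D a b" by (simp add: frame_bracket_def)
    \<comment> \<open>On a mixed pair one summand survives in each order; by antisymmetry of the
      bracket they contribute its minus part and its plus part, together the whole bracket.\<close>
    then have "torsion_correction z D a b - torsion_correction z D b a =
        minus_part (frame_bracket z D a b) + plus_part (frame_bracket z D a b)"
      using ab by (simp add: torsion_correction_def part_eigen bilinear_lzero[OF B] bilinear_rzero[OF B]
          linear_0[OF linear_part(1)] linear_0[OF linear_part(2)] linear_neg[OF linear_part(1)])
    also have "\<dots> = frame_deriv z D a b - frame_deriv z D b a"
      by (simp add: plus_minus_part add.commute[of "minus_part _"]) (simp add: frame_bracket_def)
    finally have "torsion_correction z D a b - frame_deriv z D a b =
        torsion_correction z D b a - frame_deriv z D b a"
      by (simp add: algebra_simps)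
    then show "z *v (torsion_correction z D (matrix_inv z *v (z *v a)) (matrix_inv z *v (z *v b)) -
           frame_deriv z D (matrix_inv z *v (z *v a)) (matrix_inv z *v (z *v b))) =
        z *v (torsion_correction z D (matrix_inv z *v (z *v b)) (matrix_inv z *v (z *v a)) -
           frame_deriv z D (matrix_inv z *v (z *v b)) (matrix_inv z *v (z *v a)))"
      by (simp add: matrix_inv_vec[OF z])
  qed
qed

text \<open>\<open>D x\<close> is a function, so its smooth dependence on \<open>x\<close> is
  expressed by evaluation at smooth arguments. This covers a Frechet derivative as well as a linear
  map assembled from jet coordinates.\<close>

lemma smooth_on_canonical_christoffel:
  assumes S: "open S" and z: "smooth_on S z" "\<And>x. x \<in> S \<Longrightarrow> invertible (z x)"
    and D: "\<And>u. smooth_on S u \<Longrightarrow> smooth_on S (\<lambda>x. D x (u x))"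
  shows "smooth_on S (\<lambda>x. canonical_christoffel (z x) (D x))"
proof -
  note zi = smooth_on_matrix_inv[OF S z]
  note mv = smooth_on_matrix_vector_mult[OF S]
  have fd: "smooth_on S (\<lambda>x. frame_deriv (z x) (D x) (a x) (b x))" if "smooth_on S a" "smooth_on S b" for a b
    unfolding frame_deriv_def using that by (intro mv zi D z(1))
  then have fb: "smooth_on S (\<lambda>x. frame_bracket (z x) (D x) (a x) (b x))" if "smooth_on S a" "smooth_on S b" for a b
    unfolding frame_bracket_def using that S by (intro smooth_on_diff) auto
  have P: "smooth_on S (\<lambda>x. model_P *v a x)" if "smooth_on S a" for a
    using that by (rule mv[OF smooth_on_const[OF S]])
  have parts: "smooth_on S (\<lambda>x. plus_part (a x))" "smooth_on S (\<lambda>x. minus_part (a x))" if "smooth_on S a" for a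
    using smooth_on_linear[OF _ S that] linear_part by (auto simp: linear_conv_bounded_linear)
  have tc: "smooth_on S (\<lambda>x. torsion_correction (z x) (D x) (a x) (b x))" if "smooth_on S a" "smooth_on S b" for a b
    unfolding torsion_correction_def using that by (intro smooth_on_add[OF S] P parts fb)
  have c: "smooth_on S (\<lambda>x. matrix_inv (z x) *v axis i 1)" for i
    by (intro mv zi smooth_on_const[OF S])
  show ?thesis
    unfolding canonical_christoffel_def christoffel_of_def
    by (intro smooth_on_vec_lambda[OF S] smooth_on_vec_nth[OF S] mv z(1) smooth_on_diff[OF S] tc fd c)
qed

text \<open>The gauge law of connection matrices: with \<open>h\<close> in the role of the
  derivative of \<open>g\<close>, the matrix \<open>A\<close> turns into g^-1 (A g + h), which stays
  in the commutant because \<open>g\<close> and \<open>h v\<close> do. The torsion condition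
  survives because \<open>g\<close> preserves both eigenspaces of \<open>model_F\<close>.\<close>

lemma canonical_at_change_frame:
  assumes c: "canonical_at z D \<gamma>" and g: "model_endo g" "invertible g" "\<And>v. model_endo (h v)"
    and D': "\<And>v b. D' v *v b = D v *v (g *v b) + z *v (h v *v b)"
  shows "canonical_at (z ** g) D' \<gamma>"
  unfolding canonical_at_def
proof (intro conjI allI impI)
  fix v
  obtain A where A: "model_endo A" "\<And>b. christoffel_apply \<gamma> v (z *v b) + D v *v b = z *v (A *v b)"
    using c unfolding canonical_at_def by blast
  show "\<exists>A. model_endo A \<and> (\<forall>b. christoffel_apply \<gamma> v (z ** g *v b) + D' v *v b = z ** g *v (A *v b))"
  proof (intro exI[of _ "matrix_inv g ** (A ** g + h v)"] conjI allI)
    show "model_endo (matrix_inv g ** (A ** g + h v))"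
      using A(1) g by (intro model_endo_mult model_endo_add model_endo_matrix_inv)
    fix b
    show "christoffel_apply \<gamma> v (z ** g *v b) + D' v *v b = z ** g *v (matrix_inv g ** (A ** g + h v) *v b)"
      using A(2)[of "g *v b"] by (simp add: D' matrix_vector_right_distrib matrix_vector_mult_add_rdistrib
          matrix_inv_vec[OF g(2)] flip: matrix_vector_mul_assoc)
  qed
next
  fix a b :: "real^('a + 'a)"
  assume "model_F *v a = a" "model_F *v b = - b"
  then have "model_F *v (g *v a) = g *v a" "model_F *v (g *v b) = - (g *v b)"
    using g(1) by (metis model_endo_vec, metis model_endo_vec vec.neg)
  then show "christoffel_apply \<gamma> (z ** g *v a) (z ** g *v b) = christoffel_apply \<gamma> (z ** g *v b) (z ** g *v a)"
    using canonical_at_torsion[OF c] by (simp flip: matrix_vector_mul_assoc)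
qed

text \<open>\<open>J\<close> plays the Jacobian and \<open>Q\<close> the Hessian of a change of
  coordinates. In the first condition the Hessian of the frame derivative cancels that of the
  Christoffel symbols; in the torsion condition it drops out by symmetry.\<close>

lemma canonical_at_change_coordinates:
  assumes c: "canonical_at z D \<gamma>" and J: "linear J" "surj J" and Q: "\<And>v w. Q v w = Q w v"
    and \<gamma>': "\<And>v w. christoffel_apply \<gamma>' (J v) (J w) = J (christoffel_apply \<gamma> v w) - Q v w"
    and z': "\<And>b. z' *v b = J (z *v b)"
    and D': "\<And>v b. D' (J v) *v b = J (D v *v b) + Q v (z *v b)"
  shows "canonical_at z' D' \<gamma>'"
  unfolding canonical_at_def
proof (intro conjI allI impI)
  fix v'
  obtain v where v: "v' = J v" using J(2) by blast
  obtain A where A: "model_endo A" "\<And>b. christoffel_apply \<gamma> v (z *v b) + D v *v b = z *v (A *v b)"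
    using c unfolding canonical_at_def by blast
  have "christoffel_apply \<gamma>' v' (z' *v b) + D' v' *v b = z' *v (A *v b)" for b
    unfolding v z' \<gamma>' D' A(2)[symmetric] by (simp add: linear_add[OF J(1)])
  then show "\<exists>A. model_endo A \<and> (\<forall>b. christoffel_apply \<gamma>' v' (z' *v b) + D' v' *v b = z' *v (A *v b))"
    using A(1) by blast
next
  fix a b :: "real^('a + 'a)"
  assume "model_F *v a = a" "model_F *v b = - b"
  then have "christoffel_apply \<gamma> (z *v a) (z *v b) = christoffel_apply \<gamma> (z *v b) (z *v a)"
    by (rule canonical_at_torsion[OF c])
  then show "christoffel_apply \<gamma>' (z' *v a) (z' *v b) = christoffel_apply \<gamma>' (z' *v b) (z' *v a)"
    by (simp add: z' \<gamma>' Q[of "z *v a"])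
qed

section \<open>Maps and fields in charts\<close>

text \<open>A product rule for the pairing of a derivative with a varying vector. Over a basis the
  pairing is a finite sum of products; the part with frozen coefficients \<open>R x\<close> is
  recognised as the second derivative.\<close>

lemma has_derivative_frechet_apply:
  fixes f :: "'a::euclidean_space \<Rightarrow> 'b::real_normed_vector"
  assumes S: "open S" "x \<in> S" and f: "smooth_on S f" and R: "(R has_derivative R') (at x)"
  shows "((\<lambda>y. frechet_derivative f (at y) (R y)) has_derivative
    (\<lambda>v. frechet_derivative f (at x) (R' v) + frechet_derivative (\<lambda>y. frechet_derivative f (at y) (R x)) (at x) v)) (at x)"
proof -
  let ?D = "\<lambda>b. frechet_derivative (\<lambda>y. frechet_derivative f (at y) b) (at x)"
  have lin: "linear (frechet_derivative f (at y))" if "y \<in> S" for y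
    using smooth_on_has_derivative[OF f that] by (rule has_derivative_linear)
  have D: "((\<lambda>y. frechet_derivative f (at y) b) has_derivative ?D b) (at x)" for b
    by (rule smooth_on_has_derivative[OF smooth_on_frechet_derivative_const[OF f] S(2)])
  have expand: "(\<Sum>b\<in>Basis. (w \<bullet> b) *\<^sub>R frechet_derivative f (at y) b) = frechet_derivative f (at y) w"
    if "y \<in> S" for y w
    by (rule linear_eq_sum_Basis[OF lin[OF that], symmetric])
  have d1: "((\<lambda>y. \<Sum>b\<in>Basis. (R x \<bullet> b) *\<^sub>R frechet_derivative f (at y) b) has_derivative
      (\<lambda>v. \<Sum>b\<in>Basis. (R x \<bullet> b) *\<^sub>R ?D b v)) (at x)"
    by (intro has_derivative_sum has_derivative_scaleR_right D)
  have 1: "?D (R x) = (\<lambda>v. \<Sum>b\<in>Basis. (R x \<bullet> b) *\<^sub>R ?D b v)"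
    using has_derivative_transform_within_open[OF d1 S expand] by (rule frechet_derivative_at[symmetric])
  have d2: "((\<lambda>y. \<Sum>b\<in>Basis. (R y \<bullet> b) *\<^sub>R frechet_derivative f (at y) b) has_derivative
      (\<lambda>v. \<Sum>b\<in>Basis. (R x \<bullet> b) *\<^sub>R ?D b v + (R' v \<bullet> b) *\<^sub>R frechet_derivative f (at x) b)) (at x)"
    by (intro has_derivative_sum has_derivative_scaleR D has_derivative_inner_left R)
  have 2: "((\<lambda>y. frechet_derivative f (at y) (R y)) has_derivative
      (\<lambda>v. \<Sum>b\<in>Basis. (R x \<bullet> b) *\<^sub>R ?D b v + (R' v \<bullet> b) *\<^sub>R frechet_derivative f (at x) b)) (at x)"
    using has_derivative_transform_within_open[OF d2 S expand] .
  have "(\<lambda>v. \<Sum>b\<in>Basis. (R x \<bullet> b) *\<^sub>R ?D b v + (R' v \<bullet> b) *\<^sub>R frechet_derivative f (at x) b) =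
      (\<lambda>v. frechet_derivative f (at x) (R' v) + ?D (R x) v)"
    by (simp only: 1 sum.distrib expand[OF S(2)] add.commute)
  with 2 show ?thesis by simp
qed

text \<open>Both sides come from differentiating the transformation law \<open>eq\<close> of vector
  components: by the chain rule on the left, by the product rule for
  \<open>frechet_derivative f\<close> on the right.\<close>

lemma derivative_transform:
  fixes f :: "'a::euclidean_space \<Rightarrow> 'b::real_normed_vector"
  assumes S: "open S" "x \<in> S" and f: "smooth_on S f"
    and R: "R differentiable at x" and R': "R' differentiable at (f x)"
    and eq: "\<And>y. y \<in> S \<Longrightarrow> R' (f y) = frechet_derivative f (at y) (R y)"
  shows "frechet_derivative R' (at (f x)) (frechet_derivative f (at x) v) =
    frechet_derivative f (at x) (frechet_derivative R (at x) v) +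
    frechet_derivative (\<lambda>y. frechet_derivative f (at y) (R x)) (at x) v"
proof -
  have "frechet_derivative f (at y) (R y) = R' (f y)" if "y \<in> S" for y
    by (rule eq[OF that, symmetric])
  from has_derivative_transform_within_open[OF has_derivative_frechet_apply[OF S f R[unfolded frechet_derivative_works]] S this]
  have 1: "((\<lambda>y. R' (f y)) has_derivative (\<lambda>v. frechet_derivative f (at x) (frechet_derivative R (at x) v) +
    frechet_derivative (\<lambda>y. frechet_derivative f (at y) (R x)) (at x) v)) (at x)" .
  have 2: "((\<lambda>y. R' (f y)) has_derivative (\<lambda>v. frechet_derivative R' (at (f x)) (frechet_derivative f (at x) v))) (at x)"
    using has_derivative_compose[OF smooth_on_has_derivative[OF f S(2)] R'[unfolded frechet_derivative_works]] .
  show ?thesis using fun_cong[OF has_derivative_unique[OF 2 1]] .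
qed

lemma bilinear_second_derivative:
  fixes f :: "'a::euclidean_space \<Rightarrow> 'b::real_normed_vector"
  assumes S: "open S" "x \<in> S" and f: "smooth_on S f"
  shows "bilinear (\<lambda>v w. frechet_derivative (\<lambda>y. frechet_derivative f (at y) w) (at x) v)"
proof -
  have lin: "linear (frechet_derivative f (at y))" if "y \<in> S" for y
    using smooth_on_has_derivative[OF f that] by (rule has_derivative_linear)
  have D: "((\<lambda>y. frechet_derivative f (at y) b) has_derivative
      frechet_derivative (\<lambda>y. frechet_derivative f (at y) b) (at x)) (at x)" for b
    by (rule smooth_on_has_derivative[OF smooth_on_frechet_derivative_const[OF f] S(2)])
  show ?thesis
    unfolding bilinear_def
  proof (intro conjI allI)
    show "linear (frechet_derivative (\<lambda>y. frechet_derivative f (at y) w) (at x))" for w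
      using D by (rule has_derivative_linear)
    show "linear (\<lambda>w. frechet_derivative (\<lambda>y. frechet_derivative f (at y) w) (at x) v)" for v
    proof (rule linearI)
      fix a b :: 'a and r :: real
      have "frechet_derivative f (at y) a + frechet_derivative f (at y) b = frechet_derivative f (at y) (a + b)" if "y \<in> S" for y
        by (rule linear_add[OF lin[OF that], symmetric])
      from has_derivative_transform_within_open[OF has_derivative_add[OF D[of a] D[of b]] S this]
      show "frechet_derivative (\<lambda>y. frechet_derivative f (at y) (a + b)) (at x) v =
          frechet_derivative (\<lambda>y. frechet_derivative f (at y) a) (at x) v +
          frechet_derivative (\<lambda>y. frechet_derivative f (at y) b) (at x) v"
        by (rule fun_cong[OF frechet_derivative_at, symmetric])
      have "r *\<^sub>R frechet_derivative f (at y) a = frechet_derivative f (at y) (r *\<^sub>R a)" if "y \<in> S" for y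
        by (rule linear_scale[OF lin[OF that], symmetric])
      from has_derivative_transform_within_open[OF has_derivative_scaleR_right[OF D[of a]] S this]
      show "frechet_derivative (\<lambda>y. frechet_derivative f (at y) (r *\<^sub>R a)) (at x) v =
          r *\<^sub>R frechet_derivative (\<lambda>y. frechet_derivative f (at y) a) (at x) v"
        by (rule fun_cong[OF frechet_derivative_at, symmetric])
    qed
  qed
qed

text \<open>A general map in a general pair of charts. With its derivative it subsumes
  \<open>to_coords\<close>, \<open>from_coords\<close> and \<open>tangent_map\<close>, so that a
  single chain rule serves all three.\<close>

definition chart_rep ::
  "('a, 'm::finite) chart \<Rightarrow> ('a, 'm) chart \<Rightarrow> ('a \<Rightarrow> 'a) \<Rightarrow> real^'m \<Rightarrow> real^'m" where
  "chart_rep c d \<phi> = snd d \<circ> \<phi> \<circ> chart_inv c"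

definition chart_deriv ::
  "('a, 'm::finite) chart \<Rightarrow> ('a, 'm) chart \<Rightarrow> ('a \<Rightarrow> 'a) \<Rightarrow> 'a \<Rightarrow> real^'m \<Rightarrow> real^'m" where
  "chart_deriv c d \<phi> x = frechet_derivative (chart_rep c d \<phi>) (at (snd c x))"

definition chart_dom ::
  "('a, 'm::finite) chart \<Rightarrow> ('a, 'm) chart \<Rightarrow> ('a \<Rightarrow> 'a) \<Rightarrow> 'a set \<Rightarrow> (real^'m) set" where
  "chart_dom c d \<phi> U = snd c ` (U \<inter> fst c \<inter> \<phi> -` fst d)"

locale smooth_manifold =
  fixes \<A> :: "('a::{t2_space, second_countable_topology}, 'm::finite) chart set"
  assumes atlas: "smooth_atlas \<A>"
begin

abbreviation \<kappa> :: "'a \<Rightarrow> ('a, 'm) chart" where "\<kappa> \<equiv> chart_at \<A>"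

lemma \<kappa>: "\<kappa> x \<in> \<A>" "x \<in> fst (\<kappa> x)"
proof -
  have "\<exists>c. c \<in> \<A> \<and> x \<in> fst c" using atlas unfolding smooth_atlas_def by blast
  from someI_ex[OF this] show "\<kappa> x \<in> \<A>" "x \<in> fst (\<kappa> x)" by (auto simp: chart_at_def)
qed

lemma chart:
  assumes "c \<in> \<A>"
  shows "open (fst c)" "open (snd c ` fst c)" "homeomorphism (fst c) (snd c ` fst c) (snd c) (chart_inv c)"
  using assms atlas by (auto simp: smooth_atlas_def is_chart_def)

lemma chart_inv [simp]: "c \<in> \<A> \<Longrightarrow> x \<in> fst c \<Longrightarrow> chart_inv c (snd c x) = x"
  using chart(3) by (auto simp: homeomorphism_def)

lemma chart_eq_iff: "c \<in> \<A> \<Longrightarrow> x \<in> fst c \<Longrightarrow> y \<in> fst c \<Longrightarrow> snd c x = snd c y \<longleftrightarrow> x = y"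
  by (metis chart_inv)

lemma open_chart_image: "c \<in> \<A> \<Longrightarrow> open W \<Longrightarrow> W \<subseteq> fst c \<Longrightarrow> open (snd c ` W)"
  using homeomorphism_imp_open_map[OF chart(3), of c W] chart(1,2)[of c]
  by (auto simp: openin_open_eq)

lemma open_chart_dom:
  assumes "c \<in> \<A>" "d \<in> \<A>" "open U" "smooth_map_on \<A> U \<phi>"
  shows "open (chart_dom c d \<phi> U)" "open (U \<inter> fst c \<inter> \<phi> -` fst d)"
proof -
  have "open (\<phi> -` fst d \<inter> U)"
    using assms(2,4) chart(1) continuous_on_open_vimage[OF assms(3), of \<phi>] by (auto simp: smooth_map_on_def)
  then have "open ((\<phi> -` fst d \<inter> U) \<inter> fst c)" using assms chart(1) by blast
  moreover have "(\<phi> -` fst d \<inter> U) \<inter> fst c = U \<inter> fst c \<inter> \<phi> -` fst d" by blast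
  ultimately show "open (U \<inter> fst c \<inter> \<phi> -` fst d)" by simp
  then show "open (chart_dom c d \<phi> U)"
    unfolding chart_dom_def using assms(1) by (intro open_chart_image) auto
qed

lemma smooth_chart_rep:
  "c \<in> \<A> \<Longrightarrow> d \<in> \<A> \<Longrightarrow> smooth_map_on \<A> U \<phi> \<Longrightarrow> smooth_on (chart_dom c d \<phi> U) (chart_rep c d \<phi>)"
  by (simp add: smooth_map_on_def chart_dom_def chart_rep_def)

lemma chart_rep_apply: "c \<in> \<A> \<Longrightarrow> x \<in> fst c \<Longrightarrow> chart_rep c d \<phi> (snd c x) = snd d (\<phi> x)"
  by (simp add: chart_rep_def)

lemma chart_dom_iff: "c \<in> \<A> \<Longrightarrow> x \<in> fst c \<Longrightarrow> snd c x \<in> chart_dom c d \<phi> U \<longleftrightarrow> x \<in> U \<and> \<phi> x \<in> fst d"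
  by (auto simp: chart_dom_def chart_eq_iff)

lemma has_derivative_chart_rep:
  assumes "c \<in> \<A>" "d \<in> \<A>" "smooth_map_on \<A> U \<phi>" "x \<in> U" "x \<in> fst c" "\<phi> x \<in> fst d"
  shows "(chart_rep c d \<phi> has_derivative chart_deriv c d \<phi> x) (at (snd c x))"
  unfolding chart_deriv_def
  using assms by (intro smooth_on_has_derivative[OF smooth_chart_rep[OF assms(1-3)]]) (auto simp: chart_dom_iff)

lemma linear_chart_deriv:
  assumes "c \<in> \<A>" "d \<in> \<A>" "smooth_map_on \<A> U \<phi>" "x \<in> U" "x \<in> fst c" "\<phi> x \<in> fst d"
  shows "linear (chart_deriv c d \<phi> x)"
  using has_derivative_chart_rep[OF assms] by (rule has_derivative_linear)

text \<open>The composite is required to agree with \<open>\<theta>\<close> on \<open>U\<close>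
  only. This lets a diffeomorphism followed by its inverse count as the identity although
  \<open>inv_into\<close> means nothing off the image.\<close>

lemma chart_deriv_compose:
  assumes ch: "c \<in> \<A>" "d \<in> \<A>" "e \<in> \<A>" and \<phi>: "open U" "smooth_map_on \<A> U \<phi>" and \<psi>: "smooth_map_on \<A> U' \<psi>"
    and x: "x \<in> U" "\<phi> x \<in> U'" "x \<in> fst c" "\<phi> x \<in> fst d" "\<psi> (\<phi> x) \<in> fst e"
    and \<theta>: "\<And>y. y \<in> U \<Longrightarrow> \<psi> (\<phi> y) = \<theta> y"
  shows "chart_deriv d e \<psi> (\<phi> x) (chart_deriv c d \<phi> x v) = chart_deriv c e \<theta> x v"
proof -
  have f: "(chart_rep c d \<phi> has_derivative chart_deriv c d \<phi> x) (at (snd c x))"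
    using assms by (intro has_derivative_chart_rep) auto
  have g: "(chart_rep d e \<psi> has_derivative chart_deriv d e \<psi> (\<phi> x)) (at (chart_rep c d \<phi> (snd c x)))"
    using assms by (auto simp: chart_rep_apply intro!: has_derivative_chart_rep)
  have "(chart_rep c e \<theta> has_derivative (\<lambda>v. chart_deriv d e \<psi> (\<phi> x) (chart_deriv c d \<phi> x v))) (at (snd c x))"
  proof (rule has_derivative_transform_within_open[OF has_derivative_compose[OF f g]])
    show "open (chart_dom c d \<phi> U)" using assms by (intro open_chart_dom)
    show "snd c x \<in> chart_dom c d \<phi> U" using assms by (simp add: chart_dom_iff)
    show "chart_rep d e \<psi> (chart_rep c d \<phi> y) = chart_rep c e \<theta> y" if "y \<in> chart_dom c d \<phi> U" for y
      using that ch \<theta> by (auto simp: chart_dom_def chart_rep_apply)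
  qed
  then show ?thesis unfolding chart_deriv_def[of c e] by (metis frechet_derivative_at)
qed

lemma smooth_map_on_id: "smooth_map_on \<A> UNIV (\<lambda>x. x)"
  using atlas by (auto simp: smooth_map_on_def smooth_atlas_def comp_def)

lemma diffeomorphism_id: "diffeomorphism \<A> UNIV UNIV (\<lambda>x. x)"
proof -
  have "inv_into UNIV (\<lambda>x::'a. x) = (\<lambda>x. x)" by (simp add: inv_into_def)
  then show ?thesis by (simp add: diffeomorphism_def smooth_map_on_id bij_betw_def)
qed

lemma chart_deriv_id:
  assumes "c \<in> \<A>" "x \<in> fst c"
  shows "chart_deriv c c (\<lambda>x. x) x v = v"
proof -
  have "(chart_rep c c (\<lambda>x. x) has_derivative (\<lambda>v. v)) (at (snd c x))"
    by (rule has_derivative_transform_within_open[OF has_derivative_ident chart(2)[OF assms(1)]])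
       (use assms in \<open>auto simp: chart_rep_apply\<close>)
  then show ?thesis unfolding chart_deriv_def by (metis frechet_derivative_at)
qed

lemma to_coords_eq: "to_coords \<A> c x = chart_deriv (\<kappa> x) c (\<lambda>x. x) x"
  by (simp add: to_coords_def chart_deriv_def chart_rep_def comp_def)

lemma from_coords_eq: "from_coords \<A> c x = chart_deriv c (\<kappa> x) (\<lambda>x. x) x"
  by (simp add: from_coords_def chart_deriv_def chart_rep_def comp_def)

lemma tangent_map_eq: "tangent_map \<A> \<phi> x = chart_deriv (\<kappa> x) (\<kappa> (\<phi> x)) \<phi> x"
  by (simp add: tangent_map_def chart_deriv_def chart_rep_def)

lemma linear_to_coords: "c \<in> \<A> \<Longrightarrow> x \<in> fst c \<Longrightarrow> linear (to_coords \<A> c x)"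
  unfolding to_coords_eq by (rule linear_chart_deriv[OF _ _ smooth_map_on_id]) (auto intro: \<kappa>)

lemma linear_from_coords: "c \<in> \<A> \<Longrightarrow> x \<in> fst c \<Longrightarrow> linear (from_coords \<A> c x)"
  unfolding from_coords_eq by (rule linear_chart_deriv[OF _ _ smooth_map_on_id]) (auto intro: \<kappa>)

lemma linear_tangent_map: "smooth_map_on \<A> U \<phi> \<Longrightarrow> x \<in> U \<Longrightarrow> linear (tangent_map \<A> \<phi> x)"
  unfolding tangent_map_eq by (rule linear_chart_deriv) (auto intro: \<kappa>)

lemma to_from_coords [simp]: "c \<in> \<A> \<Longrightarrow> x \<in> fst c \<Longrightarrow> to_coords \<A> c x (from_coords \<A> c x v) = v"
  unfolding to_coords_eq from_coords_eq
  using chart_deriv_compose[OF _ \<kappa>(1) _ open_UNIV smooth_map_on_id smooth_map_on_id, of c c x x "\<lambda>x. x" v]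
  by (simp add: \<kappa> chart_deriv_id)

lemma from_to_coords [simp]: "c \<in> \<A> \<Longrightarrow> x \<in> fst c \<Longrightarrow> from_coords \<A> c x (to_coords \<A> c x v) = v"
  unfolding to_coords_eq from_coords_eq
  using chart_deriv_compose[OF \<kappa>(1) _ \<kappa>(1) open_UNIV smooth_map_on_id smooth_map_on_id, of c x x x "\<lambda>x. x" v]
  by (simp add: \<kappa> chart_deriv_id)

lemma to_coords_chart_at [simp]: "to_coords \<A> (\<kappa> x) x v = v"
  by (simp add: to_coords_eq chart_deriv_id \<kappa>)

lemma tangent_map_id: "tangent_map \<A> (\<lambda>x. x) x v = v"
  by (simp add: tangent_map_eq chart_deriv_id \<kappa>)

text \<open>Both sides are the derivative of \<open>\<phi>\<close> from the chosen chart at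
  \<open>x\<close> to \<open>d\<close>; the chain rule inserts the identity after
  \<open>\<phi>\<close> on the left and before it on the right.\<close>

lemma to_coords_tangent_map:
  assumes "c \<in> \<A>" "d \<in> \<A>" "open U" "smooth_map_on \<A> U \<phi>" "x \<in> U" "x \<in> fst c" "\<phi> x \<in> fst d"
  shows "to_coords \<A> d (\<phi> x) (tangent_map \<A> \<phi> x v) = chart_deriv c d \<phi> x (to_coords \<A> c x v)"
  unfolding to_coords_eq tangent_map_eq
  using chart_deriv_compose[OF \<kappa>(1) \<kappa>(1) assms(2,3,4) smooth_map_on_id, of x x "\<phi> x" \<phi> v]
    chart_deriv_compose[OF \<kappa>(1) assms(1,2) open_UNIV smooth_map_on_id assms(4), of x x \<phi> v] assms
  by (simp add: \<kappa>)

section \<open>Diffeomorphisms and vector fields in charts\<close>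

lemma diffeomorphism_inverse:
  assumes "diffeomorphism \<A> U U' \<phi>"
  shows "open U" "open U'" "smooth_map_on \<A> U \<phi>" "smooth_map_on \<A> U' (inv_into U \<phi>)"
    "\<And>x. x \<in> U \<Longrightarrow> \<phi> x \<in> U'" "\<And>y. y \<in> U' \<Longrightarrow> inv_into U \<phi> y \<in> U"
    "\<And>x. x \<in> U \<Longrightarrow> inv_into U \<phi> (\<phi> x) = x" "\<And>y. y \<in> U' \<Longrightarrow> \<phi> (inv_into U \<phi> y) = y"
  using assms by (auto simp: diffeomorphism_def bij_betw_inv_into_left bij_betw_inv_into_right
      bij_betw_apply bij_betw_apply[OF bij_betw_inv_into])

lemma diffeomorphism_open_image:
  assumes "diffeomorphism \<A> U U' \<phi>" "open V" "V \<subseteq> U"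
  shows "open (\<phi> ` V)"
proof -
  note d = diffeomorphism_inverse[OF assms(1)]
  have "\<phi> ` V = inv_into U \<phi> -` V \<inter> U'"
    using d(5,7,8) assms(3) by (auto simp: image_iff) (metis)
  moreover have "open (inv_into U \<phi> -` V \<inter> U')"
    using d(2,4) assms(2) continuous_on_open_vimage[OF d(2)] by (auto simp: smooth_map_on_def)
  ultimately show ?thesis by simp
qed

lemma chart_deriv_inverse:
  assumes "diffeomorphism \<A> U U' \<phi>" "c \<in> \<A>" "d \<in> \<A>" "x \<in> U" "x \<in> fst c" "\<phi> x \<in> fst d"
  shows "chart_deriv c d \<phi> x (chart_deriv d c (inv_into U \<phi>) (\<phi> x) v) = v"
proof -
  note \<phi> = diffeomorphism_inverse[OF assms(1)]
  have "chart_deriv c d \<phi> (inv_into U \<phi> (\<phi> x)) (chart_deriv d c (inv_into U \<phi>) (\<phi> x) v) = chart_deriv d d (\<lambda>x. x) (\<phi> x) v"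
    by (rule chart_deriv_compose[OF assms(3,2,3) \<phi>(2,4,3)]) (use assms \<phi> in auto)
  then show ?thesis using assms \<phi> by (simp add: chart_deriv_id)
qed

lemma surj_chart_deriv:
  assumes "diffeomorphism \<A> U U' \<phi>" "c \<in> \<A>" "d \<in> \<A>" "x \<in> U" "x \<in> fst c" "\<phi> x \<in> fst d"
  shows "surj (chart_deriv c d \<phi> x)"
  using chart_deriv_inverse[OF assms] by (metis surj_def)

lemma field_rep_apply: "c \<in> \<A> \<Longrightarrow> x \<in> fst c \<Longrightarrow> field_rep \<A> c X (snd c x) = to_coords \<A> c x (X x)"
  by (simp add: field_rep_def)

lemma field_rep_push:
  assumes "c \<in> \<A>" "d \<in> \<A>" "open U" "smooth_map_on \<A> U \<phi>"
    and X': "\<And>x. x \<in> W \<Longrightarrow> X' (\<phi> x) = tangent_map \<A> \<phi> x (X x)"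
    and y: "y \<in> chart_dom c d \<phi> U" "y \<in> snd c ` (W \<inter> fst c)"
  shows "field_rep \<A> d X' (chart_rep c d \<phi> y) = frechet_derivative (chart_rep c d \<phi>) (at y) (field_rep \<A> c X y)"
proof -
  obtain x where x: "y = snd c x" "x \<in> W" "x \<in> fst c" using y by blast
  then have x': "x \<in> U" "\<phi> x \<in> fst d" using y(1) assms(1) by (auto simp: chart_dom_iff)
  show ?thesis
    using to_coords_tangent_map[OF assms(1-4) x'(1) x(3) x'(2), of "X x"] x x' assms
    by (simp add: chart_rep_apply field_rep_apply chart_deriv_def)
qed

text \<open>With \<open>\<phi>\<close> the identity this says that smoothness may be tested in one chart around each point.\<close>

lemma vector_field_push:
  assumes \<phi>: "diffeomorphism \<A> U U' \<phi>" and V: "open V" "V \<subseteq> U"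
    and X: "\<And>x. x \<in> V \<Longrightarrow> \<exists>c\<in>\<A>. \<exists>W. open W \<and> x \<in> W \<and> x \<in> fst c \<and> smooth_on (snd c ` (W \<inter> fst c)) (field_rep \<A> c X)"
    and X': "\<And>x. x \<in> V \<Longrightarrow> X' (\<phi> x) = tangent_map \<A> \<phi> x (X x)"
  shows "vector_field \<A> (\<phi> ` V) X'"
  unfolding vector_field_def
proof (intro conjI ballI)
  show "open (\<phi> ` V)" using \<phi> V by (rule diffeomorphism_open_image)
  fix d assume d: "d \<in> \<A>"
  note \<phi>' = diffeomorphism_inverse[OF \<phi>]
  define \<psi> where "\<psi> = inv_into U \<phi>"
  show "smooth_on (snd d ` (\<phi> ` V \<inter> fst d)) (field_rep \<A> d X')"
  proof (rule smooth_on_local)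
    fix w assume "w \<in> snd d ` (\<phi> ` V \<inter> fst d)"
    then obtain x where x: "x \<in> V" "\<phi> x \<in> fst d" "w = snd d (\<phi> x)" by auto
    obtain c W where c: "c \<in> \<A>" "open W" "x \<in> W" "x \<in> fst c" "smooth_on (snd c ` (W \<inter> fst c)) (field_rep \<A> c X)"
      using X[OF x(1)] by blast
    define S where "S = chart_dom c d \<phi> (W \<inter> V)"
    have WV: "open (W \<inter> V)" "smooth_map_on \<A> (W \<inter> V) \<phi>"
    proof -
      show "open (W \<inter> V)" using c V by blast
      have "continuous_on (W \<inter> V) \<phi>" using \<phi>'(3) V by (auto simp: smooth_map_on_def intro: continuous_on_subset)
      moreover have "smooth_on (snd c ` (W \<inter> V \<inter> fst c \<inter> \<phi> -` fst d)) (snd d \<circ> \<phi> \<circ> chart_inv c)" if "c \<in> \<A>" "d \<in> \<A>" for c d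
        by (rule smooth_on_subset[of "snd c ` (U \<inter> fst c \<inter> \<phi> -` fst d)"])
           (use \<phi>'(3) V that in \<open>auto simp: smooth_map_on_def\<close>)
      ultimately show "smooth_map_on \<A> (W \<inter> V) \<phi>" by (auto simp: smooth_map_on_def)
    qed
    have S: "open S" "smooth_on S (chart_rep c d \<phi>)" "S \<subseteq> snd c ` (W \<inter> fst c)"
      unfolding S_def using open_chart_dom(1)[OF c(1) d WV] smooth_chart_rep[OF c(1) d WV(2)]
      by (auto simp: chart_dom_def)
    have sm: "smooth_on S (\<lambda>y. frechet_derivative (chart_rep c d \<phi>) (at y) (field_rep \<A> c X y))"
      using S c(5) smooth_on_subset by (intro smooth_on_frechet_derivative) blast+
    \<comment> \<open>\<open>S\<close> is the part of the chart \<open>c\<close> where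
      \<open>X\<close> is known to be smooth and \<open>\<phi>\<close> lands in \<open>d\<close>;
      \<open>T\<close> consists of the coordinates in \<open>d\<close> whose preimage lies in
      \<open>S\<close>. On \<open>T\<close> the representative of \<open>X'\<close> is the
      transformed representative of \<open>X\<close>, composed with the inverse of
      \<open>\<phi>\<close> in charts.\<close>
    define T where "T = chart_dom d c \<psi> U' \<inter> chart_rep d c \<psi> -` S"
    have \<psi>: "smooth_map_on \<A> U' \<psi>" using \<phi>'(4) by (simp add: \<psi>_def)
    have "open T"
    proof -
      have "open (chart_rep d c \<psi> -` S \<inter> chart_dom d c \<psi> U')"
        using continuous_on_open_vimage[OF open_chart_dom(1)[OF d c(1) \<phi>'(2) \<psi>]]
          smooth_on_imp_continuous[OF smooth_chart_rep[OF d c(1) \<psi>]] S(1) by blast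
      then show ?thesis by (simp add: T_def Int_commute)
    qed
    moreover have "w \<in> T"
      using x c d V \<phi>' by (auto simp: T_def S_def \<psi>_def chart_dom_iff chart_rep_apply subset_iff)
    moreover have "smooth_on T (field_rep \<A> d X')"
    proof (rule smooth_on_cong)
      show "smooth_on T (\<lambda>w. frechet_derivative (chart_rep c d \<phi>) (at (chart_rep d c \<psi> w)) (field_rep \<A> c X (chart_rep d c \<psi> w)))"
        by (rule smooth_on_compose[OF \<open>open T\<close> S(1) _ smooth_on_subset[OF smooth_chart_rep[OF d c(1) \<psi>]] sm])
           (auto simp: T_def)
      fix w assume w: "w \<in> T"
      then obtain y where y: "w = snd d y" "y \<in> U'" "y \<in> fst d" "\<psi> y \<in> fst c"
        by (auto simp: T_def chart_dom_def)
      have y': "chart_rep d c \<psi> w = snd c (\<psi> y)" using y d by (simp add: chart_rep_apply)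
      then have "snd c (\<psi> y) \<in> S" using w by (auto simp: T_def)
      then have *: "\<psi> y \<in> W" "\<psi> y \<in> V" using y c by (auto simp: S_def chart_dom_iff)
      have "field_rep \<A> d X' (chart_rep c d \<phi> (snd c (\<psi> y))) =
          frechet_derivative (chart_rep c d \<phi>) (at (snd c (\<psi> y))) (field_rep \<A> c X (snd c (\<psi> y)))"
        using * y c d V \<phi>' by (intro field_rep_push[OF c(1) d \<phi>'(1,3) X']) (auto simp: chart_dom_iff \<psi>_def)
      then show "frechet_derivative (chart_rep c d \<phi>) (at (chart_rep d c \<psi> w)) (field_rep \<A> c X (chart_rep d c \<psi> w)) =
          field_rep \<A> d X' w"
        using y y' c \<phi>' by (simp add: chart_rep_apply \<psi>_def)
    qed (fact \<open>open T\<close>)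
    ultimately show "\<exists>T. open T \<and> w \<in> T \<and> smooth_on T (field_rep \<A> d X')" by blast
  qed
qed

lemma vector_field_subset:
  assumes "vector_field \<A> V X" "open W" "W \<subseteq> V"
  shows "vector_field \<A> W X"
  unfolding vector_field_def
proof (intro conjI ballI)
  fix c assume "c \<in> \<A>"
  show "smooth_on (snd c ` (W \<inter> fst c)) (field_rep \<A> c X)"
    by (rule smooth_on_subset[of "snd c ` (V \<inter> fst c)"]) (use assms \<open>c \<in> \<A>\<close> in \<open>auto simp: vector_field_def\<close>)
qed fact

text \<open>Smoothness is evident in the chart \<open>c\<close>, where the components are constant;
  pushing by the identity carries it to all charts. These fields serve as test fields.\<close>

lemma vector_field_const_coords:
  assumes c: "c \<in> \<A>" and V: "open V" "V \<subseteq> fst c"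
  shows "vector_field \<A> V (\<lambda>x. from_coords \<A> c x v)"
proof -
  have "vector_field \<A> ((\<lambda>x. x) ` V) (\<lambda>x. from_coords \<A> c x v)"
  proof (rule vector_field_push[OF diffeomorphism_id V(1)])
    fix x assume x: "x \<in> V"
    have "smooth_on (snd c ` (V \<inter> fst c)) (field_rep \<A> c (\<lambda>x. from_coords \<A> c x v))"
    proof (rule smooth_on_cong[OF smooth_on_const])
      show "open (snd c ` (V \<inter> fst c))"
        using open_Int[OF V(1) chart(1)[OF c]] c by (intro open_chart_image) auto
      then show "open (snd c ` (V \<inter> fst c))" .
    qed (use c in \<open>auto simp: field_rep_apply\<close>)
    then show "\<exists>ca\<in>\<A>. \<exists>W. open W \<and> x \<in> W \<and> x \<in> fst ca \<and>
        smooth_on (snd ca ` (W \<inter> fst ca)) (field_rep \<A> ca (\<lambda>x. from_coords \<A> c x v))"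
      using x V c by blast
  qed (auto simp: tangent_map_id)
  then show ?thesis by simp
qed

lemma vector_field_differentiable:
  assumes "vector_field \<A> V X" "c \<in> \<A>" "x \<in> V" "x \<in> fst c"
  shows "field_rep \<A> c X differentiable at (snd c x)"
  using assms smooth_on_has_derivative[of "snd c ` (V \<inter> fst c)" "field_rep \<A> c X" "snd c x"]
  by (auto simp: vector_field_def differentiable_def)

text \<open>The second derivative of \<open>\<phi>\<close> in charts: the non-tensorial part of the law of change of
  coordinates of derivatives of fields and of Christoffel symbols.\<close>

definition chart_deriv2 :: "('a, 'm) chart \<Rightarrow> ('a, 'm) chart \<Rightarrow> ('a \<Rightarrow> 'a) \<Rightarrow> 'a \<Rightarrow> real^'m \<Rightarrow> real^'m \<Rightarrow> real^'m" where
  "chart_deriv2 c d \<phi> x v w = frechet_derivative (\<lambda>y. frechet_derivative (chart_rep c d \<phi>) (at y) w) (at (snd c x)) v"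

lemma chart_deriv2:
  assumes "c \<in> \<A>" "d \<in> \<A>" "open U" "smooth_map_on \<A> U \<phi>" "x \<in> U" "x \<in> fst c" "\<phi> x \<in> fst d"
  shows "bilinear (chart_deriv2 c d \<phi> x)" "chart_deriv2 c d \<phi> x v w = chart_deriv2 c d \<phi> x w v"
proof -
  have S: "open (chart_dom c d \<phi> U)" "snd c x \<in> chart_dom c d \<phi> U"
    using assms open_chart_dom by (auto simp: chart_dom_iff)
  note f = smooth_chart_rep[OF assms(1,2,4)]
  show "bilinear (chart_deriv2 c d \<phi> x)"
    unfolding chart_deriv2_def[abs_def] by (rule bilinear_second_derivative[OF S f])
  show "chart_deriv2 c d \<phi> x v w = chart_deriv2 c d \<phi> x w v"
    unfolding chart_deriv2_def by (rule second_derivative_symmetric[OF S f])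
qed

text \<open>The first derivative of a field is not tensorial, and its defect is the Hessian of
  \<open>\<phi>\<close>. With \<open>\<phi>\<close> the identity this yields the coordinate law of
  Christoffel symbols, with a diffeomorphism the naturality of covariant derivatives.\<close>

lemma field_rep_push_derivative:
  assumes ch: "c \<in> \<A>" "d \<in> \<A>" and \<phi>: "open U" "smooth_map_on \<A> U \<phi>"
    and x: "x \<in> U" "x \<in> fst c" "\<phi> x \<in> fst d"
    and W: "open W" "x \<in> W" "\<And>y. y \<in> W \<Longrightarrow> X' (\<phi> y) = tangent_map \<A> \<phi> y (X y)"
    and X: "field_rep \<A> c X differentiable at (snd c x)"
    and X': "field_rep \<A> d X' differentiable at (snd d (\<phi> x))"
  shows "frechet_derivative (field_rep \<A> d X') (at (snd d (\<phi> x))) (chart_deriv c d \<phi> x v) =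
    chart_deriv c d \<phi> x (frechet_derivative (field_rep \<A> c X) (at (snd c x)) v) +
    chart_deriv2 c d \<phi> x v (to_coords \<A> c x (X x))"
proof -
  let ?S = "chart_dom c d \<phi> U \<inter> snd c ` (W \<inter> fst c)"
  have S: "open ?S" "snd c x \<in> ?S"
    using open_chart_dom(1)[OF ch \<phi>] open_chart_image[OF ch(1), of "W \<inter> fst c"] chart(1)[OF ch(1)] W x ch
    by (auto simp: chart_dom_iff)
  have f: "smooth_on ?S (chart_rep c d \<phi>)"
    using smooth_chart_rep[OF ch \<phi>(2)] by (rule smooth_on_subset) auto
  have e: "snd d (\<phi> x) = chart_rep c d \<phi> (snd c x)" using ch x by (simp add: chart_rep_apply)
  have X'2: "field_rep \<A> d X' differentiable at (chart_rep c d \<phi> (snd c x))" using X' e by simp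
  have eq: "field_rep \<A> d X' (chart_rep c d \<phi> y) = frechet_derivative (chart_rep c d \<phi>) (at y) (field_rep \<A> c X y)"
    if "y \<in> ?S" for y
    by (rule field_rep_push[OF ch \<phi>, of W]) (use that W(3) in auto)
  show ?thesis
    unfolding e chart_deriv_def chart_deriv2_def field_rep_apply[OF ch(1) x(2), symmetric]
    by (rule derivative_transform[OF S f X X'2 eq])
qed

end

section \<open>Frames and connections in charts\<close>

definition frame_deriv_at ::
  "('a, 'm::finite) chart set \<Rightarrow> ('a, 'm) chart \<Rightarrow> 'a \<Rightarrow> ('a \<Rightarrow> real^'m^'m) \<Rightarrow> real^'m \<Rightarrow> real^'m^'m" where
  "frame_deriv_at \<A> c x Z = frechet_derivative (frame_rep \<A> c Z) (at (snd c x))"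

context smooth_manifold
begin

lemma frame_coords_vec:
  assumes "c \<in> \<A>" "x \<in> fst c"
  shows "frame_coords \<A> c x u *v b = to_coords \<A> c x (u *v b)"
proof -
  have "to_coords \<A> c x (u *v b) = (\<Sum>i\<in>UNIV. b $ i *\<^sub>R to_coords \<A> c x (column i u))"
    unfolding matrix_vector_mult_columns[of u]
    by (simp add: linear_sum[OF linear_to_coords[OF assms]] linear_scale[OF linear_to_coords[OF assms]])
  then show ?thesis
    by (simp add: frame_coords_def matrix_vector_mult_def vec_eq_iff mult.commute)
qed

lemma frame_coords_mult:
  "c \<in> \<A> \<Longrightarrow> x \<in> fst c \<Longrightarrow> frame_coords \<A> c x (u ** g) = frame_coords \<A> c x u ** g"
  by (simp add: matrix_eq frame_coords_vec flip: matrix_vector_mul_assoc)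

lemma frame_coords_chart_at [simp]: "frame_coords \<A> (\<kappa> x) x u = u"
  by (simp add: matrix_eq frame_coords_vec \<kappa>)

lemma invertible_frame_coords:
  assumes "c \<in> \<A>" "x \<in> fst c" "invertible u"
  shows "invertible (frame_coords \<A> c x u)"
proof -
  have "inj ((*v) (frame_coords \<A> c x u))"
    using assms by (auto intro!: injI simp: frame_coords_vec) (metis from_to_coords matrix_inv_vec(2))
  then show ?thesis
    using matrix_left_invertible_injective invertible_left_inverse by blast
qed

lemma frame_rep_apply: "c \<in> \<A> \<Longrightarrow> x \<in> fst c \<Longrightarrow> frame_rep \<A> c Z (snd c x) = frame_coords \<A> c x (Z x)"
  by (simp add: frame_rep_def)

lemma frame_rep_vec:
  "c \<in> \<A> \<Longrightarrow> y \<in> snd c ` fst c \<Longrightarrow> frame_rep \<A> c Z y *v b = field_rep \<A> c (\<lambda>x. Z x *v b) y"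
  by (auto simp: frame_rep_apply field_rep_apply frame_coords_vec)

lemma open_chart_Int: "c \<in> \<A> \<Longrightarrow> open V \<Longrightarrow> open (snd c ` (V \<inter> fst c))"
  by (intro open_chart_image open_Int chart(1)) auto

lemma frame_field_smooth:
  "frame_field \<A> V Z \<Longrightarrow> c \<in> \<A> \<Longrightarrow> smooth_on (snd c ` (V \<inter> fst c)) (frame_rep \<A> c Z)"
  by (auto simp: frame_field_def)

lemma frame_field_open: "frame_field \<A> V Z \<Longrightarrow> open V"
  by (auto simp: frame_field_def)

lemma frame_field_invertible: "frame_field \<A> V Z \<Longrightarrow> x \<in> V \<Longrightarrow> invertible (Z x)"
  by (auto simp: frame_field_def)

lemma frame_field_subset:
  assumes "frame_field \<A> V Z" "open W" "W \<subseteq> V"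
  shows "frame_field \<A> W Z"
  unfolding frame_field_def
proof (intro conjI ballI)
  fix c assume c: "c \<in> \<A>"
  show "smooth_on (snd c ` (W \<inter> fst c)) (frame_rep \<A> c Z)"
    by (rule smooth_on_subset[OF frame_field_smooth[OF assms(1) c]]) (use assms(3) in auto)
qed (use assms frame_field_invertible in auto)

lemma vector_field_frame:
  assumes "frame_field \<A> V Z"
  shows "vector_field \<A> V (\<lambda>x. Z x *v b)"
  unfolding vector_field_def
proof (intro conjI ballI)
  show V: "open V" using assms by (rule frame_field_open)
  fix c assume c: "c \<in> \<A>"
  show "smooth_on (snd c ` (V \<inter> fst c)) (field_rep \<A> c (\<lambda>x. Z x *v b))"
  proof (rule smooth_on_cong)
    show "smooth_on (snd c ` (V \<inter> fst c)) (\<lambda>y. frame_rep \<A> c Z y *v b)"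
      using open_chart_Int[OF c V]
      by (intro smooth_on_matrix_vector_mult smooth_on_const frame_field_smooth[OF assms c])
    show "frame_rep \<A> c Z y *v b = field_rep \<A> c (\<lambda>x. Z x *v b) y" if "y \<in> snd c ` (V \<inter> fst c)" for y
      using that by (intro frame_rep_vec[OF c]) auto
  qed (rule open_chart_Int[OF c V])
qed

lemma frame_fieldI:
  assumes V: "open V" and inv: "\<And>x. x \<in> V \<Longrightarrow> invertible (Z x)"
    and vf: "\<And>b. vector_field \<A> V (\<lambda>x. Z x *v b)"
  shows "frame_field \<A> V Z"
  unfolding frame_field_def
proof (intro conjI ballI)
  fix c assume c: "c \<in> \<A>"
  let ?S = "snd c ` (V \<inter> fst c)"
  have S: "open ?S" using c V by (rule open_chart_Int)
  show "smooth_on ?S (frame_rep \<A> c Z)"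
  proof (rule smooth_on_cong[OF _ S])
    show "smooth_on ?S (\<lambda>y. \<chi> k i. field_rep \<A> c (\<lambda>x. Z x *v axis i 1) y $ k)"
      using vf c by (intro smooth_on_vec_lambda smooth_on_vec_nth S) (auto simp: vector_field_def)
    show "(\<chi> k i. field_rep \<A> c (\<lambda>x. Z x *v axis i 1) y $ k) = frame_rep \<A> c Z y" if y: "y \<in> ?S" for y
    proof -
      have "field_rep \<A> c (\<lambda>x. Z x *v axis i 1) y = frame_rep \<A> c Z y *v axis i 1" for i
        using y by (intro frame_rep_vec[OF c, symmetric]) auto
      then show ?thesis by (simp add: vec_eq_iff matrix_vector_mult_basis column_def)
    qed
  qed
qed (use assms in auto)

lemma has_derivative_frame_rep:
  assumes "frame_field \<A> V Z" "c \<in> \<A>" "x \<in> V" "x \<in> fst c"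
  shows "(frame_rep \<A> c Z has_derivative frame_deriv_at \<A> c x Z) (at (snd c x))"
  unfolding frame_deriv_at_def
  using assms by (intro smooth_on_has_derivative[OF frame_field_smooth[OF assms(1,2)]]) auto

lemma has_derivative_field_rep_frame:
  assumes Z: "frame_field \<A> V Z" "c \<in> \<A>" "x \<in> V" "x \<in> fst c"
  shows "(field_rep \<A> c (\<lambda>x. Z x *v b) has_derivative (\<lambda>v. frame_deriv_at \<A> c x Z v *v b)) (at (snd c x))"
proof -
  have "((\<lambda>y. frame_rep \<A> c Z y *v b) has_derivative (\<lambda>v. frame_deriv_at \<A> c x Z v *v b)) (at (snd c x))"
    using has_derivative_matrix_vector_mult[OF has_derivative_frame_rep[OF assms] has_derivative_const[of b]] by simp
  moreover have "frame_rep \<A> c Z y *v b = field_rep \<A> c (\<lambda>x. Z x *v b) y" if "y \<in> snd c ` fst c" for y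
    using that by (rule frame_rep_vec[OF Z(2)])
  ultimately show ?thesis
    using has_derivative_transform_within_open[OF _ chart(2)[OF Z(2)]] Z(4) by blast
qed

lemma component_deriv_frame:
  assumes "frame_field \<A> V Z" "x \<in> V"
  shows "component_deriv \<A> x v (\<lambda>x. Z x *v b) = frame_deriv_at \<A> (\<kappa> x) x Z v *v b"
  unfolding component_deriv_def
  using fun_cong[OF frechet_derivative_at[OF has_derivative_field_rep_frame[OF assms(1) \<kappa>(1) assms(2) \<kappa>(2)]]]
  by simp

lemma component_deriv_cong:
  assumes "open V" "x \<in> V" "\<And>y. y \<in> V \<Longrightarrow> Y y = Y' y" "vector_field \<A> V Y"
  shows "component_deriv \<A> x v Y = component_deriv \<A> x v Y'"
proof -
  have "field_rep \<A> (\<kappa> x) Y differentiable at (snd (\<kappa> x) x)"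
    using vector_field_differentiable[OF assms(4) \<kappa>(1) assms(2) \<kappa>(2)] .
  then have d: "(field_rep \<A> (\<kappa> x) Y has_derivative frechet_derivative (field_rep \<A> (\<kappa> x) Y) (at (snd (\<kappa> x) x))) (at (snd (\<kappa> x) x))"
    by (simp add: frechet_derivative_works)
  have o: "open (snd (\<kappa> x) ` (V \<inter> fst (\<kappa> x)))" using \<kappa>(1) assms(1) by (rule open_chart_Int)
  have i: "snd (\<kappa> x) x \<in> snd (\<kappa> x) ` (V \<inter> fst (\<kappa> x))" using assms(2) \<kappa>(2) by blast
  have e: "field_rep \<A> (\<kappa> x) Y y = field_rep \<A> (\<kappa> x) Y' y" if "y \<in> snd (\<kappa> x) ` (V \<inter> fst (\<kappa> x))" for y
    using that assms(3) \<kappa> by (auto simp: field_rep_apply)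
  show ?thesis
    unfolding component_deriv_def
    using frechet_derivative_at[OF has_derivative_transform_within_open[OF d o i e]] by simp
qed

text \<open>The classical transformation law of Christoffel symbols. It must be derived, since
  \<open>conn_coords\<close> is defined through covariant derivatives of the coordinate
  fields.\<close>

lemma christoffel_apply_conn_coords:
  assumes c: "c \<in> \<A>" "x \<in> fst c"
  shows "christoffel_apply (conn_coords \<A> c x \<gamma>) (to_coords \<A> c x v) (to_coords \<A> c x w) =
    to_coords \<A> c x (christoffel_apply \<gamma> v w) - chart_deriv2 (\<kappa> x) c (\<lambda>x. x) x v w"
proof -
  let ?J = "to_coords \<A> c x" and ?K = "from_coords \<A> c x" and ?Q = "chart_deriv2 (\<kappa> x) c (\<lambda>x. x) x"
  note J = linear_to_coords[OF c] and K = linear_from_coords[OF c]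
  have Q: "bilinear ?Q"
    by (rule chart_deriv2(1)[OF \<kappa>(1) c(1) open_UNIV smooth_map_on_id]) (use c \<kappa> in auto)
  note G = bilinear_christoffel_apply[of \<gamma>]
  define h where "h a b = ?J (christoffel_apply \<gamma> (?K a) (?K b)) - ?Q (?K a) (?K b)" for a b
  have h: "bilinear h"
    unfolding bilinear_def h_def
    by (auto intro!: linearI simp: linear_add[OF J] linear_add[OF K] linear_scale[OF J] linear_scale[OF K]
        bilinear_ladd[OF Q] bilinear_radd[OF Q] bilinear_lmul[OF Q] bilinear_rmul[OF Q]
        bilinear_ladd[OF G] bilinear_radd[OF G] bilinear_lmul[OF G] bilinear_rmul[OF G] scaleR_diff_right)
  \<comment> \<open>A coordinate field of \<open>c\<close> has constant components in
    \<open>c\<close>; hence its derivative in the chosen chart can only compensate the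
    Hessian.\<close>
  have "?J (component_deriv \<A> x u (\<lambda>x. from_coords \<A> c x b)) = - ?Q u (?K b)" for u b
  proof -
    let ?X = "\<lambda>x. from_coords \<A> c x b"
    have X: "vector_field \<A> (fst c) ?X"
      by (rule vector_field_const_coords[OF c(1) chart(1)[OF c(1)]]) simp
    have const: "(field_rep \<A> c ?X has_derivative (\<lambda>v. 0)) (at (snd c x))"
    proof -
      have "b = field_rep \<A> c ?X y" if "y \<in> snd c ` fst c" for y
        using that c by (auto simp: field_rep_apply)
      moreover have "snd c x \<in> snd c ` fst c" using c by blast
      ultimately show ?thesis
        using has_derivative_transform_within_open[OF has_derivative_const[of b] chart(2)[OF c(1)], of "snd c x" "field_rep \<A> c ?X"]
        by blast
    qed
    have "frechet_derivative (field_rep \<A> c ?X) (at (snd c x)) (chart_deriv (\<kappa> x) c (\<lambda>x. x) x u) =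
      chart_deriv (\<kappa> x) c (\<lambda>x. x) x (frechet_derivative (field_rep \<A> (\<kappa> x) ?X) (at (snd (\<kappa> x) x)) u) +
      ?Q u (to_coords \<A> (\<kappa> x) x (?X x))"
      by (rule field_rep_push_derivative[OF \<kappa>(1) c(1) open_UNIV smooth_map_on_id UNIV_I \<kappa>(2) c(2) chart(1)[OF c(1)] c(2)])
         (use tangent_map_id vector_field_differentiable[OF X] c \<kappa> in auto)
    then show ?thesis
      using frechet_derivative_at[OF const, symmetric]
      by (simp add: component_deriv_def to_coords_eq[symmetric] eq_neg_iff_add_eq_0)
  qed
  then have "conn_coords \<A> c x \<gamma> = christoffel_of h"
    unfolding conn_coords_def christoffel_of_def cov_deriv_at_def coord_field_def h_def
    by (simp add: linear_add[OF J])
  then show ?thesis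
    using christoffel_apply_of[OF h] c by (simp add: h_def)
qed

end

section \<open>The canonical connection of a section\<close>

text \<open>The commutation equations are linear, so they may be differentiated.\<close>

lemma model_endo_derivative:
  assumes g: "(g has_derivative h) (at x)" and S: "open S" "x \<in> S" "\<And>y. y \<in> S \<Longrightarrow> model_endo (g y)"
  shows "model_endo (h v)"
proof -
  have "h v ** M = M ** h v" if M: "\<And>y. y \<in> S \<Longrightarrow> g y ** M = M ** g y" for M
  proof -
    have 1: "((\<lambda>y. g y ** M) has_derivative (\<lambda>v. h v ** M)) (at x)"
      by (rule bounded_linear.has_derivative[OF bounded_bilinear.bounded_linear_left[OF bounded_bilinear_matrix_mult] g])
    have 2: "((\<lambda>y. M ** g y) has_derivative (\<lambda>v. M ** h v)) (at x)"
      by (rule bounded_linear.has_derivative[OF bounded_bilinear.bounded_linear_right[OF bounded_bilinear_matrix_mult] g])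
    show ?thesis
      using fun_cong[OF has_derivative_unique[OF has_derivative_transform_within_open[OF 1 S(1,2) M] 2]] .
  qed
  then show ?thesis using S(3) unfolding model_endo_def by blast
qed

definition is_lift ::
  "('a::topological_space, 'n::finite + 'n) chart set \<Rightarrow> ('a \<Rightarrow> (real^('n + 'n)^('n + 'n)) set) \<Rightarrow>
   'a set \<Rightarrow> ('a \<Rightarrow> real^('n + 'n)^('n + 'n)) \<Rightarrow> bool" where
  "is_lift \<A> s V Z \<longleftrightarrow> frame_field \<A> V Z \<and> (\<forall>y\<in>V. s y = frame_orbit (Z y) delta_GL)"

locale double_manifold = smooth_manifold \<A>
  for \<A> :: "('a::{t2_space, second_countable_topology}, 'n::finite + 'n) chart set"
begin

abbreviation canonical_in :: "('a, 'n + 'n) chart \<Rightarrow> 'a \<Rightarrow> ('a \<Rightarrow> real^('n + 'n)^('n + 'n)) \<Rightarrow> ('n + 'n) christoffel \<Rightarrow> bool" where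
  "canonical_in c x Z \<gamma> \<equiv> canonical_at (frame_coords \<A> c x (Z x)) (frame_deriv_at \<A> c x Z) \<gamma>"

lemma is_lift_subset: "is_lift \<A> s V Z \<Longrightarrow> open W \<Longrightarrow> W \<subseteq> V \<Longrightarrow> is_lift \<A> s W Z"
  using frame_field_subset by (auto simp: is_lift_def)

lemma is_lift_frame: "is_lift \<A> s V Z \<Longrightarrow> frame_field \<A> V Z"
  by (simp add: is_lift_def)

lemma is_lift_invertible: "is_lift \<A> s V Z \<Longrightarrow> x \<in> V \<Longrightarrow> invertible (Z x)"
  by (auto simp: is_lift_def intro: frame_field_invertible)

lemma quotient_section_lift:
  assumes "quotient_section \<A> delta_GL U s" "x \<in> U"
  obtains V Z where "x \<in> V" "V \<subseteq> U" "is_lift \<A> s V Z"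
  using assms unfolding quotient_section_def is_lift_def by blast

text \<open>\<open>canonical_at_change_coordinates\<close> with the Jacobian and the symmetric
  Hessian of \<open>\<phi>\<close> in the two charts; the frame derivative obeys the required law
  because each field \<open>Z y *v b\<close> does. It is used both for changes of chart and for
  naturality.\<close>

lemma canonical_in_push:
  assumes \<phi>: "diffeomorphism \<A> U U' \<phi>" and ch: "c \<in> \<A>" "d \<in> \<A>"
    and x: "x \<in> U" "x \<in> fst c" "\<phi> x \<in> fst d" "x \<in> V"
    and Z: "frame_field \<A> V Z" "\<And>y b. y \<in> V \<Longrightarrow> Z' (\<phi> y) *v b = tangent_map \<A> \<phi> y (Z y *v b)"
    and Z': "frame_field \<A> V' Z'" "\<phi> x \<in> V'"
    and \<gamma>: "canonical_in c x Z \<gamma>"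
    and \<gamma>': "\<And>v w. christoffel_apply \<gamma>' (chart_deriv c d \<phi> x v) (chart_deriv c d \<phi> x w) =
      chart_deriv c d \<phi> x (christoffel_apply \<gamma> v w) - chart_deriv2 c d \<phi> x v w"
  shows "canonical_in d (\<phi> x) Z' \<gamma>'"
proof -
  note d = diffeomorphism_inverse[OF \<phi>]
  show ?thesis
  proof (rule canonical_at_change_coordinates[OF \<gamma> _ _ _ \<gamma>'])
    show "linear (chart_deriv c d \<phi> x)" by (rule linear_chart_deriv[OF ch d(3) x(1-3)])
    show "surj (chart_deriv c d \<phi> x)" by (rule surj_chart_deriv[OF \<phi> ch x(1-3)])
    show "chart_deriv2 c d \<phi> x v w = chart_deriv2 c d \<phi> x w v" for v w
      by (rule chart_deriv2(2)[OF ch d(1,3) x(1-3)])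
    show "frame_coords \<A> d (\<phi> x) (Z' (\<phi> x)) *v b = chart_deriv c d \<phi> x (frame_coords \<A> c x (Z x) *v b)" for b
      using to_coords_tangent_map[OF ch d(1,3) x(1-3)] Z(2)[OF x(4)] ch x by (simp add: frame_coords_vec)
    fix v b
    have 1: "frechet_derivative (field_rep \<A> c (\<lambda>x. Z x *v b)) (at (snd c x)) = (\<lambda>v. frame_deriv_at \<A> c x Z v *v b)"
      by (rule frechet_derivative_at[OF has_derivative_field_rep_frame[OF Z(1) ch(1) x(4,2)], symmetric])
    have 2: "frechet_derivative (field_rep \<A> d (\<lambda>x. Z' x *v b)) (at (snd d (\<phi> x))) = (\<lambda>v. frame_deriv_at \<A> d (\<phi> x) Z' v *v b)"
      by (rule frechet_derivative_at[OF has_derivative_field_rep_frame[OF Z'(1) ch(2) Z'(2) x(3)], symmetric])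
    have "frechet_derivative (field_rep \<A> d (\<lambda>x. Z' x *v b)) (at (snd d (\<phi> x))) (chart_deriv c d \<phi> x v) =
      chart_deriv c d \<phi> x (frechet_derivative (field_rep \<A> c (\<lambda>x. Z x *v b)) (at (snd c x)) v) +
      chart_deriv2 c d \<phi> x v (to_coords \<A> c x (Z x *v b))"
      by (rule field_rep_push_derivative[OF ch d(1,3) x(1-3) frame_field_open[OF Z(1)] x(4) Z(2)
            vector_field_differentiable[OF vector_field_frame[OF Z(1)] ch(1) x(4,2)]
            vector_field_differentiable[OF vector_field_frame[OF Z'(1)] ch(2) Z'(2) x(3)]])
    then show "frame_deriv_at \<A> d (\<phi> x) Z' (chart_deriv c d \<phi> x v) *v b =
       chart_deriv c d \<phi> x (frame_deriv_at \<A> c x Z v *v b) +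
       chart_deriv2 c d \<phi> x v (frame_coords \<A> c x (Z x) *v b)"
      unfolding 1 2 using ch x by (simp add: frame_coords_vec)
  qed
qed

lemma canonical_in_conn_coords:
  assumes c: "c \<in> \<A>" "x \<in> fst c" and Z: "frame_field \<A> V Z" "x \<in> V" and \<gamma>: "canonical_in (\<kappa> x) x Z \<gamma>"
  shows "canonical_in c x Z (conn_coords \<A> c x \<gamma>)"
  by (rule canonical_in_push[OF diffeomorphism_id \<kappa>(1) c(1) UNIV_I \<kappa>(2) c(2) Z(2,1) _ Z \<gamma>])
     (simp_all add: tangent_map_id christoffel_apply_conn_coords[OF c] flip: to_coords_eq)

lemma linear_frame_deriv_at:
  assumes "frame_field \<A> V Z" "c \<in> \<A>" "x \<in> V" "x \<in> fst c"
  shows "linear (frame_deriv_at \<A> c x Z)"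
  using has_derivative_frame_rep[OF assms] by (rule has_derivative_linear)

text \<open>Existence and uniqueness in one equation, valid in every chart around the point; the
  explicit right-hand side is what makes smoothness and dependence on the jet accessible.\<close>

lemma canonical_in_iff:
  assumes "frame_field \<A> V Z" "c \<in> \<A>" "x \<in> V" "x \<in> fst c"
  shows "canonical_in c x Z \<gamma> \<longleftrightarrow> \<gamma> = canonical_christoffel (frame_coords \<A> c x (Z x)) (frame_deriv_at \<A> c x Z)"
  using canonical_at_canonical_christoffel canonical_at_unique linear_frame_deriv_at[OF assms]
    invertible_frame_coords[OF assms(2,4) frame_field_invertible[OF assms(1,3)]] by metis

text \<open>Two lifts of one section differ by a smooth function with values in
  \<open>delta_GL\<close>, whose derivative lies in the commutant; the product rule then puts the
  new lift into the form required by \<open>canonical_at_change_frame\<close>.\<close>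

lemma canonical_in_change_lift:
  assumes Z: "is_lift \<A> s V Z" "x \<in> V" and Z': "is_lift \<A> s V' Z'" "x \<in> V'" and \<gamma>: "canonical_in (\<kappa> x) x Z \<gamma>"
  shows "canonical_in (\<kappa> x) x Z' \<gamma>"
proof -
  define c where "c = \<kappa> x"
  define S where "S = snd c ` (V \<inter> V' \<inter> fst c)"
  have c: "c \<in> \<A>" "x \<in> fst c" by (auto simp: c_def \<kappa>)
  have V: "open (V \<inter> V')"
    using Z Z' is_lift_frame frame_field_open by blast
  have S: "open S" "snd c x \<in> S" using open_chart_Int[OF c(1) V] Z Z' c by (auto simp: S_def)
  note ZW = frame_field_smooth[OF is_lift_frame[OF Z(1)] c(1)] frame_field_smooth[OF is_lift_frame[OF Z'(1)] c(1)]
  have sm: "smooth_on S (frame_rep \<A> c Z)" "smooth_on S (frame_rep \<A> c Z')"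
    by (rule smooth_on_subset[OF ZW(1)] smooth_on_subset[OF ZW(2)]; auto simp: S_def)+
  \<comment> \<open>A formula instead of a pointwise choice of group elements: its smoothness is
    immediate, and its values are then found to lie in \<open>delta_GL\<close>.\<close>
  define g where "g y = matrix_inv (frame_rep \<A> c Z y) ** frame_rep \<A> c Z' y" for y
  have inv: "invertible (frame_rep \<A> c Z y)" if "y \<in> S" for y
    using that c by (auto simp: S_def frame_rep_apply intro!: invertible_frame_coords is_lift_invertible[OF Z(1)])
  have g: "model_endo (g y) \<and> invertible (g y) \<and> frame_rep \<A> c Z' y = frame_rep \<A> c Z y ** g y" if y: "y \<in> S" for y
  proof -
    obtain p where p: "y = snd c p" "p \<in> V" "p \<in> V'" "p \<in> fst c" using y by (auto simp: S_def)
    have "Z' p \<in> frame_orbit (Z p) delta_GL"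
      using p Z Z' frame_orbit_self unfolding is_lift_def by blast
    then obtain h where h: "h \<in> delta_GL" "Z' p = Z p ** h" by (auto simp: frame_orbit_def)
    then have e: "frame_rep \<A> c Z' y = frame_rep \<A> c Z y ** h"
      using p c by (simp add: frame_rep_apply frame_coords_mult)
    then have "g y = h" unfolding g_def using inv[OF y] by (simp add: matrix_mul_assoc matrix_inv_left)
    then show ?thesis using e h by (simp add: delta_GL_eq)
  qed
  have "smooth_on S g"
    unfolding g_def[abs_def] by (intro smooth_on_matrix_mult S(1) smooth_on_matrix_inv sm inv)
  then have dg: "(g has_derivative frechet_derivative g (at (snd c x))) (at (snd c x))"
    using S(2) by (rule smooth_on_has_derivative)
  have e: "frame_rep \<A> c Z y ** g y = frame_rep \<A> c Z' y" if "y \<in> S" for y using g[OF that] by simp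
  have "((\<lambda>y. frame_rep \<A> c Z y ** g y) has_derivative
      (\<lambda>v. frame_rep \<A> c Z (snd c x) ** frechet_derivative g (at (snd c x)) v + frame_deriv_at \<A> c x Z v ** g (snd c x))) (at (snd c x))"
    by (rule has_derivative_matrix_mult[OF has_derivative_frame_rep[OF is_lift_frame[OF Z(1)] c(1) Z(2) c(2)] dg])
  from frechet_derivative_at[OF has_derivative_transform_within_open[OF this S e]]
  have D: "frame_deriv_at \<A> c x Z' =
      (\<lambda>v. frame_rep \<A> c Z (snd c x) ** frechet_derivative g (at (snd c x)) v + frame_deriv_at \<A> c x Z v ** g (snd c x))"
    by (simp add: frame_deriv_at_def)
  have "canonical_at (frame_coords \<A> c x (Z x) ** g (snd c x)) (frame_deriv_at \<A> c x Z') \<gamma>"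
  proof (rule canonical_at_change_frame)
    show "canonical_at (frame_coords \<A> c x (Z x)) (frame_deriv_at \<A> c x Z) \<gamma>" using \<gamma> by (simp add: c_def)
    show "model_endo (g (snd c x))" "invertible (g (snd c x))" using g[OF S(2)] by auto
    show "model_endo (frechet_derivative g (at (snd c x)) v)" for v
      using model_endo_derivative[OF dg S] g by blast
    show "frame_deriv_at \<A> c x Z' v *v b = frame_deriv_at \<A> c x Z v *v (g (snd c x) *v b) +
        frame_coords \<A> c x (Z x) *v (frechet_derivative g (at (snd c x)) v *v b)" for v b
      using c by (simp add: D frame_rep_apply matrix_vector_mult_add_rdistrib add.commute flip: matrix_vector_mul_assoc)
  qed
  then show ?thesis using g[OF S(2)] c by (simp add: frame_rep_apply c_def)
qed

text \<open>The pointwise counterpart of \<open>is_canonical_connection\<close>, free of vector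
  fields. Quantifying over all lifts allows whichever lift is convenient; by
  \<open>canonical_in_change_lift\<close> the solution is the same for each.\<close>

definition adapted_connection where
  "adapted_connection U s \<Gamma> \<longleftrightarrow> linear_connection \<A> U \<Gamma> \<and>
     (\<forall>x\<in>U. \<forall>V Z. x \<in> V \<longrightarrow> is_lift \<A> s V Z \<longrightarrow> canonical_in (\<kappa> x) x Z (\<Gamma> x))"

lemma adapted_connectionD:
  "adapted_connection U s \<Gamma> \<Longrightarrow> x \<in> U \<Longrightarrow> x \<in> V \<Longrightarrow> is_lift \<A> s V Z \<Longrightarrow> canonical_in (\<kappa> x) x Z (\<Gamma> x)"
  by (auto simp: adapted_connection_def)

lemma adapted_connection_unique:
  assumes s: "quotient_section \<A> delta_GL U s" and "adapted_connection U s \<Gamma>" "adapted_connection U s \<Gamma>'"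
  shows "\<Gamma> = \<Gamma>'"
proof (rule extensionalityI)
  show "\<Gamma> \<in> extensional U" "\<Gamma>' \<in> extensional U"
    using assms by (auto simp: adapted_connection_def linear_connection_def)
  fix x assume x: "x \<in> U"
  obtain V Z where V: "x \<in> V" "V \<subseteq> U" "is_lift \<A> s V Z" using quotient_section_lift[OF s x] .
  show "\<Gamma> x = \<Gamma>' x"
    using adapted_connectionD[OF assms(2) x V(1,3)] adapted_connectionD[OF assms(3) x V(1,3)]
      canonical_in_iff[OF is_lift_frame[OF V(3)] \<kappa>(1) V(1) \<kappa>(2)] by simp
qed

lemma adapted_connection_exists:
  assumes s: "quotient_section \<A> delta_GL U s"
  obtains \<Gamma> where "adapted_connection U s \<Gamma>"
proof
  \<comment> \<open>The choice is harmless: no coherence between points is asked for, since the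
    value agrees with the solution for every lift through the point.\<close>
  define \<Gamma> where "\<Gamma> = (\<lambda>x\<in>U. SOME \<gamma>. \<exists>V Z. x \<in> V \<and> is_lift \<A> s V Z \<and> canonical_in (\<kappa> x) x Z \<gamma>)"
  have can: "canonical_in (\<kappa> x) x Z (\<Gamma> x)" if x: "x \<in> U" "x \<in> V" and Z: "is_lift \<A> s V Z" for x V Z
  proof -
    have "canonical_in (\<kappa> x) x Z (canonical_christoffel (frame_coords \<A> (\<kappa> x) x (Z x)) (frame_deriv_at \<A> (\<kappa> x) x Z))"
      using canonical_in_iff[OF is_lift_frame[OF Z] \<kappa>(1) x(2) \<kappa>(2)] by simp
    then have "\<exists>\<gamma> V Z. x \<in> V \<and> is_lift \<A> s V Z \<and> canonical_in (\<kappa> x) x Z \<gamma>" using x Z by blast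
    from someI_ex[OF this] obtain V' Z' where "x \<in> V'" "is_lift \<A> s V' Z'" "canonical_in (\<kappa> x) x Z' (\<Gamma> x)"
      using x by (auto simp: \<Gamma>_def)
    then show ?thesis using canonical_in_change_lift x Z by blast
  qed
  have "linear_connection \<A> U \<Gamma>"
    unfolding linear_connection_def
  proof (intro conjI ballI)
    show "open U" using s by (simp add: quotient_section_def)
    show "\<Gamma> \<in> extensional U" by (simp add: \<Gamma>_def)
    fix c assume c: "c \<in> \<A>"
    show "smooth_on (snd c ` (U \<inter> fst c)) (\<lambda>y. conn_coords \<A> c (chart_inv c y) (\<Gamma> (chart_inv c y)))"
    proof (rule smooth_on_local)
      fix y assume "y \<in> snd c ` (U \<inter> fst c)"
      then obtain x where x: "y = snd c x" "x \<in> U" "x \<in> fst c" by blast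
      obtain V Z where V: "x \<in> V" "V \<subseteq> U" "is_lift \<A> s V Z" using quotient_section_lift[OF s x(2)] .
      note Z = is_lift_frame[OF V(3)]
      let ?S = "snd c ` (V \<inter> fst c)"
      have S: "open ?S" "y \<in> ?S" using open_chart_Int[OF c frame_field_open[OF Z]] V x by auto
      note sm = frame_field_smooth[OF Z c]
      have "smooth_on ?S (\<lambda>y. conn_coords \<A> c (chart_inv c y) (\<Gamma> (chart_inv c y)))"
      proof (rule smooth_on_cong[OF _ S(1)])
        \<comment> \<open>Near a point one fixed lift describes the components of the connection by
          the explicit formula, which is smooth.\<close>
        show "smooth_on ?S (\<lambda>y. canonical_christoffel (frame_rep \<A> c Z y) (frechet_derivative (frame_rep \<A> c Z) (at y)))"
        proof (rule smooth_on_canonical_christoffel[OF S(1) sm])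
          show "invertible (frame_rep \<A> c Z y)" if "y \<in> ?S" for y
            using that c by (auto simp: frame_rep_apply intro!: invertible_frame_coords is_lift_invertible[OF V(3)])
          show "smooth_on ?S (\<lambda>y. frechet_derivative (frame_rep \<A> c Z) (at y) (u y))" if "smooth_on ?S u" for u
            by (rule smooth_on_frechet_derivative[OF S(1) sm that])
        qed
        fix w assume "w \<in> ?S"
        then obtain p where p: "w = snd c p" "p \<in> V" "p \<in> fst c" by blast
        have "canonical_in c p Z (conn_coords \<A> c p (\<Gamma> p))"
          using p V by (intro canonical_in_conn_coords[OF c p(3) Z] can) auto
        then show "canonical_christoffel (frame_rep \<A> c Z w) (frechet_derivative (frame_rep \<A> c Z) (at w)) =
            conn_coords \<A> c (chart_inv c w) (\<Gamma> (chart_inv c w))"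
          using canonical_in_iff[OF Z c p(2,3)] p c by (simp add: frame_rep_apply frame_deriv_at_def)
      qed
      then show "\<exists>T. open T \<and> y \<in> T \<and> smooth_on T (\<lambda>y. conn_coords \<A> c (chart_inv c y) (\<Gamma> (chart_inv c y)))"
        using S by blast
    qed
  qed
  then show "adapted_connection U s \<Gamma>" using can by (simp add: adapted_connection_def)
qed

end

section \<open>The structure of a section and its canonical connection\<close>

context double_manifold
begin

lemma conjugate_endo_field:
  assumes U: "open U" and F: "F \<in> extensional U"
    and loc: "\<And>x. x \<in> U \<Longrightarrow> \<exists>V Z. x \<in> V \<and> V \<subseteq> U \<and> frame_field \<A> V Z \<and> (\<forall>y\<in>V. F y = Z y ** M ** matrix_inv (Z y))"
  shows "endo_field \<A> U F"
  unfolding endo_field_def Let_def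
proof (intro conjI ballI U F)
  fix c assume c: "c \<in> \<A>"
  let ?f = "\<lambda>y. matrix (\<lambda>w. to_coords \<A> c (chart_inv c y) (F (chart_inv c y) *v from_coords \<A> c (chart_inv c y) w))"
  show "smooth_on (snd c ` (U \<inter> fst c)) ?f"
  proof (rule smooth_on_local)
    fix y assume "y \<in> snd c ` (U \<inter> fst c)"
    then obtain x where x: "y = snd c x" "x \<in> U" "x \<in> fst c" by blast
    obtain V Z where V: "x \<in> V" "V \<subseteq> U" "frame_field \<A> V Z" "\<And>y. y \<in> V \<Longrightarrow> F y = Z y ** M ** matrix_inv (Z y)"
      using loc[OF x(2)] by blast
    let ?S = "snd c ` (V \<inter> fst c)"
    have S: "open ?S" "y \<in> ?S" using open_chart_Int[OF c frame_field_open[OF V(3)]] V x by auto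
    note sm = frame_field_smooth[OF V(3) c]
    have "smooth_on ?S ?f"
    proof (rule smooth_on_cong[OF _ S(1)])
      have inv: "invertible (frame_rep \<A> c Z y)" if "y \<in> ?S" for y
        using that c by (auto simp: frame_rep_apply intro!: invertible_frame_coords frame_field_invertible[OF V(3)])
      then show "smooth_on ?S (\<lambda>y. frame_rep \<A> c Z y ** M ** matrix_inv (frame_rep \<A> c Z y))"
        by (intro smooth_on_matrix_mult S(1) smooth_on_const sm smooth_on_matrix_inv)
      fix w assume w: "w \<in> ?S"
      then obtain p where p: "w = snd c p" "p \<in> V" "p \<in> fst c" by blast
      define Zc where "Zc = frame_rep \<A> c Z w"
      have Zc: "Zc *v b = to_coords \<A> c p (Z p *v b)" for b
        using p c by (simp add: Zc_def frame_rep_apply frame_coords_vec)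
      have Zi: "invertible Zc" "invertible (Z p)" using inv[OF w] frame_field_invertible[OF V(3) p(2)] by (auto simp: Zc_def)
      \<comment> \<open>In the chart, F is again a conjugate of \<open>M\<close>, now by the
        components of the frame, and these depend smoothly on the point.\<close>
      have "to_coords \<A> c p (F p *v from_coords \<A> c p v) = (Zc ** M ** matrix_inv Zc) *v v" for v
      proof -
        define b where "b = matrix_inv (Z p) *v from_coords \<A> c p v"
        have b: "from_coords \<A> c p v = Z p *v b" by (simp add: b_def matrix_inv_vec[OF Zi(2)])
        have "Zc *v b = v" unfolding Zc b[symmetric] using c p by simp
        then have "matrix_inv Zc *v v = b" using matrix_inv_vec(2)[OF Zi(1)] by metis
        then show ?thesis
          unfolding V(4)[OF p(2)] b by (simp add: Zc matrix_inv_vec[OF Zi(2)] flip: matrix_vector_mul_assoc)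
      qed
      then show "frame_rep \<A> c Z w ** M ** matrix_inv (frame_rep \<A> c Z w) = ?f w"
        using p c by (simp add: Zc_def matrix_of_matrix_vector_mul)
    qed
    then show "\<exists>T. open T \<and> y \<in> T \<and> smooth_on T ?f" using S by blast
  qed
qed

lemma structure_of_section:
  assumes s: "quotient_section \<A> delta_GL U s"
  obtains F P where "structure_of_section \<A> U s = (F, P)"
    "\<And>x V Z. x \<in> U \<Longrightarrow> x \<in> V \<Longrightarrow> is_lift \<A> s V Z \<Longrightarrow> F x = Z x ** model_F ** matrix_inv (Z x)"
    "\<And>x V Z. x \<in> U \<Longrightarrow> x \<in> V \<Longrightarrow> is_lift \<A> s V Z \<Longrightarrow> P x = Z x ** model_P ** matrix_inv (Z x)"
proof -
  \<comment> \<open>Representatives are chosen pointwise without regard to smoothness. Conjugation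
    depends on the orbit only, so the result coincides locally with the one given by a smooth
    lift.\<close>
  define z where "z x = (SOME z. invertible z \<and> s x = frame_orbit z delta_GL)" for x
  define F where "F = (\<lambda>x\<in>U. z x ** model_F ** matrix_inv (z x))"
  define P where "P = (\<lambda>x\<in>U. z x ** model_P ** matrix_inv (z x))"
  have lift: "invertible (Z x)" "s x = frame_orbit (Z x) delta_GL" if "x \<in> V" "is_lift \<A> s V Z" for x V Z
    using that is_lift_invertible by (auto simp: is_lift_def)
  have z: "invertible (z x)" "s x = frame_orbit (z x) delta_GL" if x: "x \<in> U" for x
  proof -
    obtain V Z where "x \<in> V" "is_lift \<A> s V Z" using quotient_section_lift[OF s x] by metis
    from lift[OF this] have "\<exists>z. invertible z \<and> s x = frame_orbit z delta_GL" by blast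
    from someI_ex[OF this] show "invertible (z x)" "s x = frame_orbit (z x) delta_GL" by (auto simp: z_def)
  qed
  have FP: "F x = Z x ** model_F ** matrix_inv (Z x)" "P x = Z x ** model_P ** matrix_inv (Z x)"
    if "x \<in> U" "x \<in> V" "is_lift \<A> s V Z" for x V Z
    using conjugate_model_cong[of "z x" "Z x"] z[OF that(1)] lift[OF that(2,3)] that(1) by (auto simp: F_def P_def)
  have U: "open U" using s by (simp add: quotient_section_def)
  have endo: "endo_field \<A> U F" "endo_field \<A> U P"
  proof -
    have *: "\<exists>V Z. x \<in> V \<and> V \<subseteq> U \<and> frame_field \<A> V Z \<and> (\<forall>y\<in>V. F y = Z y ** model_F ** matrix_inv (Z y))"
       "\<exists>V Z. x \<in> V \<and> V \<subseteq> U \<and> frame_field \<A> V Z \<and> (\<forall>y\<in>V. P y = Z y ** model_P ** matrix_inv (Z y))"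
      if x: "x \<in> U" for x
      using quotient_section_lift[OF s x] FP is_lift_frame by (metis subsetD)+
    have "F \<in> extensional U" "P \<in> extensional U"
      unfolding F_def P_def by (rule restrict_extensional)+
    then show "endo_field \<A> U F" "endo_field \<A> U P"
      using conjugate_endo_field[OF U _ *(1)] conjugate_endo_field[OF U _ *(2)] by blast+
  qed
  have abc: "almost_biparacomplex \<A> U F P"
    using endo conjugate_model[OF z(1)] by (auto simp: almost_biparacomplex_def F_def P_def)
  have "structure_of_section \<A> U s = (F, P)"
    unfolding structure_of_section_def
  proof (rule the_equality)
    have "(x, u) \<in> G_structure delta_GL U s \<longleftrightarrow> adapted_frame (F x) (P x) u" if "x \<in> U" for x u
      using that z[OF that] adapted_frame_conjugate[OF z(1)[OF that], of u] by (auto simp: G_structure_def F_def P_def)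
    with abc show "case (F, P) of (F, P) \<Rightarrow> almost_biparacomplex \<A> U F P \<and>
        (\<forall>x\<in>U. \<forall>u. (x, u) \<in> G_structure delta_GL U s \<longleftrightarrow> adapted_frame (F x) (P x) u)" by simp
    fix p assume p: "case p of (F, P) \<Rightarrow> almost_biparacomplex \<A> U F P \<and>
        (\<forall>x\<in>U. \<forall>u. (x, u) \<in> G_structure delta_GL U s \<longleftrightarrow> adapted_frame (F x) (P x) u)"
    obtain F' P' where p': "p = (F', P')" by fastforce
    have ext: "F' \<in> extensional U" "P' \<in> extensional U"
      using p by (auto simp: p' almost_biparacomplex_def endo_field_def)
    have "F' x = F x \<and> P' x = P x" if x: "x \<in> U" for x
    proof -
      \<comment> \<open>A competing structure has the frame \<open>z x\<close> among its adapted
        frames, which determines it at \<open>x\<close>; off \<open>U\<close> both are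
        \<open>undefined\<close> by extensionality.\<close>
      have "(x, z x) \<in> G_structure delta_GL U s" using z[OF x] x by (simp add: G_structure_def)
      then have "P' x ** P' x = mat 1" "F' x ** P' x + P' x ** F' x = 0" "adapted_frame (F' x) (P' x) (z x)"
        using p x by (auto simp: p' almost_biparacomplex_def)
      from adapted_frame_unique[OF this] show ?thesis using x by (simp add: F_def P_def)
    qed
    then show "p = (F, P)"
      unfolding p' using ext by (auto intro!: extensionalityI[of _ U] simp: F_def P_def)
  qed
  then show thesis
  proof (rule that)
    fix x V Z assume "x \<in> U" "x \<in> V" "is_lift \<A> s V Z"
    then show "F x = Z x ** model_F ** matrix_inv (Z x)" "P x = Z x ** model_P ** matrix_inv (Z x)"
      by (rule FP)+
  qed
qed

text \<open>Write Y = Z a with component functions \<open>a\<close>. The covariant derivative of Y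
  along X then has frame components a' + A a, and F Y has components M a; commutation of
  \<open>A\<close> with \<open>M\<close> gives the Leibniz rule with parallel F.\<close>

lemma cov_deriv_endo_conjugate:
  assumes Z: "frame_field \<A> V Z" "x \<in> V" and F: "\<And>y. y \<in> V \<Longrightarrow> F y = Z y ** M ** matrix_inv (Z y)"
    and Y: "vector_field \<A> V Y"
    and A: "A ** M = M ** A" "\<And>b. christoffel_apply (\<Gamma> x) (X x) (Z x *v b) + frame_deriv_at \<A> (\<kappa> x) x Z (X x) *v b = Z x *v (A *v b)"
  shows "cov_deriv_endo \<A> \<Gamma> F X Y x = 0"
proof -
  define c where "c = \<kappa> x"
  have c: "c \<in> \<A>" "x \<in> fst c" by (auto simp: c_def \<kappa>)
  define S where "S = snd c ` (V \<inter> fst c)"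
  have S: "open S" "snd c x \<in> S" using open_chart_Int[OF c(1) frame_field_open[OF Z(1)]] Z c by (auto simp: S_def)
  have sm: "smooth_on S (frame_rep \<A> c Z)" "smooth_on S (field_rep \<A> c Y)"
    using frame_field_smooth[OF Z(1) c(1)] Y c(1) by (auto simp: S_def vector_field_def)
  have inv: "invertible (frame_rep \<A> c Z y)" if "y \<in> S" for y
    using that c by (auto simp: S_def frame_rep_apply intro!: invertible_frame_coords frame_field_invertible[OF Z(1)])
  define a where "a y = matrix_inv (frame_rep \<A> c Z y) *v field_rep \<A> c Y y" for y
  have "smooth_on S a"
    unfolding a_def[abs_def] by (intro smooth_on_matrix_vector_mult S(1) smooth_on_matrix_inv sm inv)
  then obtain a' where a': "(a has_derivative a') (at (snd c x))"
    using smooth_on_has_derivative[OF _ S(2)] by blast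
  then have Ma': "((\<lambda>y. M *v a y) has_derivative (\<lambda>v. M *v a' v)) (at (snd c x))"
    by (rule bounded_linear.has_derivative[OF matrix_vector_mul_bounded_linear])
  have Za: "frame_rep \<A> c Z y *v a y = field_rep \<A> c Y y" if "y \<in> S" for y
    unfolding a_def by (rule matrix_inv_vec(1)[OF inv[OF that]])
  have Ya: "Y p = Z p *v a (snd c p)" if p: "p \<in> V" "p \<in> fst c" for p
  proof -
    have "to_coords \<A> c p (Z p *v a (snd c p)) = to_coords \<A> c p (Y p)"
      using Za[of "snd c p"] p c by (simp add: S_def frame_rep_apply field_rep_apply frame_coords_vec)
    then show ?thesis using from_to_coords[OF c(1) p(2)] by metis
  qed
  have FYa: "F p *v Y p = Z p *v (M *v a (snd c p))" if p: "p \<in> V" "p \<in> fst c" for p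
    by (simp add: F[OF p(1)] Ya[OF p] matrix_inv_vec[OF frame_field_invertible[OF Z(1) p(1)]] flip: matrix_vector_mul_assoc)
  have FY: "frame_rep \<A> c Z y *v (M *v a y) = field_rep \<A> c (\<lambda>y. F y *v Y y) y" if "y \<in> S" for y
    using that c by (auto simp: S_def frame_rep_apply field_rep_apply frame_coords_vec FYa)
  note dZ = has_derivative_frame_rep[OF Z(1) c(1) Z(2) c(2)]
  have z: "frame_rep \<A> c Z (snd c x) = Z x" using c by (simp add: frame_rep_apply) (simp add: c_def)
  have 1: "component_deriv \<A> x v Y = Z x *v a' v + frame_deriv_at \<A> c x Z v *v a (snd c x)" for v
    using fun_cong[OF frechet_derivative_at[OF has_derivative_transform_within_open[OF has_derivative_matrix_vector_mult[OF dZ a'] S Za]]]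
    by (simp add: component_deriv_def c_def[symmetric] z)
  have 2: "component_deriv \<A> x v (\<lambda>y. F y *v Y y) = Z x *v (M *v a' v) + frame_deriv_at \<A> c x Z v *v (M *v a (snd c x))" for v
    using fun_cong[OF frechet_derivative_at[OF has_derivative_transform_within_open[OF has_derivative_matrix_vector_mult[OF dZ Ma'] S FY]]]
    by (simp add: component_deriv_def c_def[symmetric] z)
  have Az: "frame_deriv_at \<A> c x Z (X x) *v b = Z x *v (A *v b) - christoffel_apply (\<Gamma> x) (X x) (Z x *v b)" for b
    using A(2)[of b] by (simp add: c_def[symmetric] algebra_simps)
  have AM: "A *v (M *v b) = M *v (A *v b)" for b using A(1) by (simp add: matrix_vector_mul_assoc)
  have "cov_deriv \<A> \<Gamma> X Y x = Z x *v (a' (X x) + A *v a (snd c x))"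
    by (simp add: cov_deriv_def cov_deriv_at_def 1 Az Ya[OF Z(2) c(2)] matrix_vector_right_distrib)
  moreover have "cov_deriv \<A> \<Gamma> X (\<lambda>y. F y *v Y y) x = Z x *v (M *v (a' (X x) + A *v a (snd c x)))"
    by (simp add: cov_deriv_def cov_deriv_at_def 2 Az FYa[OF Z(2) c(2)] matrix_vector_right_distrib AM)
  ultimately show ?thesis
    by (simp add: cov_deriv_endo_def F[OF Z(2)] matrix_inv_vec[OF frame_field_invertible[OF Z]] flip: matrix_vector_mul_assoc)
qed

text \<open>Parallelism is tested on fields with constant frame components: \<open>?X\<close> takes
  the value \<open>v\<close> at \<open>x\<close>, and F sends the field with components
  \<open>b\<close> to the one with components \<open>M *v b\<close>, so only derivatives of the
  frame occur.\<close>

lemma parallel_endo_conjugate: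
  assumes par: "parallel_endo \<A> U \<Gamma> F" and Z: "frame_field \<A> V Z" "V \<subseteq> U" "x \<in> V"
    and F: "\<And>y. y \<in> V \<Longrightarrow> F y = Z y ** M ** matrix_inv (Z y)"
  shows "christoffel_apply (\<Gamma> x) v (Z x *v (M *v b)) + frame_deriv_at \<A> (\<kappa> x) x Z v *v (M *v b) =
    Z x *v (M *v (matrix_inv (Z x) *v (christoffel_apply (\<Gamma> x) v (Z x *v b) + frame_deriv_at \<A> (\<kappa> x) x Z v *v b)))"
proof -
  note inv = frame_field_invertible[OF Z(1)]
  let ?X = "\<lambda>y. Z y *v (matrix_inv (Z x) *v v)" and ?Y = "\<lambda>y. Z y *v b"
  have FY: "F y *v ?Y y = Z y *v (M *v b)" if "y \<in> V" for y
    by (simp add: F[OF that] matrix_inv_vec[OF inv[OF that]] flip: matrix_vector_mul_assoc)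
  have "component_deriv \<A> x v (\<lambda>y. F y *v ?Y y) = component_deriv \<A> x v (\<lambda>y. Z y *v (M *v b))"
    using component_deriv_cong[OF frame_field_open[OF Z(1)] Z(3) FY[symmetric] vector_field_frame[OF Z(1)]] by simp
  moreover have "cov_deriv_endo \<A> \<Gamma> F ?X ?Y x = 0"
    using par Z vector_field_frame[OF Z(1)] unfolding parallel_endo_def by blast
  ultimately show ?thesis
    by (simp add: cov_deriv_endo_def cov_deriv_def cov_deriv_at_def component_deriv_frame[OF Z(1,3)]
        FY[OF Z(3)] matrix_inv_vec[OF inv[OF Z(3)]] F[OF Z(3)] add.commute flip: matrix_vector_mul_assoc)
qed

text \<open>Bracket and covariant derivatives are computed in the same chosen chart, so all
  derivatives of the fields cancel and only values at the point remain.\<close>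

lemma torsion_eq:
  "torsion \<A> \<Gamma> X Y x = christoffel_apply (\<Gamma> x) (X x) (Y x) - christoffel_apply (\<Gamma> x) (Y x) (X x)"
  by (simp add: torsion_def cov_deriv_def cov_deriv_at_def lie_bracket_def)

text \<open>The bridge between the definition by vector fields and the linear algebra at each point.
  One direction tests on fields with constant frame components; the other expands arbitrary fields
  in a frame.\<close>

lemma is_canonical_connection_iff:
  assumes s: "quotient_section \<A> delta_GL U s"
    and F: "\<And>x V Z. x \<in> U \<Longrightarrow> x \<in> V \<Longrightarrow> is_lift \<A> s V Z \<Longrightarrow> F x = Z x ** model_F ** matrix_inv (Z x)"
    and P: "\<And>x V Z. x \<in> U \<Longrightarrow> x \<in> V \<Longrightarrow> is_lift \<A> s V Z \<Longrightarrow> P x = Z x ** model_P ** matrix_inv (Z x)"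
  shows "is_canonical_connection \<A> U F P \<Gamma> \<longleftrightarrow> adapted_connection U s \<Gamma>"
proof
  assume can: "is_canonical_connection \<A> U F P \<Gamma>"
  show "adapted_connection U s \<Gamma>"
    unfolding adapted_connection_def
  proof (intro conjI ballI allI impI)
    show "linear_connection \<A> U \<Gamma>" using can by (simp add: is_canonical_connection_def)
    fix x V' Z assume x: "x \<in> U" "x \<in> V'" and lift': "is_lift \<A> s V' Z"
    \<comment> \<open>A lift may extend beyond \<open>U\<close>, whereas the conditions on the
      connection speak about fields inside \<open>U\<close> only.\<close>
    define V where "V = V' \<inter> U"
    have "open V"
      using open_Int[OF frame_field_open[OF is_lift_frame[OF lift']], of U] s by (simp add: V_def quotient_section_def)
    then have lift: "is_lift \<A> s V Z" "V \<subseteq> U" "x \<in> V"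
      using is_lift_subset[OF lift'] x by (auto simp: V_def)
    note Z = is_lift_frame[OF lift(1)]
    note inv = matrix_inv_vec[OF frame_field_invertible[OF Z lift(3)]]
    let ?D = "frame_deriv_at \<A> (\<kappa> x) x Z"
    have FP: "F y = Z y ** model_F ** matrix_inv (Z y)" "P y = Z y ** model_P ** matrix_inv (Z y)" if "y \<in> V" for y
      using F P that lift by blast+
    have par: "parallel_endo \<A> U \<Gamma> F" "parallel_endo \<A> U \<Gamma> P" using can by (auto simp: is_canonical_connection_def)
    show "canonical_in (\<kappa> x) x Z (\<Gamma> x)"
      unfolding canonical_at_def frame_coords_chart_at
    proof (intro conjI allI impI)
      fix v
      \<comment> \<open>The connection matrix in the frame \<open>Z\<close>. It commutes with the
        two models because F and P are parallel.\<close>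
      define A where "A = matrix_inv (Z x) ** (christoffel_matrix (\<Gamma> x) v ** Z x + ?D v)"
      have A: "A *v b = matrix_inv (Z x) *v (christoffel_apply (\<Gamma> x) v (Z x *v b) + ?D v *v b)" for b
        by (simp add: A_def matrix_vector_mult_add_rdistrib christoffel_matrix_vec flip: matrix_vector_mul_assoc)
      have "model_endo A"
        unfolding model_endo_vec A
        by (simp add: parallel_endo_conjugate[OF par(1) Z lift(2,3) FP(1)] parallel_endo_conjugate[OF par(2) Z lift(2,3) FP(2)] inv)
      then show "\<exists>A. model_endo A \<and> (\<forall>b. christoffel_apply (\<Gamma> x) v (Z x *v b) + ?D v *v b = Z x *v (A *v b))"
        using A inv(1) by auto
    next
      fix a b :: "real^('n + 'n)" assume ab: "model_F *v a = a" "model_F *v b = - b"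
      have "(\<lambda>y. Z y *v a) y \<in> eigen_plus (F y)" "(\<lambda>y. Z y *v b) y \<in> eigen_minus (F y)" if "y \<in> V" for y
        using ab matrix_inv_vec[OF frame_field_invertible[OF Z that]]
        by (simp_all add: eigen_plus_iff eigen_minus_iff FP[OF that] vec.neg flip: matrix_vector_mul_assoc)
      then have "torsion \<A> \<Gamma> (\<lambda>y. Z y *v a) (\<lambda>y. Z y *v b) x = 0"
        using can lift vector_field_frame[OF Z] unfolding is_canonical_connection_def by blast
      then show "christoffel_apply (\<Gamma> x) (Z x *v a) (Z x *v b) = christoffel_apply (\<Gamma> x) (Z x *v b) (Z x *v a)"
        by (simp add: torsion_eq)
    qed
  qed
next
  assume ad: "adapted_connection U s \<Gamma>"
  show "is_canonical_connection \<A> U F P \<Gamma>"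
    unfolding is_canonical_connection_def parallel_endo_def
  proof (intro conjI allI impI ballI)
    show "linear_connection \<A> U \<Gamma>" using ad by (simp add: adapted_connection_def)
  next
    fix V X Y x assume V: "V \<subseteq> U" "x \<in> V" and XY: "vector_field \<A> V X" "vector_field \<A> V Y"
    obtain W Z where W: "x \<in> W" "W \<subseteq> U" "is_lift \<A> s W Z" using quotient_section_lift[OF s] V by blast
    note can = adapted_connectionD[OF ad _ W(1,3), unfolded frame_coords_chart_at]
    have x: "x \<in> U" using V by blast
    have o: "open (V \<inter> W)"
      using XY(1) frame_field_open[OF is_lift_frame[OF W(3)]] by (auto simp: vector_field_def)
    have Z: "frame_field \<A> (V \<inter> W) Z" "x \<in> V \<inter> W" 
      using frame_field_subset[OF is_lift_frame[OF W(3)] o] V W by auto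
    have Y: "vector_field \<A> (V \<inter> W) Y" using vector_field_subset[OF XY(2) o] by simp
    obtain A where A: "model_endo A" "\<And>b. christoffel_apply (\<Gamma> x) (X x) (Z x *v b) + frame_deriv_at \<A> (\<kappa> x) x Z (X x) *v b = Z x *v (A *v b)"
      using can[OF x] unfolding canonical_at_def by blast
    show "cov_deriv_endo \<A> \<Gamma> F X Y x = 0"
      by (rule cov_deriv_endo_conjugate[where \<Gamma> = \<Gamma> and X = X and A = A and M = model_F, OF Z _ Y _ A(2)]) (use F W A(1) in \<open>auto simp: model_endo_def\<close>)
    show "cov_deriv_endo \<A> \<Gamma> P X Y x = 0"
      by (rule cov_deriv_endo_conjugate[where \<Gamma> = \<Gamma> and X = X and A = A and M = model_P, OF Z _ Y _ A(2)]) (use P W A(1) in \<open>auto simp: model_endo_def\<close>)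
  next
    fix V X Y x assume V: "V \<subseteq> U" "x \<in> V" and eig: "\<forall>x\<in>V. X x \<in> eigen_plus (F x)" "\<forall>x\<in>V. Y x \<in> eigen_minus (F x)"
    have x: "x \<in> U" using V by blast
    obtain W Z where W: "x \<in> W" "W \<subseteq> U" "is_lift \<A> s W Z" using quotient_section_lift[OF s x] .
    note inv = matrix_inv_vec[OF is_lift_invertible[OF W(3,1)]]
    \<comment> \<open>Components at the single point \<open>x\<close> suffice, as the torsion is
      tensorial.\<close>
    define a b where "a = matrix_inv (Z x) *v X x" and "b = matrix_inv (Z x) *v Y x"
    have ab: "X x = Z x *v a" "Y x = Z x *v b" by (simp_all add: a_def b_def inv)
    have "Z x *v (model_F *v a) = Z x *v a" "Z x *v (model_F *v b) = Z x *v (- b)"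
    proof -
      have "F x *v X x = X x" "F x *v Y x = - Y x"
        using eig V by (auto simp: eigen_plus_iff eigen_minus_iff)
      then show "Z x *v (model_F *v a) = Z x *v a" "Z x *v (model_F *v b) = Z x *v (- b)"
        unfolding F[OF x W(1,3)] ab by (simp_all add: inv vec.neg flip: matrix_vector_mul_assoc)
    qed
    then have "model_F *v a = a" "model_F *v b = - b" using inv(2) by metis+
    then show "torsion \<A> \<Gamma> X Y x = 0"
      using canonical_at_torsion[OF adapted_connectionD[OF ad x W(1,3)], of a b] by (simp add: torsion_eq ab)
  qed
qed

definition canonical_conn where
  "canonical_conn U s = (case structure_of_section \<A> U s of (F, P) \<Rightarrow> canonical_connection \<A> U F P)"

lemma adapted_canonical_conn:
  assumes s: "quotient_section \<A> delta_GL U s"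
  shows "adapted_connection U s (canonical_conn U s)"
proof -
  obtain F P where FP: "structure_of_section \<A> U s = (F, P)"
    "\<And>x V Z. x \<in> U \<Longrightarrow> x \<in> V \<Longrightarrow> is_lift \<A> s V Z \<Longrightarrow> F x = Z x ** model_F ** matrix_inv (Z x)"
    "\<And>x V Z. x \<in> U \<Longrightarrow> x \<in> V \<Longrightarrow> is_lift \<A> s V Z \<Longrightarrow> P x = Z x ** model_P ** matrix_inv (Z x)"
    using structure_of_section[OF s] by metis
  obtain \<Gamma> where \<Gamma>: "adapted_connection U s \<Gamma>" using adapted_connection_exists[OF s] .
  have "canonical_conn U s = (THE \<Gamma>. adapted_connection U s \<Gamma>)"
  proof -
    have "is_canonical_connection \<A> U F P = adapted_connection U s"
      by (rule ext, rule is_canonical_connection_iff[OF s]) (fact FP(2), fact FP(3))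
    then show ?thesis by (simp add: canonical_conn_def FP(1) canonical_connection_def)
  qed
  also have "\<dots> = \<Gamma>" using \<Gamma> adapted_connection_unique[OF s] by blast
  finally show ?thesis using \<Gamma> by simp
qed

lemma canonical_conn_eqI:
  "quotient_section \<A> delta_GL U s \<Longrightarrow> adapted_connection U s \<Gamma> \<Longrightarrow> canonical_conn U s = \<Gamma>"
  using adapted_connection_unique adapted_canonical_conn by blast

section \<open>Restriction to open subsets, and reducibility\<close>

lemma quotient_sectionI:
  assumes "open U" "s \<in> extensional U" "\<And>x. x \<in> U \<Longrightarrow> \<exists>V Z. x \<in> V \<and> V \<subseteq> U \<and> is_lift \<A> s V Z"
  shows "quotient_section \<A> delta_GL U s"
  using assms unfolding quotient_section_def is_lift_def by meson

lemma is_lift_restrict: "is_lift \<A> (restrict s V) W Z \<longleftrightarrow> is_lift \<A> s W Z" if "W \<subseteq> V"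
  using that by (auto simp: is_lift_def)

lemma canonical_conn_restrict:
  assumes s: "quotient_section \<A> delta_GL U s" and V: "open V" "V \<subseteq> U"
  shows "quotient_section \<A> delta_GL V (restrict s V)"
    "canonical_conn V (restrict s V) = restrict (canonical_conn U s) V"
proof -
  show s': "quotient_section \<A> delta_GL V (restrict s V)"
  proof (rule quotient_sectionI)
    fix x assume x: "x \<in> V"
    obtain W Z where W: "x \<in> W" "W \<subseteq> U" "is_lift \<A> s W Z" using quotient_section_lift[OF s] x V by blast
    have "open (W \<inter> V)" using V W is_lift_frame frame_field_open by blast
    then have "is_lift \<A> (restrict s V) (W \<inter> V) Z"
      using is_lift_subset[OF W(3)] by (simp add: is_lift_restrict)
    then show "\<exists>W Z. x \<in> W \<and> W \<subseteq> V \<and> is_lift \<A> (restrict s V) W Z" using W x by blast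
  qed (use V in auto)
  let ?\<Gamma> = "canonical_conn U s"
  have ad: "adapted_connection U s ?\<Gamma>" using s by (rule adapted_canonical_conn)
  have "adapted_connection V (restrict s V) (restrict ?\<Gamma> V)"
    unfolding adapted_connection_def linear_connection_def
  proof (intro conjI ballI allI impI V(1) restrict_extensional)
    fix c assume c: "c \<in> \<A>"
    show "smooth_on (snd c ` (V \<inter> fst c)) (\<lambda>y. conn_coords \<A> c (chart_inv c y) (restrict ?\<Gamma> V (chart_inv c y)))"
    proof (rule smooth_on_cong[OF _ open_chart_Int[OF c V(1)]])
      have "smooth_on (snd c ` (U \<inter> fst c)) (\<lambda>y. conn_coords \<A> c (chart_inv c y) (?\<Gamma> (chart_inv c y)))"
        using ad c by (simp add: adapted_connection_def linear_connection_def)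
      then show "smooth_on (snd c ` (V \<inter> fst c)) (\<lambda>y. conn_coords \<A> c (chart_inv c y) (?\<Gamma> (chart_inv c y)))"
        by (rule smooth_on_subset) (use V in auto)
    qed (use c in auto)
  next
    fix x W Z assume x: "x \<in> V" "x \<in> W" and lift: "is_lift \<A> (restrict s V) W Z"
    have o: "open (W \<inter> V)" using V lift is_lift_frame frame_field_open by blast
    have "is_lift \<A> s (W \<inter> V) Z"
      using is_lift_subset[OF lift o] is_lift_restrict[of "W \<inter> V" V s Z] by simp
    then show "canonical_in (\<kappa> x) x Z (restrict ?\<Gamma> V x)"
      using adapted_connectionD[OF ad, of x "W \<inter> V" Z] x V by auto
  qed
  with s' show "canonical_conn V (restrict s V) = restrict ?\<Gamma> V" by (rule canonical_conn_eqI)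
qed

lemma reducible_adapted_connection:
  assumes s: "quotient_section \<A> delta_GL U s" and ad: "adapted_connection U s \<Gamma>"
  shows "reducible_to \<A> \<Gamma> (G_structure delta_GL U s)"
  unfolding reducible_to_def
proof (intro ballI, clarify)
  fix x u v w assume xu: "(x, u) \<in> G_structure delta_GL U s" and "(v, w) \<in> horizontal_space (\<Gamma> x) u"
  then have w: "w = (\<chi> k i. - (christoffel_apply (\<Gamma> x) v (column i u) $ k))" by (auto simp: horizontal_space_def)
  have x: "x \<in> U" "frame_orbit u delta_GL = s x" using xu by (auto simp: G_structure_def)
  obtain V Z where V: "x \<in> V" "V \<subseteq> U" "is_lift \<A> s V Z" using quotient_section_lift[OF s x(1)] .
  note Z = is_lift_frame[OF V(3)]
  define c where "c = \<kappa> x"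
  have c: "c \<in> \<A>" "x \<in> fst c" by (auto simp: c_def \<kappa>)
  have "u \<in> frame_orbit (Z x) delta_GL"
    using x V frame_orbit_self[of u] by (auto simp: is_lift_def)
  then obtain g\<^sub>0 where g0: "g\<^sub>0 \<in> delta_GL" "u = Z x ** g\<^sub>0" by (auto simp: frame_orbit_def)
  obtain A where A: "model_endo A"
    "\<And>b. christoffel_apply (\<Gamma> x) v (Z x *v b) + frame_deriv_at \<A> c x Z v *v b = Z x *v (A *v b)"
    using adapted_connectionD[OF ad x(1) V(1,3)] unfolding canonical_at_def frame_coords_chart_at c_def by blast
  \<comment> \<open>The base curve is a straight line in the chart with velocity
    \<open>v\<close>.\<close>
  define l where "l t = snd c x + t *\<^sub>R v" for t :: real
  \<comment> \<open>The initial velocity \<open>- (A ** g\<^sub>0)\<close> offsets the vertical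
    motion of the frame \<open>Z\<close> relative to parallel transport. An affine path stays in the
    commutant, a linear space; only invertibility confines it to small \<open>t\<close>.\<close>
  define g where "g t = g\<^sub>0 + t *\<^sub>R (- (A ** g\<^sub>0))" for t :: real
  define \<beta> where "\<beta> t = (chart_inv c (l t), Z (chart_inv c (l t)) ** g t)" for t
  define S where "S = snd c ` (V \<inter> fst c)"
  have S: "open S" "snd c x \<in> S" using open_chart_Int[OF c(1) frame_field_open[OF Z]] V c by (auto simp: S_def)
  have sm: "smooth_on T l" "smooth_on T g" if "open T" for T
    unfolding l_def[abs_def] g_def[abs_def] using that
    by (auto intro!: smooth_on_add smooth_on_diff smooth_on_scaleR smooth_on_const smooth_on_ident)
  \<comment> \<open>Times at which the base curve is inside the domain of the lift and the affine
    path is still invertible.\<close>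
  define N where "N = l -` S \<inter> g -` {B. invertible B}"
  have "open N"
    unfolding N_def using S(1) open_invertible smooth_on_imp_continuous[OF sm(1)[OF open_UNIV]]
      smooth_on_imp_continuous[OF sm(2)[OF open_UNIV]] by (intro open_Int open_vimage) auto
  moreover have "0 \<in> N" using S(2) g0 by (simp add: N_def l_def g_def delta_GL_eq)
  ultimately obtain \<epsilon> where \<epsilon>: "\<epsilon> > 0" "ball 0 \<epsilon> \<subseteq> N" using openE by blast
  define T where "T = {-\<epsilon><..<\<epsilon>}"
  have T: "open T" "T \<subseteq> N" "0 \<in> T" using \<epsilon> by (auto simp: T_def subset_iff dist_real_def)
  have pos: "chart_inv c (l t) \<in> V \<inter> fst c" "snd c (chart_inv c (l t)) = l t" if "t \<in> T" for t
    using that T(2) c(1) by (auto simp: N_def S_def subset_iff)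
  have rep: "(l t, frame_rep \<A> c Z (l t) ** g t) = (frame_chart \<A> c \<circ> \<beta>) t" if "t \<in> T" for t
    using pos[OF that] c frame_rep_apply[of c "chart_inv c (l t)" Z]
    by (simp add: frame_chart_def \<beta>_def frame_coords_mult)
  have "smooth_on T (\<lambda>t. (l t, frame_rep \<A> c Z (l t) ** g t))"
  proof (intro smooth_on_Pair smooth_on_matrix_mult T(1) sm)
    show "smooth_on T (\<lambda>t. frame_rep \<A> c Z (l t))"
      by (rule smooth_on_compose[OF T(1) S(1) _ sm(1)[OF T(1)]])
         (use T frame_field_smooth[OF Z c(1)] in \<open>auto simp: N_def S_def\<close>)
  qed
  then have smooth: "smooth_on T (frame_chart \<A> c \<circ> \<beta>)"
    using T(1) rep by (rule smooth_on_cong)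
  have dl: "(l has_derivative (\<lambda>t. t *\<^sub>R v)) (at 0)"
    and dg: "(g has_derivative (\<lambda>t. t *\<^sub>R (- (A ** g\<^sub>0)))) (at 0)"
    unfolding l_def[abs_def] g_def[abs_def] by (auto intro!: derivative_eq_intros)
  have "(frame_rep \<A> c Z has_derivative frame_deriv_at \<A> c x Z) (at (l 0))"
    using has_derivative_frame_rep[OF Z c(1) V(1) c(2)] by (simp add: l_def)
  from has_derivative_Pair[OF dl has_derivative_matrix_mult[OF has_derivative_compose[OF dl this] dg]]
  have "((\<lambda>t. (l t, frame_rep \<A> c Z (l t) ** g t)) has_derivative
      (\<lambda>t. (t *\<^sub>R v, frame_rep \<A> c Z (l 0) ** (t *\<^sub>R (- (A ** g\<^sub>0))) + frame_deriv_at \<A> c x Z (t *\<^sub>R v) ** g 0))) (at 0)" .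
  \<comment> \<open>Inserting the derivative of \<open>Z\<close> in direction \<open>v\<close>,
    given by \<open>A\<close>, into the product rule makes both terms with \<open>A\<close> cancel;
    what is left is minus the Christoffel term applied to the columns of \<open>u\<close>, the
    horizontal lift.\<close>
  moreover have "frame_rep \<A> c Z (l 0) ** (t *\<^sub>R (- (A ** g\<^sub>0))) + frame_deriv_at \<A> c x Z (t *\<^sub>R v) ** g 0 = t *\<^sub>R w" for t
  proof -
    have z: "frame_rep \<A> c Z (l 0) = Z x" using c by (simp add: l_def frame_rep_apply) (simp add: c_def)
    have ax: "w *v axis i 1 = - christoffel_apply (\<Gamma> x) v (u *v axis i 1)" for i
      by (simp add: w matrix_vector_mult_basis vec_eq_iff) (simp add: column_def)
    have *: "frame_deriv_at \<A> c x Z v *v b = Z x *v (A *v b) - christoffel_apply (\<Gamma> x) v (Z x *v b)" for b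
      using A(2)[of b] by (simp add: algebra_simps)
    show ?thesis
      unfolding matrix_eq_columns z
      by (simp add: ax g0(2) g_def * linear_scale[OF linear_frame_deriv_at[OF Z c(1) V(1) c(2)]]
          matrix_vector_mult_add_rdistrib matrix_vector_mult_scaleR vec.neg matrix_vector_mult_minus_left
          scaleR_diff_right flip: matrix_vector_mul_assoc scaleR_matrix_vector_assoc)
  qed
  ultimately have "((\<lambda>t. (l t, frame_rep \<A> c Z (l t) ** g t)) has_derivative (\<lambda>t. t *\<^sub>R (v, w))) (at 0)"
    by simp
  from has_derivative_transform_within_open[OF this T(1,3) rep]
  have deriv: "((frame_chart \<A> c \<circ> \<beta>) has_vector_derivative (v, w)) (at 0)"
    by (simp add: has_vector_derivative_def comp_def)
  have mem: "\<beta> t \<in> G_structure delta_GL U s" if t: "t \<in> T" for t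
  proof -
    have "model_endo (g t)"
      unfolding g_def using A(1) g0(1)
      by (intro model_endo_add model_endo_scaleR) (auto simp: delta_GL_eq model_endo_vec vec.neg
          matrix_vector_mult_minus_left simp flip: matrix_vector_mul_assoc)
    moreover have "invertible (g t)" using t T(2) by (auto simp: N_def)
    ultimately have g: "g t \<in> delta_GL" by (simp add: delta_GL_eq)
    let ?p = "chart_inv c (l t)"
    have p: "?p \<in> V" using pos[OF t] by blast
    then have "s ?p = frame_orbit (Z ?p ** g t) delta_GL"
      using V(3) by (simp add: is_lift_def frame_orbit_mult[OF g])
    moreover have "invertible (Z ?p ** g t)"
      using is_lift_invertible[OF V(3) p] \<open>invertible (g t)\<close> by (rule invertible_mult)
    ultimately show ?thesis
      using p V(2) by (auto simp: G_structure_def \<beta>_def)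
  qed
  show "(v, w) \<in> frame_tangent_space \<A> (G_structure delta_GL U s) x u"
    unfolding frame_tangent_space_def mem_Collect_eq
  proof (intro exI[of _ \<beta>] exI[of _ \<epsilon>] conjI ballI)
    show "\<beta> 0 = (x, u)" using c g0 by (simp add: \<beta>_def l_def g_def)
    show "\<beta> t \<in> G_structure delta_GL U s" if "t \<in> {-\<epsilon><..<\<epsilon>}" for t using mem that by (simp add: T_def)
    show "fst (\<beta> t) \<in> fst (\<kappa> x)" if "t \<in> {-\<epsilon><..<\<epsilon>}" for t using pos that by (simp add: T_def \<beta>_def c_def)
    show "smooth_on {-\<epsilon><..<\<epsilon>} (frame_chart \<A> (\<kappa> x) \<circ> \<beta>)" using smooth by (simp add: T_def c_def)
    show "((frame_chart \<A> (\<kappa> x) \<circ> \<beta>) has_vector_derivative (v, w)) (at 0)" using deriv by (simp add: c_def)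
  qed (fact \<epsilon>(1))
qed

end

section \<open>Invariance under diffeomorphisms\<close>

context double_manifold
begin

lemma push_frame_vec:
  assumes "smooth_map_on \<A> U \<phi>" "x \<in> U"
  shows "push_frame \<A> \<phi> x u *v b = tangent_map \<A> \<phi> x (u *v b)"
proof -
  have "tangent_map \<A> \<phi> x (u *v b) = (\<Sum>i\<in>UNIV. b $ i *\<^sub>R tangent_map \<A> \<phi> x (column i u))"
    unfolding matrix_vector_mult_columns[of u]
    by (simp add: linear_sum[OF linear_tangent_map[OF assms]] linear_scale[OF linear_tangent_map[OF assms]])
  then show ?thesis
    by (simp add: push_frame_def matrix_vector_mult_def vec_eq_iff mult.commute)
qed

lemma push_frame_mult:
  "smooth_map_on \<A> U \<phi> \<Longrightarrow> x \<in> U \<Longrightarrow> push_frame \<A> \<phi> x (u ** g) = push_frame \<A> \<phi> x u ** g"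
  by (simp add: matrix_eq push_frame_vec flip: matrix_vector_mul_assoc)

lemma tangent_map_inverse:
  assumes \<phi>: "diffeomorphism \<A> U U' \<phi>" and x: "x \<in> U"
  shows "tangent_map \<A> (inv_into U \<phi>) (\<phi> x) (tangent_map \<A> \<phi> x v) = v"
    "tangent_map \<A> \<phi> x (tangent_map \<A> (inv_into U \<phi>) (\<phi> x) v) = v"
proof -
  note d = diffeomorphism_inverse[OF \<phi>]
  have i: "inv_into U \<phi> (\<phi> x) = x" using d x by simp
  have "chart_deriv (\<kappa> (\<phi> x)) (\<kappa> x) (inv_into U \<phi>) (\<phi> x) (chart_deriv (\<kappa> x) (\<kappa> (\<phi> x)) \<phi> x v) =
      chart_deriv (\<kappa> x) (\<kappa> x) (\<lambda>x. x) x v"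
    by (rule chart_deriv_compose[OF \<kappa>(1) \<kappa>(1) \<kappa>(1) d(1,3,4) x]) (use x d \<kappa> in auto)
  then show "tangent_map \<A> (inv_into U \<phi>) (\<phi> x) (tangent_map \<A> \<phi> x v) = v"
    by (simp add: tangent_map_eq i chart_deriv_id \<kappa>)
  show "tangent_map \<A> \<phi> x (tangent_map \<A> (inv_into U \<phi>) (\<phi> x) v) = v"
    using chart_deriv_inverse[OF \<phi> \<kappa>(1) \<kappa>(1) x \<kappa>(2) \<kappa>(2)] by (simp add: tangent_map_eq i)
qed

lemma vector_field_chart_nbhd:
  assumes "vector_field \<A> V X" "x \<in> V"
  shows "\<exists>c\<in>\<A>. \<exists>W. open W \<and> x \<in> W \<and> x \<in> fst c \<and> smooth_on (snd c ` (W \<inter> fst c)) (field_rep \<A> c X)"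
  using assms \<kappa>[of x] unfolding vector_field_def by blast

lemma vector_field_push_field:
  assumes \<phi>: "diffeomorphism \<A> U U' \<phi>" and X: "vector_field \<A> V X" "V \<subseteq> U"
  shows "vector_field \<A> (\<phi> ` V) (push_field \<A> \<phi> U X)"
proof (rule vector_field_push[OF \<phi> _ X(2) vector_field_chart_nbhd[OF X(1)]])
  show "open V" using X by (simp add: vector_field_def)
  show "push_field \<A> \<phi> U X (\<phi> x) = tangent_map \<A> \<phi> x (X x)" if "x \<in> V" for x
    using that X(2) diffeomorphism_inverse(7)[OF \<phi>] by (auto simp: push_field_def)
qed auto

lemma is_lift_push_section:
  assumes \<phi>: "diffeomorphism \<A> U U' \<phi>" and Z: "is_lift \<A> s V Z" and V: "V \<subseteq> U"
  defines "Z' \<equiv> \<lambda>y. push_frame \<A> \<phi> (inv_into U \<phi> y) (Z (inv_into U \<phi> y))"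
  shows "is_lift \<A> (push_section \<A> \<phi> U U' s) (\<phi> ` V) Z'"
    and "\<And>y b. y \<in> V \<Longrightarrow> Z' (\<phi> y) *v b = tangent_map \<A> \<phi> y (Z y *v b)"
proof -
  note d = diffeomorphism_inverse[OF \<phi>]
  have Z': "Z' (\<phi> y) = push_frame \<A> \<phi> y (Z y)" if "y \<in> V" for y
    using that V d(7) by (auto simp: Z'_def)
  show vec: "Z' (\<phi> y) *v b = tangent_map \<A> \<phi> y (Z y *v b)" if "y \<in> V" for y b
    using that V by (auto simp: Z' push_frame_vec[OF d(3)])
  have o: "open V" using Z is_lift_frame frame_field_open by blast
  have "frame_field \<A> (\<phi> ` V) Z'"
  proof (rule frame_fieldI)
    show "open (\<phi> ` V)" using \<phi> o V by (rule diffeomorphism_open_image)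
    fix y assume "y \<in> \<phi> ` V"
    then obtain x where x: "y = \<phi> x" "x \<in> V" "x \<in> U" using V by blast
    have "inj ((*v) (Z' y))"
      unfolding x(1)
      \<comment> \<open>The tangent map and the original frame are both injective, hence so is the
        pushed frame; for a square matrix this means invertible.\<close>
      by (rule injI) (metis vec[OF x(2)] tangent_map_inverse(1)[OF \<phi> x(3)] matrix_inv_vec(2)[OF is_lift_invertible[OF Z x(2)]])
    then show "invertible (Z' y)"
      using matrix_left_invertible_injective invertible_left_inverse by blast
  next
    fix b
    note vf = vector_field_frame[OF is_lift_frame[OF Z], of b]
    show "vector_field \<A> (\<phi> ` V) (\<lambda>x. Z' x *v b)"
      by (rule vector_field_push[OF \<phi> o V vector_field_chart_nbhd[OF vf] vec])
  qed
  moreover have "push_section \<A> \<phi> U U' s y = frame_orbit (Z' y) delta_GL" if y: "y \<in> \<phi> ` V" for y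
  proof -
    obtain x where x: "y = \<phi> x" "x \<in> V" "x \<in> U" using y V by blast
    have "push_section \<A> \<phi> U U' s y = push_frame \<A> \<phi> x ` frame_orbit (Z x) delta_GL"
      using x d(5,7) Z by (simp add: push_section_def is_lift_def)
    also have "\<dots> = frame_orbit (Z' y) delta_GL"
      unfolding frame_orbit_def image_image using x by (simp add: Z' push_frame_mult[OF d(3)])
    finally show ?thesis .
  qed
  ultimately show "is_lift \<A> (push_section \<A> \<phi> U U' s) (\<phi> ` V) Z'" by (simp add: is_lift_def)
qed

lemma quotient_section_push_section:
  assumes \<phi>: "diffeomorphism \<A> U U' \<phi>" and s: "quotient_section \<A> delta_GL U s"
  shows "quotient_section \<A> delta_GL U' (push_section \<A> \<phi> U U' s)"
proof (rule quotient_sectionI)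
  note d = diffeomorphism_inverse[OF \<phi>]
  show "open U'" by (rule d(2))
  show "push_section \<A> \<phi> U U' s \<in> extensional U'" by (simp add: push_section_def)
  fix y assume y: "y \<in> U'"
  obtain V Z where V: "inv_into U \<phi> y \<in> V" "V \<subseteq> U" "is_lift \<A> s V Z" using quotient_section_lift[OF s d(6)[OF y]] .
  have "y \<in> \<phi> ` V" using V(1) d(8)[OF y] by (metis imageI)
  moreover have "\<phi> ` V \<subseteq> U'" using V(2) d(5) by blast
  ultimately show "\<exists>V Z. y \<in> V \<and> V \<subseteq> U' \<and> is_lift \<A> (push_section \<A> \<phi> U U' s) V Z"
    using is_lift_push_section(1)[OF \<phi> V(3,2)] by blast
qed

text \<open>The symbols \<open>christoffel_of h\<close>, transported by the law with the Hessian of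
  \<open>\<phi>\<close>, satisfy the canonical conditions for the pushed lift. So do those of
  \<open>\<Gamma>'\<close>, and uniqueness at the point identifies them.\<close>

lemma christoffel_push:
  assumes \<phi>: "diffeomorphism \<A> U U' \<phi>" and s: "quotient_section \<A> delta_GL U s" and x: "x \<in> U"
    and \<Gamma>: "adapted_connection U s \<Gamma>" and \<Gamma>': "adapted_connection U' (push_section \<A> \<phi> U U' s) \<Gamma>'"
  shows "christoffel_apply (\<Gamma>' (\<phi> x)) (tangent_map \<A> \<phi> x v) (tangent_map \<A> \<phi> x w) =
    tangent_map \<A> \<phi> x (christoffel_apply (\<Gamma> x) v w) - chart_deriv2 (\<kappa> x) (\<kappa> (\<phi> x)) \<phi> x v w"
proof -
  note d = diffeomorphism_inverse[OF \<phi>]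
  let ?J = "tangent_map \<A> \<phi> x" and ?K = "tangent_map \<A> (inv_into U \<phi>) (\<phi> x)" and ?Q = "chart_deriv2 (\<kappa> x) (\<kappa> (\<phi> x)) \<phi> x"
  note J = linear_tangent_map[OF d(3) x] and K = linear_tangent_map[OF d(4) d(5)[OF x]]
  have Q: "bilinear ?Q"
    by (rule chart_deriv2(1)[OF \<kappa>(1) \<kappa>(1) d(1,3) x \<kappa>(2) \<kappa>(2)])
  note G = bilinear_christoffel_apply[of "\<Gamma> x"]
  define h where "h a b = ?J (christoffel_apply (\<Gamma> x) (?K a) (?K b)) - ?Q (?K a) (?K b)" for a b
  have "bilinear h"
    unfolding bilinear_def h_def
    by (auto intro!: linearI simp: linear_add[OF J] linear_add[OF K] linear_scale[OF J] linear_scale[OF K]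
        bilinear_ladd[OF Q] bilinear_radd[OF Q] bilinear_lmul[OF Q] bilinear_rmul[OF Q]
        bilinear_ladd[OF G] bilinear_radd[OF G] bilinear_lmul[OF G] bilinear_rmul[OF G] scaleR_diff_right)
  then have h: "christoffel_apply (christoffel_of h) (?J v) (?J w) = ?J (christoffel_apply (\<Gamma> x) v w) - ?Q v w" for v w
    by (simp add: christoffel_apply_of h_def tangent_map_inverse(1)[OF \<phi> x])
  obtain V Z where V: "x \<in> V" "V \<subseteq> U" "is_lift \<A> s V Z" using quotient_section_lift[OF s x] .
  let ?Z' = "\<lambda>y. push_frame \<A> \<phi> (inv_into U \<phi> y) (Z (inv_into U \<phi> y))"
  have Z': "is_lift \<A> (push_section \<A> \<phi> U U' s) (\<phi> ` V) ?Z'"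
    "\<And>y b. y \<in> V \<Longrightarrow> ?Z' (\<phi> y) *v b = tangent_map \<A> \<phi> y (Z y *v b)"
    using is_lift_push_section[OF \<phi> V(3,2)] by auto
  have \<phi>x: "\<phi> x \<in> \<phi> ` V" using V(1) by blast
  have "canonical_in (\<kappa> (\<phi> x)) (\<phi> x) ?Z' (christoffel_of h)"
    by (rule canonical_in_push[OF \<phi> \<kappa>(1) \<kappa>(1) x \<kappa>(2) \<kappa>(2) V(1) is_lift_frame[OF V(3)] Z'(2) is_lift_frame[OF Z'(1)] \<phi>x
          adapted_connectionD[OF \<Gamma> x V(1,3)]])
       (simp_all add: h flip: tangent_map_eq)
  moreover have "canonical_in (\<kappa> (\<phi> x)) (\<phi> x) ?Z' (\<Gamma>' (\<phi> x))"
    by (rule adapted_connectionD[OF \<Gamma>' d(5)[OF x] \<phi>x Z'(1)])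
  ultimately have "\<Gamma>' (\<phi> x) = christoffel_of h"
    using canonical_in_iff[OF is_lift_frame[OF Z'(1)] \<kappa>(1) \<phi>x \<kappa>(2)] by simp
  then show ?thesis by (simp add: h)
qed

lemma push_adapted_connection:
  assumes \<phi>: "diffeomorphism \<A> U U' \<phi>" and s: "quotient_section \<A> delta_GL U s"
    and \<Gamma>: "adapted_connection U s \<Gamma>" and \<Gamma>': "adapted_connection U' (push_section \<A> \<phi> U U' s) \<Gamma>'"
  shows "push_connection \<A> \<phi> U U' \<Gamma> = \<Gamma>'"
  unfolding push_connection_def
proof (rule the_equality)
  note d = diffeomorphism_inverse[OF \<phi>]
  have push: "push_field \<A> \<phi> U X (\<phi> x) = tangent_map \<A> \<phi> x (X x)" if "x \<in> U" for X x
    using that d(7) by (simp add: push_field_def)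
  \<comment> \<open>The Hessian appears with opposite signs in the derivative of the pushed field
    and in the pushed Christoffel symbols, and cancels.\<close>
  have nat: "cov_deriv \<A> \<Gamma>' (push_field \<A> \<phi> U X) (push_field \<A> \<phi> U Y) (\<phi> x) = tangent_map \<A> \<phi> x (cov_deriv \<A> \<Gamma> X Y x)"
    if V: "V \<subseteq> U" "x \<in> V" and XY: "vector_field \<A> V Y" for V X Y x
  proof -
    have x: "x \<in> U" using V by blast
    have "component_deriv \<A> (\<phi> x) (tangent_map \<A> \<phi> x (X x)) (push_field \<A> \<phi> U Y) =
      tangent_map \<A> \<phi> x (component_deriv \<A> x (X x) Y) + chart_deriv2 (\<kappa> x) (\<kappa> (\<phi> x)) \<phi> x (X x) (Y x)"
      using field_rep_push_derivative[OF \<kappa>(1) \<kappa>(1) d(1,3) x \<kappa>(2) \<kappa>(2) d(1) x push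
          vector_field_differentiable[OF XY \<kappa>(1) V(2) \<kappa>(2)]
          vector_field_differentiable[OF vector_field_push_field[OF \<phi> XY V(1)] \<kappa>(1) imageI[OF V(2)] \<kappa>(2)]]
      by (simp add: component_deriv_def tangent_map_eq)
    then show ?thesis
      using christoffel_push[OF \<phi> s x \<Gamma> \<Gamma>', of "X x" "Y x"] linear_add[OF linear_tangent_map[OF d(3) x]]
      by (simp add: cov_deriv_def cov_deriv_at_def push[OF x])
  qed
  have lin: "linear_connection \<A> U' \<Gamma>'" using \<Gamma>' by (simp add: adapted_connection_def)
  then show "linear_connection \<A> U' \<Gamma>' \<and> (\<forall>V X Y. V \<subseteq> U \<longrightarrow> vector_field \<A> V X \<longrightarrow> vector_field \<A> V Y \<longrightarrow>
      (\<forall>x\<in>V. cov_deriv \<A> \<Gamma>' (push_field \<A> \<phi> U X) (push_field \<A> \<phi> U Y) (\<phi> x) = tangent_map \<A> \<phi> x (cov_deriv \<A> \<Gamma> X Y x)))"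
    using nat by blast
  fix \<Gamma>1 assume \<Gamma>1: "linear_connection \<A> U' \<Gamma>1 \<and> (\<forall>V X Y. V \<subseteq> U \<longrightarrow> vector_field \<A> V X \<longrightarrow> vector_field \<A> V Y \<longrightarrow>
      (\<forall>x\<in>V. cov_deriv \<A> \<Gamma>1 (push_field \<A> \<phi> U X) (push_field \<A> \<phi> U Y) (\<phi> x) = tangent_map \<A> \<phi> x (cov_deriv \<A> \<Gamma> X Y x)))"
  show "\<Gamma>1 = \<Gamma>'"
  proof (rule extensionalityI)
    show "\<Gamma>1 \<in> extensional U'" "\<Gamma>' \<in> extensional U'" using \<Gamma>1 lin by (auto simp: linear_connection_def)
    fix y assume y: "y \<in> U'"
    define x where "x = inv_into U \<phi> y"
    have x: "x \<in> U" "y = \<phi> x" using d y by (auto simp: x_def)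
    show "\<Gamma>1 y = \<Gamma>' y"
    proof (rule christoffel_eqI)
      fix v w
      \<comment> \<open>Test fields constant in the chosen chart at \<open>x\<close>, normalised so
        that the push-forward has value \<open>u\<close> at \<open>\<phi> x\<close>. Two connections
        that agree on the pushed fields share the derivative term, so their Christoffel symbols
        agree.\<close>
      define X where "X u p = from_coords \<A> (\<kappa> x) p (tangent_map \<A> (inv_into U \<phi>) (\<phi> x) u)" for u p
      define V where "V = U \<inter> fst (\<kappa> x)"
      have V: "V \<subseteq> U" "x \<in> V" "open V" using x(1) \<kappa> d(1) chart(1)[OF \<kappa>(1)] by (auto simp: V_def)
      have XV: "vector_field \<A> V (X u)" for u
        unfolding X_def by (rule vector_field_const_coords[OF \<kappa>(1) V(3)]) (auto simp: V_def)
      have JX: "push_field \<A> \<phi> U (X u) (\<phi> x) = u" for u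
        by (simp add: push[OF x(1)] X_def from_coords_eq chart_deriv_id \<kappa> tangent_map_inverse(2)[OF \<phi> x(1)])
      have "cov_deriv \<A> \<Gamma>1 (push_field \<A> \<phi> U (X v)) (push_field \<A> \<phi> U (X w)) (\<phi> x) =
          cov_deriv \<A> \<Gamma>' (push_field \<A> \<phi> U (X v)) (push_field \<A> \<phi> U (X w)) (\<phi> x)"
        using \<Gamma>1 V XV nat[OF V(1,2) XV] by metis
      then show "christoffel_apply (\<Gamma>1 y) v w = christoffel_apply (\<Gamma>' y) v w"
        by (simp add: cov_deriv_def cov_deriv_at_def JX x(2))
    qed
  qed
qed

end

section \<open>Dependence on the first jet\<close>

lemma multi_partial_empty [simp]: "multi_partial {#} f = f"
  by (simp add: multi_partial_def)

lemma multi_partial_single [simp]: "multi_partial {#l#} f y = frechet_derivative f (at y) (axis l 1)"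
proof -
  have "(SOME xs. mset xs = {#l#}) = [l]" by (rule some_equality) auto
  then show ?thesis by (simp add: multi_partial_def)
qed

text \<open>This and the next definition read off the value and the first partial derivatives of a
  frame field from the fibre coordinates of orders 0 and 1.\<close>

definition jet_frame :: "('m jet_index \<Rightarrow> real) \<Rightarrow> real^'m^'m::finite" where
  "jet_frame p = (\<chi> k i. p (Fibre {#} k i))"

definition jet_deriv :: "('m jet_index \<Rightarrow> real) \<Rightarrow> real^'m^'m^'m::finite" where
  "jet_deriv p = (\<chi> l k i. p (Fibre {#l#} k i))"

definition deriv_of :: "real^'m^'m^'m \<Rightarrow> real^'m \<Rightarrow> real^'m^'m::finite" where
  "deriv_of d v = (\<Sum>l\<in>UNIV. v $ l *\<^sub>R d $ l)"

text \<open>Partial derivatives in jet coordinates reduce to Frechet derivatives when the function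
  factors through a map \<open>L\<close> that is affine in each coordinate, with slope
  \<open>a i\<close>. The factorisation is assumed wherever \<open>L p\<close> lies in
  \<open>S\<close>, since varying one coordinate may leave \<open>D\<close>.\<close>

lemma coord_differentiable_upto_compose:
  assumes S: "open S" and L: "continuous_on UNIV L" "\<And>p i t. L (p(i := t)) = L p + (t - p i) *\<^sub>R a i" "L ` D \<subseteq> S"
  shows "differentiable_upto k S g \<Longrightarrow> (\<And>p. L p \<in> S \<Longrightarrow> f p = g (L p)) \<Longrightarrow> coord_differentiable_upto k I D f"
proof (induction k arbitrary: f g)
  case 0
  have "continuous_on D (\<lambda>p. g (L p))"
    using 0 L continuous_on_compose2[of S g D L] continuous_on_subset[OF L(1) subset_UNIV] by simp
  moreover have "continuous_on D f \<longleftrightarrow> continuous_on D (\<lambda>p. g (L p))"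
    by (rule continuous_on_cong) (use 0 L(3) in auto)
  ultimately show ?case by simp
next
  case (Suc k)
  have "continuous_on S g" using Suc.prems(1) by (rule differentiable_upto_imp_continuous)
  then have "continuous_on D (\<lambda>p. g (L p))"
    using L continuous_on_compose2[of S g D L] continuous_on_subset[OF L(1) subset_UNIV] by simp
  moreover have "continuous_on D f \<longleftrightarrow> continuous_on D (\<lambda>p. g (L p))"
    by (rule continuous_on_cong) (use Suc.prems(2) L(3) in auto)
  ultimately have cont: "continuous_on D f" by simp
  have der: "((\<lambda>t. f (p(i := t))) has_vector_derivative frechet_derivative g (at (L p)) (a i)) (at (p i))"
    if p: "L p \<in> S" for p i
  proof -
    define l where "l t = L p + (t - p i) *\<^sub>R a i" for t
    have l: "(l has_derivative (\<lambda>t. t *\<^sub>R a i)) (at (p i))" "l (p i) = L p"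
      unfolding l_def[abs_def] by (auto intro!: derivative_eq_intros)
    have g: "(g has_derivative frechet_derivative g (at (L p))) (at (l (p i)))"
      unfolding l(2) using Suc.prems(1) p by (rule differentiable_upto_has_derivative)
    have "continuous_on UNIV l" unfolding l_def[abs_def] by (intro continuous_intros)
    then have o: "open (l -` S)" using S by (simp add: open_vimage)
    have i: "p i \<in> l -` S" using p l(2) by simp
    have e: "g (l t) = f (p(i := t))" if "t \<in> l -` S" for t
    proof -
      have "L (p(i := t)) = l t" unfolding L(2) l_def ..
      then show ?thesis using that Suc.prems(2)[of "p(i := t)"] by (simp only: vimage_eq)
    qed
    have "((\<lambda>t. f (p(i := t))) has_derivative (\<lambda>t. frechet_derivative g (at (L p)) (t *\<^sub>R a i))) (at (p i))"
      using has_derivative_transform_within_open[OF has_derivative_compose[OF l(1) g] o i e] .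
    then show ?thesis
      using linear_scale[OF has_derivative_linear[OF g]] by (simp add: has_vector_derivative_def)
  qed
  show ?case
    unfolding coord_differentiable_upto.simps
  proof (intro conjI ballI cont)
    fix i p assume "p \<in> D"
    then have "L p \<in> S" using L(3) by blast
    from der[OF this, of i] show "(\<lambda>t. f (p(i := t))) differentiable at (p i)"
      unfolding has_vector_derivative_def differentiable_def by blast
  next
    fix i
    show "coord_differentiable_upto k I D (\<lambda>p. vector_derivative (\<lambda>t. f (p(i := t))) (at (p i)))"
    proof (rule Suc.IH[of "\<lambda>y. frechet_derivative g (at y) (a i)"])
      show "differentiable_upto k S (\<lambda>y. frechet_derivative g (at y) (a i))" using Suc.prems(1) by simp
      show "vector_derivative (\<lambda>t. f (p(i := t))) (at (p i)) = frechet_derivative g (at (L p)) (a i)" if "L p \<in> S" for p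
        by (rule vector_derivative_at[OF der[OF that]])
    qed
  qed
qed

lemma coord_smooth_on_canonical_christoffel:
  "coord_smooth_on I (frame_jet_domain r c)
     (\<lambda>p. canonical_christoffel (jet_frame p) (deriv_of (jet_deriv p)) :: ('n::finite + 'n) christoffel)"
proof -
  define S :: "((real^('n + 'n)^('n + 'n)) \<times> (real^('n + 'n)^('n + 'n)^('n + 'n))) set" where
    "S = fst -` {z. invertible z}"
  have S: "open S" unfolding S_def using open_invertible by (intro open_vimage) (auto intro: continuous_intros)
  have sm1: "smooth_on S fst" and sm2: "smooth_on S snd"
    using smooth_on_linear[OF bounded_linear_fst S smooth_on_ident[OF S]]
      smooth_on_linear[OF bounded_linear_snd S smooth_on_ident[OF S]] by auto
  have "smooth_on S (\<lambda>q. canonical_christoffel (fst q) (deriv_of (snd q)))"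
  proof (rule smooth_on_canonical_christoffel[OF S sm1])
    show "invertible (fst q)" if "q \<in> S" for q using that by (simp add: S_def)
    show "smooth_on S (\<lambda>q. deriv_of (snd q) (u q))" if "smooth_on S u" for u
      unfolding deriv_of_def using that sm2 by (intro smooth_on_sum smooth_on_scaleR smooth_on_vec_nth S)
  qed
  then have g: "differentiable_upto k S (\<lambda>q. canonical_christoffel (fst q) (deriv_of (snd q)))" for k
    by (simp add: smooth_on_def)
  let ?L = "\<lambda>p :: ('n + 'n) jet_index \<Rightarrow> real. (jet_frame p, jet_deriv p)"
  \<comment> \<open>\<open>?L\<close> is linear in the jet coordinates, so its slope in a coordinate
    is its value at the corresponding unit jet.\<close>
  define a :: "('n + 'n) jet_index \<Rightarrow> _" where "a i = ?L (\<lambda>j. if j = i then 1 else 0)" for i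
  have c: "continuous_on UNIV ?L"
    unfolding jet_frame_def jet_deriv_def
    by (intro continuous_on_Pair continuous_on_vec_lambda continuous_on_product_coordinates)
  have L: "?L (p(i := t)) = ?L p + (t - p i) *\<^sub>R a i" for p i t
    by (auto simp: a_def jet_frame_def jet_deriv_def vec_eq_iff)
  have dom: "?L ` frame_jet_domain r c \<subseteq> S"
    by (auto simp: S_def frame_jet_domain_def jet_frame_def)
  show ?thesis
    unfolding coord_smooth_on_def
    using coord_differentiable_upto_compose[OF S c L dom g] by simp
qed

context double_manifold
begin

lemma frame_jet_coords_1:
  assumes "c \<in> \<A>" "x \<in> fst c" "x \<in> V" "frame_field \<A> V Z" "r \<ge> 1"
  shows "jet_frame (frame_jet_coords \<A> r c x Z) = frame_coords \<A> c x (Z x)"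
    "deriv_of (jet_deriv (frame_jet_coords \<A> r c x Z)) = frame_deriv_at \<A> c x Z"
proof -
  show "jet_frame (frame_jet_coords \<A> r c x Z) = frame_coords \<A> c x (Z x)"
    using assms by (simp add: jet_frame_def frame_jet_coords_def frame_rep_apply)
  have "jet_deriv (frame_jet_coords \<A> r c x Z) $ l = frame_deriv_at \<A> c x Z (axis l 1)" for l
    using assms by (simp add: jet_deriv_def frame_jet_coords_def frame_deriv_at_def vec_eq_iff)
  then have "deriv_of (jet_deriv (frame_jet_coords \<A> r c x Z)) v = frame_deriv_at \<A> c x Z v" for v
  proof -
    note lin = linear_frame_deriv_at[OF assms(4,1,3,2)]
    have "v = (\<Sum>l\<in>UNIV. v $ l *\<^sub>R axis l 1)"
      by (simp add: basis_expansion flip: scalar_mult_eq_scaleR)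
    then have "frame_deriv_at \<A> c x Z v = frame_deriv_at \<A> c x Z (\<Sum>l\<in>UNIV. v $ l *\<^sub>R axis l 1)"
      by (rule arg_cong)
    also have "\<dots> = (\<Sum>l\<in>UNIV. v $ l *\<^sub>R frame_deriv_at \<A> c x Z (axis l 1))"
      by (simp only: linear_sum[OF lin] linear_scale[OF lin])
    finally show ?thesis
      using \<open>\<And>l. jet_deriv _ $ l = _\<close> by (simp add: deriv_of_def)
  qed
  then show "deriv_of (jet_deriv (frame_jet_coords \<A> r c x Z)) = frame_deriv_at \<A> c x Z" by blast
qed

lemma canonical_conn_lift:
  assumes "quotient_section \<A> delta_GL U s" "x \<in> U" "x \<in> V" "is_lift \<A> s V Z"
  shows "canonical_conn U s x =
    canonical_christoffel (frame_coords \<A> (\<kappa> x) x (Z x)) (frame_deriv_at \<A> (\<kappa> x) x Z)"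
  using adapted_connectionD[OF adapted_canonical_conn[OF assms(1)] assms(2-4)]
    canonical_in_iff[OF is_lift_frame[OF assms(4)] \<kappa>(1) assms(3) \<kappa>(2)] by simp

text \<open>Equal 1-jets of lifts mean equal values and first derivatives in the chosen chart, which
  are the only arguments of the explicit formula.\<close>

lemma canonical_conn_same_jet:
  assumes s: "quotient_section \<A> delta_GL U s" "x \<in> U" and s': "quotient_section \<A> delta_GL U' s'" "x \<in> U'"
    and jet: "same_jet \<A> delta_GL 1 x s s'"
  shows "canonical_conn U s x = canonical_conn U' s' x"
proof -
  obtain V Z Z' where V: "x \<in> V" "frame_field \<A> V Z" "frame_field \<A> V Z'"
    "\<forall>y\<in>V. s y = frame_orbit (Z y) delta_GL \<and> s' y = frame_orbit (Z' y) delta_GL"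
    and j: "frame_jet_coords \<A> 1 (\<kappa> x) x Z = frame_jet_coords \<A> 1 (\<kappa> x) x Z'"
    using jet unfolding same_jet_def by blast
  have lifts: "is_lift \<A> s V Z" "is_lift \<A> s' V Z'" using V by (auto simp: is_lift_def)
  show ?thesis
    unfolding canonical_conn_lift[OF s V(1) lifts(1)] canonical_conn_lift[OF s' V(1) lifts(2)]
    using frame_jet_coords_1[OF \<kappa>(1) \<kappa>(2) V(1,2) order_refl] frame_jet_coords_1[OF \<kappa>(1) \<kappa>(2) V(1,3) order_refl] j
    by simp
qed

text \<open>A jet is a class of local sections, and the connection of any representative is
  evaluated at the base point; \<open>canonical_conn_same_jet\<close> makes the choice
  immaterial.\<close>

definition jet_conn :: "('a, 'n + 'n) quotient_jet \<Rightarrow> ('n + 'n) christoffel" where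
  "jet_conn j = (case SOME p. p \<in> snd j of (U, s) \<Rightarrow> canonical_conn U s (fst j))"

lemma jet_conn:
  assumes s: "quotient_section \<A> delta_GL U s" "x \<in> U"
  shows "jet_conn (quotient_jet \<A> delta_GL 1 x s) = canonical_conn U s x"
proof -
  obtain V Z where V: "x \<in> V" "V \<subseteq> U" "is_lift \<A> s V Z" using quotient_section_lift[OF s] .
  then have "same_jet \<A> delta_GL 1 x s s" unfolding same_jet_def is_lift_def by blast
  then have "(U, s) \<in> snd (quotient_jet \<A> delta_GL 1 x s)" using s by (simp add: quotient_jet_def)
  then have "(SOME p. p \<in> snd (quotient_jet \<A> delta_GL 1 x s)) \<in> snd (quotient_jet \<A> delta_GL 1 x s)"
    by (rule someI)
  then obtain U' s' where *: "(SOME p. p \<in> snd (quotient_jet \<A> delta_GL 1 x s)) = (U', s')"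
    "quotient_section \<A> delta_GL U' s'" "x \<in> U'" "same_jet \<A> delta_GL 1 x s s'"
    by (auto simp: quotient_jet_def)
  have "jet_conn (quotient_jet \<A> delta_GL 1 x s) = canonical_conn U' s' x"
    unfolding jet_conn_def *(1) by (simp add: quotient_jet_def)
  then show ?thesis using canonical_conn_same_jet[OF s *(2-4)] by simp
qed

lemma smooth_jet_conn: "smooth_on_quotient_jets \<A> delta_GL 1 jet_conn"
  unfolding smooth_on_quotient_jets_def
proof (intro ballI exI conjI allI impI)
  fix c V Z x assume c: "c \<in> \<A>" and x: "x \<in> V" and V: "V \<subseteq> fst c" and Z: "frame_field \<A> V Z"
  let ?s = "\<lambda>y\<in>V. frame_orbit (Z y) delta_GL"
  have lift: "is_lift \<A> ?s V Z" using Z by (simp add: is_lift_def)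
  have s: "quotient_section \<A> delta_GL V ?s"
    using lift frame_field_open[OF Z] by (intro quotient_sectionI) auto
  have xc: "x \<in> fst c" using x V by blast
  have "canonical_in c x Z (conn_coords \<A> c x (canonical_conn V ?s x))"
    by (rule canonical_in_conn_coords[OF c xc Z x adapted_connectionD[OF adapted_canonical_conn[OF s] x x lift]])
  \<comment> \<open>The coordinate expression left open by \<open>exI\<close> is fixed here as the
    explicit formula in the 1-jet coordinates of a frame field in the chart
    \<open>c\<close>.\<close>
  then show "conn_coords \<A> c x (jet_conn (quotient_jet \<A> delta_GL 1 x ?s)) =
      canonical_christoffel (jet_frame (frame_jet_coords \<A> 1 c x Z)) (deriv_of (jet_deriv (frame_jet_coords \<A> 1 c x Z)))"
    unfolding jet_conn[OF s x] frame_jet_coords_1[OF c xc x Z order_refl] canonical_in_iff[OF Z c x xc] .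
qed (rule coord_smooth_on_canonical_christoffel)

end

theorem theorem12:
  fixes \<A> :: "('a::{t2_space, second_countable_topology}, 'n::finite + 'n) chart set"
  assumes "smooth_atlas \<A>"
  shows "functorial_connection \<A> delta_GL
    (\<lambda>U \<sigma>. case structure_of_section \<A> U \<sigma> of (F, P) \<Rightarrow> canonical_connection \<A> U F P)"
proof -
  interpret double_manifold \<A> by unfold_locales (rule assms)
  have "functorial_connection \<A> delta_GL canonical_conn"
    unfolding functorial_connection_def
  proof (intro conjI allI impI)
    fix U V s assume "quotient_section \<A> delta_GL U s" "open V" "V \<subseteq> U"
    then show "canonical_conn V (restrict s V) = restrict (canonical_conn U s) V"
      by (rule canonical_conn_restrict)
  next
    fix U s assume s: "quotient_section \<A> delta_GL U s"
    note ad = adapted_canonical_conn[OF s]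
    show "linear_connection \<A> U (canonical_conn U s)" using ad by (simp add: adapted_connection_def)
    show "reducible_to \<A> (canonical_conn U s) (G_structure delta_GL U s)"
      using s ad by (rule reducible_adapted_connection)
  next
    fix U U' \<phi> s assume \<phi>: "diffeomorphism \<A> U U' \<phi>" and s: "quotient_section \<A> delta_GL U s"
    show "canonical_conn U' (push_section \<A> \<phi> U U' s) = push_connection \<A> \<phi> U U' (canonical_conn U s)"
      using push_adapted_connection[OF \<phi> s adapted_canonical_conn[OF s]
          adapted_canonical_conn[OF quotient_section_push_section[OF \<phi> s]]] by simp
  next
    show "\<exists>r nabla_r. smooth_on_quotient_jets \<A> delta_GL r nabla_r \<and>
        (\<forall>U s x. quotient_section \<A> delta_GL U s \<longrightarrow> x \<in> U \<longrightarrow> nabla_r (quotient_jet \<A> delta_GL r x s) = canonical_conn U s x)"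
      \<comment> \<open>The order is 1: the formula involves the frame and its first
        derivatives.\<close>
      using smooth_jet_conn jet_conn by blast
  qed
  then show ?thesis by (simp add: canonical_conn_def[abs_def])
qed

end
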